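(* Let $f\in\mathbb{K}[x,y]$ be a minimal polynomial with parameters $(d_y,d_x,c)$. Denote by $V$ the euclidean volume (area) of $P(f)$. Suppose that $d_y\ge 2$. Then the following assertions are equivalent: \begin{enumerate} \item $V=V_{\min}$; \item $d_x=d_{x,\min}$ and $c=c_{\min}$; \item $d_y$ does not divide $d_x-c$. \end{enumerate}
   Context: $\mathbb{K}$ is an algebraically closed field of characteristic zero. For $f\in\mathbb{K}[x,y]$, $d_x=\deg_x f$, $d_y=\deg_y f$, and $\Delta_y(f)\in\mathbb{K}[x]$ is the discriminant with respect to $y$. $f$ is minimal if it is irreducible and $\deg_x\Delta_y(f)=d_y-1$. The generic Newton polytope of $f$ is the convex hull $P(f)=\mathrm{Conv}\big(\{(0,0),(0,d_y)\}\cup \mathrm{Supp}(f)\big)\subset\mathbb{R}^2$, where $\mathrm{Supp}(f)$ is the set of exponents $(i,j)$ of monomials $x^iy^j$ appearing in $f$. Let $a=a(f)$ and $b=b(f)$ be the degrees in $x$ of, respectively, the constant coefficient and the leading coefficient of $f$ seen as a polynomial in $y$; put $c=c(f)=\min(a,b)$. (For minimal $f$ one has $d_x=\max(a,b)$.) Let $G=GL_2(\mathbb{K}[x])$ act on irreducible polynomials with $d_y>1$ by \[ \begin{pmatrix} \alpha & \beta \\ \gamma & \delta \end{pmatrix}(f)=(\gamma y+\delta)^{d_y} f\Big(x,\frac{\alpha y+\beta}{\gamma y+\delta}\Big), \] and write $f\equiv g$ if $f=\sigma(g)$ for some $\sigma\in G$. For a function $n:\mathbb{K}[x,y]\to\mathbb{Q}_{\ge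 0}$ put $n_{\min}(f)=\inf\{n(g): g\equiv f\}$; this is applied to $n=V$ (area of the generic Newton polytope), $n=d_x$ and $n=c$, giving $V_{\min}$, $d_{x,\min}$, $c_{\min}$ for the given $f$. Zero is divisible by $d_y$. *)

theory Defs
  imports "HOL-Analysis.Analysis" "Subresultants.Resultant_Prelim"
begin

text \<open>
  A polynomial in two variables x, y is an element of type 'a poly poly: the outer
  variable is y, and the coefficients are polynomials in x. So \<open>degree f\<close> is the
  degree in y, and \<open>coeff (coeff f j) i\<close> is the coefficient of x^i y^j.
\<close>

definition deg_x :: "'a::zero poly poly \<Rightarrow> nat" where
  "deg_x f = Max ((\<lambda>j. degree (coeff f j)) ` {..degree f})"

text \<open>
  The classical discriminant \<open>(-1)^(d(d-1)/2) Res(f, f') / lc(f)\<close> of a polynomial of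
  degree d; the division is exact for d \<open>\<ge>\<close> 1 over a domain of characteristic zero.
\<close>

definition discriminant :: "'a::idom_divide poly \<Rightarrow> 'a" where
  "discriminant f =
     (-1) ^ (degree f * (degree f - 1) div 2) * (resultant f (pderiv f) div lead_coeff f)"

definition minimal_poly2 :: "'a::field poly poly \<Rightarrow> bool" where
  "minimal_poly2 f \<longleftrightarrow> irreducible f \<and> int (degree (discriminant f)) = int (degree f) - 1"

definition supp :: "'a::zero poly poly \<Rightarrow> (nat \<times> nat) set" where
  "supp f = {(i, j). coeff (coeff f j) i \<noteq> 0}"

definition generic_newton_polytope :: "'a::zero poly poly \<Rightarrow> (real \<times> real) set" where
  "generic_newton_polytope f =
     convex hull ({(0, 0), (0, real (degree f))} \<union> (\<lambda>(i, j). (real i, real j)) ` supp f)"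

definition newton_area :: "'a::zero poly poly \<Rightarrow> real" where
  "newton_area f = measure lborel (generic_newton_polytope f)"

text \<open>
  The constant coefficient (with respect to y) of an irreducible f with \<open>degree f \<ge> 2\<close> is
  nonzero, so the convention \<open>degree 0 = 0\<close> plays no role here.
\<close>

definition a_deg :: "'a::zero poly poly \<Rightarrow> nat" where
  "a_deg f = degree (coeff f 0)"

definition b_deg :: "'a::zero poly poly \<Rightarrow> nat" where
  "b_deg f = degree (lead_coeff f)"

definition c_deg :: "'a::zero poly poly \<Rightarrow> nat" where
  "c_deg f = min (a_deg f) (b_deg f)"

definition GL2 :: "'a::comm_ring_1 poly mat set" where
  "GL2 = {A \<in> carrier_mat 2 2. invertible_mat A}"

text \<open>
  With the matrix entries \<open>\<alpha> = A(0,0)\<close>, \<open>\<beta> = A(0,1)\<close>, \<open>\<gamma> = A(1,0)\<close>, \<open>\<delta> = A(1,1)\<close>, this is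
  \<open>(\<gamma> y + \<delta>)^d f(x, (\<alpha> y + \<beta>) / (\<gamma> y + \<delta>))\<close> for d the degree of f in y, with
  denominators cleared.
\<close>

definition GL2_act :: "'a::comm_ring_1 poly mat \<Rightarrow> 'a poly poly \<Rightarrow> 'a poly poly" where
  "GL2_act A f =
     (\<Sum>j\<le>degree f. Polynomial.smult (coeff f j)
        ([:A $$ (0,1), A $$ (0,0):] ^ j * [:A $$ (1,1), A $$ (1,0):] ^ (degree f - j)))"

definition GL2_equiv :: "'a::field poly poly \<Rightarrow> 'a poly poly \<Rightarrow> bool" where
  "GL2_equiv f g \<longleftrightarrow>
     irreducible f \<and> degree f > 1 \<and> irreducible g \<and> degree g > 1 \<and>
     (\<exists>A\<in>GL2. f = GL2_act A g)"

definition orbit_min :: "('a::field poly poly \<Rightarrow> real) \<Rightarrow> 'a poly poly \<Rightarrow> real" where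
  "orbit_min n f = Inf {n g | g. GL2_equiv g f}"

end

theory Submission
  imports Defs "HOL-Algebra.Algebraic_Closure_Type" "Subresultants.Subresultant" "HOL-Library.Function_Algebras"
begin

hide_const (open) Polynomials.degree Polynomials.lead_coeff Divisibility.irreducible
  up_ring.coeff up_ring.monom Coset.order module.smult

text \<open>
  Let \<open>d\<close> be the degree of \<open>f\<close> in \<open>y\<close>, and \<open>a\<close>, \<open>b\<close> the degrees in \<open>x\<close> of its constant and leading coefficients. All comes
  down to one geometric property of a minimal \<open>f\<close>: the curve \<open>f = 0\<close> has only one place over \<open>x = \<infinity>\<close>
  (\<open>one_place_at_infinity\<close>), so that a rational function on the curve that is finite over infinity has a single value there.

  This has two consequences. First, all roots of \<open>f\<close> in the algebraic closure of \<open>K(x)\<close> have the same order at infinity, hence the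
  Newton polygon of \<open>f\<close> at infinity is one edge from \<open>(a, 0)\<close> to \<open>(b, d)\<close> (\<open>newton_polygon_slope\<close>), the generic Newton polytope is a
  trapezoid of area \<open>d (a + b) / 2\<close>, and \<open>d_x = max a b\<close>. Secondly, if \<open>d\<close> divides \<open>a - b\<close>, then the roots, or their reciprocals,
  are \<open>c x^m + o(x^m)\<close> with a common constant \<open>c\<close> and a natural number \<open>m\<close>. The translation that removes \<open>c x^m\<close> pushes the whole support
  except the leading coefficient strictly below the edge; it lowers the area and one of \<open>d_x\<close> and \<open>c\<close> (\<open>exists_reduction\<close>), so neither
  minimality statement holds.

  If \<open>d\<close> does not divide \<open>a - b\<close>, then no cancellation is possible under the action of \<open>GL2\<close>: the extreme coefficients of a transformed
  polynomial are values of the binary form attached to \<open>f\<close>, and in each of them one of the two extreme terms dominates, because their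
  degrees are never equal (\<open>form_degree\<close>). As rows and columns of an invertible matrix are nonzero, neither the minimum nor the maximum of
  the two degrees can drop (\<open>orbit_lower_bounds\<close>). Since the polytope of every polynomial contains the trapezoid of its extreme
  coefficients, the area cannot drop either.

  The property of having one place is what the Riemann-Hurwitz formula says about a curve whose discriminant has degree less than \<open>d\<close>. The
  proof here is a direct form of Serre duality. If some function \<open>w\<close> took two values over infinity, then a linear functional \<open>\<phi>\<close> on the
  function field would be nonzero at \<open>w\<close> and annihilate all functions regular on the affine part as well as all functions vanishing over
  infinity. Such a functional is the residue pairing with a differential \<open>g dx / f_y\<close> (\<open>residue_duality\<close>), where \<open>g\<close> has degree at most
  \<open>d - 2\<close> in \<open>y\<close>, with at most simple poles over infinity (\<open>u_bound\<close>). Taking norms, with resultants as norms, shows that the discriminant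
  has degree at least \<open>d\<close> (\<open>\<phi>_vanishes\<close>). Orders at infinity are measured by a valuation ring of the algebraic closure of \<open>K(x)\<close>,
  obtained from Zorn's lemma (\<open>exists_valuation_ring\<close>), and integrality over \<open>K[x]\<close> by the valuation rings that contain \<open>K[x]\<close>.
\<close>

section \<open>Valuation rings of a field\<close>

definition subring_set :: "'m::field set \<Rightarrow> bool" where
  "subring_set S \<longleftrightarrow> 1 \<in> S \<and> (\<forall>a\<in>S. \<forall>b\<in>S. a - b \<in> S \<and> a * b \<in> S)"

definition valuation_ring :: "'m::field set \<Rightarrow> bool" where
  "valuation_ring V \<longleftrightarrow> subring_set V \<and> (\<forall>z. z \<in> V \<or> inverse z \<in> V)"

text \<open>
The nonunits. As \<open>inverse 0 = 0\<close> lies in \<open>V\<close>, the element 0 has to be named.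
\<close>

definition max_ideal :: "'m::field set \<Rightarrow> 'm set" where
  "max_ideal V = {z. z = 0 \<or> inverse z \<notin> V}"

lemma subring_set_closed:
  assumes "subring_set S"
  shows "1 \<in> S" "0 \<in> S"
    and "a \<in> S \<Longrightarrow> b \<in> S \<Longrightarrow> a - b \<in> S"
    and "a \<in> S \<Longrightarrow> b \<in> S \<Longrightarrow> a + b \<in> S"
    and "a \<in> S \<Longrightarrow> b \<in> S \<Longrightarrow> a * b \<in> S"
    and "a \<in> S \<Longrightarrow> - a \<in> S"
    and "a \<in> S \<Longrightarrow> a ^ n \<in> S"
    and "(\<And>i. i \<in> I \<Longrightarrow> f i \<in> S) \<Longrightarrow> sum f I \<in> S"
    and "(\<And>i. i \<in> I \<Longrightarrow> f i \<in> S) \<Longrightarrow> prod f I \<in> S"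
proof -
  show 1: "1 \<in> S" using assms by (auto simp: subring_set_def)
  show diff: "a - b \<in> S" if "a \<in> S" "b \<in> S" for a b using assms that by (auto simp: subring_set_def)
  show 0: "0 \<in> S" using diff[OF 1 1] by simp
  show neg: "- a \<in> S" if "a \<in> S" for a using diff[OF 0 that] by simp
  show add: "a + b \<in> S" if "a \<in> S" "b \<in> S" for a b using diff[OF that(1) neg[OF that(2)]] by simp
  show mult: "a * b \<in> S" if "a \<in> S" "b \<in> S" for a b using assms that by (auto simp: subring_set_def)
  show "a ^ n \<in> S" if "a \<in> S" by (induction n) (auto intro: 1 mult that)
  show "sum f I \<in> S" if "\<And>i. i \<in> I \<Longrightarrow> f i \<in> S"
    using that by (induction I rule: infinite_finite_induct) (auto intro: 0 add)
  show "prod f I \<in> S" if "\<And>i. i \<in> I \<Longrightarrow> f i \<in> S"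
    using that by (induction I rule: infinite_finite_induct) (auto intro: 1 mult)
qed

lemma subring_set_Union_chain:
  assumes "\<C> \<noteq> {}" "\<And>S T. S \<in> \<C> \<Longrightarrow> T \<in> \<C> \<Longrightarrow> S \<subseteq> T \<or> T \<subseteq> S"
    and "\<And>S. S \<in> \<C> \<Longrightarrow> subring_set S"
  shows "subring_set (\<Union>\<C>)"
proof -
  have "a - b \<in> \<Union>\<C> \<and> a * b \<in> \<Union>\<C>" if "a \<in> \<Union>\<C>" "b \<in> \<Union>\<C>" for a b
  proof -
    obtain S where "S \<in> \<C>" "a \<in> S" "b \<in> S" using \<open>a \<in> \<Union>\<C>\<close> \<open>b \<in> \<Union>\<C>\<close> assms(2) by blast
    then show ?thesis using assms(3)[of S] by (auto simp: subring_set_def)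
  qed
  moreover have "1 \<in> \<Union>\<C>" using assms(1,3) by (auto simp: subring_set_def)
  ultimately show ?thesis by (auto simp: subring_set_def)
qed

definition adjoin :: "'m::field set \<Rightarrow> 'm \<Rightarrow> 'm set" where
  "adjoin S z = {poly p z |p. \<forall>i. coeff p i \<in> S}"

lemma subring_set_adjoin:
  assumes "subring_set S"
  shows "subring_set (adjoin S z)" "S \<subseteq> adjoin S z" "z \<in> adjoin S z"
proof -
  note c = subring_set_closed[OF assms]
  have cm: "\<forall>i. coeff (p * q) i \<in> S" if "\<forall>i. coeff p i \<in> S" "\<forall>i. coeff q i \<in> S" for p q :: "'a poly"
    using that by (auto simp: coeff_mult intro!: c)
  have "poly p z - poly q z \<in> adjoin S z \<and> poly p z * poly q z \<in> adjoin S z"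
    if pq: "\<forall>i. coeff p i \<in> S" "\<forall>i. coeff q i \<in> S" for p q
  proof -
    have "poly (p - q) z \<in> adjoin S z" unfolding adjoin_def using pq by (intro CollectI exI[of _ "p - q"]) (auto intro!: c)
    moreover have "poly (p * q) z \<in> adjoin S z"
      unfolding adjoin_def using cm[OF pq] by (intro CollectI exI[of _ "p * q"]) auto
    ultimately show ?thesis by simp
  qed
  moreover have "1 \<in> adjoin S z" unfolding adjoin_def
    by (auto intro!: exI[of _ 1] c simp: coeff_1)
  ultimately show "subring_set (adjoin S z)"
    unfolding subring_set_def by (auto simp: adjoin_def)
  show "S \<subseteq> adjoin S z"
  proof
    fix a assume "a \<in> S"
    then show "a \<in> adjoin S z" unfolding adjoin_def
      by (intro CollectI exI[of _ "[:a:]"]) (auto simp: coeff_pCons c split: nat.split)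
  qed
  show "z \<in> adjoin S z" unfolding adjoin_def
    by (intro CollectI exI[of _ "[:0,1:]"]) (auto simp: coeff_pCons c split: nat.split)
qed

text \<open>
Zorn's lemma applies to the subrings that contain \<open>S\<close> and omit \<open>1/t\<close>: omitting an element survives
unions of chains.
\<close>

lemma exists_maximal_subring:
  fixes t :: "'m::field"
  assumes "subring_set S" "inverse t \<notin> S"
  obtains V where "subring_set V" "S \<subseteq> V" "inverse t \<notin> V"
    "\<And>T. subring_set T \<Longrightarrow> V \<subseteq> T \<Longrightarrow> inverse t \<notin> T \<Longrightarrow> T = V"
proof -
  define \<A> where "\<A> = {T. subring_set T \<and> S \<subseteq> T \<and> inverse t \<notin> T}"
  have "\<exists>V\<in>\<A>. \<forall>T\<in>\<A>. V \<subseteq> T \<longrightarrow> T = V"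
  proof (rule subset_Zorn_nonempty)
    show "\<A> \<noteq> {}" using assms by (auto simp: \<A>_def)
  next
    fix \<C> assume "\<C> \<noteq> {}" and ch: "subset.chain \<A> \<C>"
    have "subring_set (\<Union>\<C>)"
      using ch \<open>\<C> \<noteq> {}\<close> by (intro subring_set_Union_chain) (auto simp: subset_chain_def \<A>_def)
    then show "\<Union>\<C> \<in> \<A>" using ch \<open>\<C> \<noteq> {}\<close> by (auto simp: subset_chain_def \<A>_def)
  qed
  then obtain V where "V \<in> \<A>" "\<And>T. T \<in> \<A> \<Longrightarrow> V \<subseteq> T \<Longrightarrow> T = V" by blast
  then show ?thesis by (intro that[of V]) (auto simp: \<A>_def)
qed

text \<open>
The combinatorial heart of Chevalley's extension theorem. A relation of degree \<open>m\<close> for \<open>1/z\<close> over the ideal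
\<open>tV\<close> expresses \<open>z ^ m\<close> through lower powers of \<open>z\<close>, since \<open>1 - tb\<close> is invertible; this lowers the degree of
the relation for \<open>z\<close> as long as that degree is at least \<open>m\<close>, and the roles of \<open>z\<close> and \<open>1/z\<close> are symmetric.
\<close>

lemma no_relations_both_sides:
  fixes V :: "'m::field set"
  assumes V: "subring_set V" and t: "t \<in> V" 
    and inv: "\<And>b. b \<in> V \<Longrightarrow> inverse (1 - t * b) \<in> V \<and> 1 - t * b \<noteq> 0"
    and z0: "z \<noteq> 0"
    and p: "\<forall>i. coeff p i \<in> V" "t * poly p z = 1"
    and q: "\<forall>i. coeff q i \<in> V" "t * poly q (inverse z) = 1"
  shows False
  using p q z0
proof (induction "degree p + degree q" arbitrary: p q z rule: less_induct)
  case less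
  note c = subring_set_closed[OF V]
  have step: False if le: "degree q \<le> degree p" and H: "\<forall>i. coeff p i \<in> V" "t * poly p z = 1"
    "\<forall>i. coeff q i \<in> V" "t * poly q (inverse z) = 1" "z \<noteq> 0"
    and IH: "\<And>p'. degree p' < degree p \<Longrightarrow> \<forall>i. coeff p' i \<in> V \<Longrightarrow> t * poly p' z = 1 \<Longrightarrow> False" for p q z
  proof (cases "degree p = 0")
    case True
    then obtain a where "p = [:a:]" by (rule degree_eq_zeroE)
    then have "t * a = 1" "a \<in> V" using H(1,2) by (auto simp: coeff_pCons split: nat.splits dest: spec[of _ 0])
    then show False using inv[of a] by auto
  next
    case False
    define m n b where "m = degree q" and "n = degree p" and "b = coeff q 0"
    have bV: "b \<in> V" using H(3) by (simp add: b_def)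
    define w where "w = inverse (1 - t * b)"
    have w: "w \<in> V" "w * (1 - t * b) = 1" using inv[OF bV] by (auto simp: w_def)
    have "z ^ m = t * poly (reflect_poly q) z"
      using H(4,5) by (simp add: poly_reflect_poly_nz m_def field_simps)
    define r where "r = smult (w * t) (reflect_poly q - monom b m)"
    have cr: "\<forall>i. coeff r i \<in> V"
      using H(3) w bV t by (auto simp: r_def coeff_reflect_poly intro!: c)
    have zr: "z ^ m = poly r z"
    proof -
      have "z ^ m * (1 - t * b) = t * (poly (reflect_poly q) z - b * z ^ m)"
        using \<open>z ^ m = t * poly (reflect_poly q) z\<close> by (simp add: algebra_simps)
      then have "z ^ m * (w * (1 - t * b)) = w * t * (poly (reflect_poly q) z - b * z ^ m)"
        by (simp add: algebra_simps)
      then show ?thesis using w(2) by (simp add: r_def poly_monom)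
    qed
    have dr: "coeff r i = 0" if "i \<ge> m" for i
      using that by (cases "i = m") (auto simp: r_def coeff_reflect_poly m_def b_def)
    \<comment> \<open>replace the top power of \<open>z\<close> in \<open>p\<close> by lower ones\<close>
    define a where "a = coeff p n"
    define p' where "p' = p - monom a n + smult a (monom 1 (n - m) * r)"
    have "coeff p' i = 0" if "i \<ge> n" for i
      using that dr le by (cases "i = n")
        (auto simp: p'_def a_def n_def m_def coeff_monom_mult coeff_eq_0)
    then have "degree p' < degree p"
      using False unfolding n_def by (metis degree_0 le_degree not_le_imp_less leading_coeff_0_iff gr0I)
    moreover have "\<forall>i. coeff p' i \<in> V"
      using H(1) cr by (auto simp: p'_def a_def coeff_monom_mult intro!: c)
    moreover have "poly p' z = poly p z"
      using le by (simp add: p'_def poly_monom zr[symmetric] n_def m_def mult.assoc power_add[symmetric])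
    ultimately show False using IH[of p'] H(2) by simp
  qed
  show ?case
  proof (cases "degree q \<le> degree p")
    case True
    show False
      by (rule step[OF True less.prems(1-5)], rule less.hyps[of _ q z]) (use less.prems in auto)
  next
    case False
    show False
      by (rule step[of p q "inverse z"], use False in simp, use less.prems in simp, use less.prems in simp,
          use less.prems in simp, use less.prems in simp, use less.prems in simp, rule less.hyps[of p _ z]) (use less.prems in auto)
  qed
qed

text \<open>
Chevalley's theorem, in the form that prescribes one pole: a maximal subring omitting \<open>1/t\<close> is a valuation
ring. If neither \<open>z\<close> nor \<open>1/z\<close> were in it, then adjoining either of them would produce \<open>1/t\<close>, and the two
relations contradict each other. That \<open>1 - tb\<close> is a unit follows from maximality in the same way, by adjoining its inverse.
\<close>

lemma exists_valuation_ring: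
  fixes t :: "'m::field"
  assumes "subring_set S" "t \<in> S" "inverse t \<notin> S"
  obtains V where "valuation_ring V" "S \<subseteq> V" "inverse t \<notin> V"
proof -
  obtain V where V: "subring_set V" "S \<subseteq> V" "inverse t \<notin> V"
    and max: "\<And>T. subring_set T \<Longrightarrow> V \<subseteq> T \<Longrightarrow> inverse t \<notin> T \<Longrightarrow> T = V"
    using exists_maximal_subring[OF assms(1,3)] by blast
  note c = subring_set_closed[OF V(1)]
  have tV: "t \<in> V" and t0: "t \<noteq> 0" using V assms c(2) by auto
  have adj: "z \<in> V \<or> inverse t \<in> adjoin V z" for z
    using max[of "adjoin V z"] subring_set_adjoin[OF V(1), of z] by auto
  have n0: "1 - t * b \<noteq> 0" if "b \<in> V" for b
    using V(3) that t0 by (metis eq_iff_diff_eq_0 inverse_unique)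
  have inv: "inverse (1 - t * b) \<in> V" if b: "b \<in> V" for b
  proof (rule ccontr)
    define s where "s = 1 - t * b"
    assume "inverse (1 - t * b) \<notin> V"
    then have "inverse t \<in> adjoin V (inverse s)" using adj unfolding s_def by blast
    then obtain p where p: "\<forall>i. coeff p i \<in> V" "inverse t = poly p (inverse s)" by (auto simp: adjoin_def)
    have s: "s \<in> V" "s \<noteq> 0" using b tV n0 by (auto simp: s_def intro!: c)
    have "s ^ degree p = t * poly (reflect_poly p) s"
      using s p(2) t0 by (simp add: poly_reflect_poly_nz field_simps)
    moreover have "poly (reflect_poly p) s \<in> V"
      unfolding poly_altdef using p(1) s by (auto simp: coeff_reflect_poly intro!: c)
    moreover have "\<exists>e\<in>V. s ^ n = 1 - t * e" for n
    proof (induction n)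
      case 0 then show ?case by (auto intro!: bexI[of _ 0] c)
    next
      case (Suc n)
      then obtain e where "e \<in> V" "s ^ n = 1 - t * e" by blast
      have "s ^ Suc n = (1 - t * b) * (1 - t * e)" by (simp add: s_def \<open>s ^ n = 1 - t * e\<close>[unfolded s_def])
      also have "\<dots> = 1 - t * (e + b - t * e * b)" by (simp add: algebra_simps)
      finally show ?case using b tV \<open>e \<in> V\<close> by (blast intro: c)
    qed
    ultimately obtain e e' where "e \<in> V" "e' \<in> V" "1 - t * e = t * e'" by metis
    then have "t * (e + e') = 1" by (simp add: algebra_simps)
    then have "inverse t = e + e'" by (metis inverse_unique)
    then show False using V(3) \<open>e \<in> V\<close> \<open>e' \<in> V\<close> c(4) by auto
  qed
  have "z \<in> V \<or> inverse z \<in> V" for z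
  proof (rule ccontr)
    assume n: "\<not> (z \<in> V \<or> inverse z \<in> V)"
    then have z0: "z \<noteq> 0" using c(2) by auto
    obtain p where p: "\<forall>i. coeff p i \<in> V" "inverse t = poly p z"
      using n adj[of z] by (auto simp: adjoin_def)
    obtain q where q: "\<forall>i. coeff q i \<in> V" "inverse t = poly q (inverse z)"
      using n adj[of "inverse z"] by (auto simp: adjoin_def)
    show False
      by (rule no_relations_both_sides[OF V(1) tV _ z0 p(1) _ q(1)])
         (use inv n0 p(2) q(2) t0 in \<open>auto simp: field_simps\<close>)
  qed
  then show ?thesis using that[of V] V by (auto simp: valuation_ring_def)
qed

lemma valuation_ring_subring: "valuation_ring V \<Longrightarrow> subring_set V"
  by (simp add: valuation_ring_def)

lemmas valuation_ring_closed = subring_set_closed[OF valuation_ring_subring]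

lemma inverse_in_valuation_ring:
  "valuation_ring V \<Longrightarrow> z \<notin> max_ideal V \<Longrightarrow> inverse z \<in> V"
  by (auto simp: max_ideal_def)

lemma max_ideal_props:
  assumes V: "valuation_ring V"
  shows max_ideal_subset: "max_ideal V \<subseteq> V"
    and one_notin_max_ideal: "1 \<notin> max_ideal V"
    and zero_in_max_ideal: "0 \<in> max_ideal V"
    and max_ideal_mult: "a \<in> max_ideal V \<Longrightarrow> v \<in> V \<Longrightarrow> a * v \<in> max_ideal V"
    and max_ideal_mult': "a \<in> max_ideal V \<Longrightarrow> v \<in> V \<Longrightarrow> v * a \<in> max_ideal V"
    and max_ideal_add: "a \<in> max_ideal V \<Longrightarrow> b \<in> max_ideal V \<Longrightarrow> a + b \<in> max_ideal V"
    and max_ideal_uminus: "a \<in> max_ideal V \<Longrightarrow> - a \<in> max_ideal V"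
    and max_ideal_diff: "a \<in> max_ideal V \<Longrightarrow> b \<in> max_ideal V \<Longrightarrow> a - b \<in> max_ideal V"
    and max_ideal_prime: "z \<in> V \<Longrightarrow> w \<in> V \<Longrightarrow> z * w \<in> max_ideal V \<Longrightarrow> z \<in> max_ideal V \<or> w \<in> max_ideal V"
    and max_ideal_inverse: "a \<notin> V \<Longrightarrow> inverse a \<in> max_ideal V"
proof -
  note c = valuation_ring_closed[OF V]
  show sub: "max_ideal V \<subseteq> V" using V c(2) by (auto simp: max_ideal_def valuation_ring_def)
  show "1 \<notin> max_ideal V" "0 \<in> max_ideal V" using c by (auto simp: max_ideal_def)
  show mult: "a * v \<in> max_ideal V" if "a \<in> max_ideal V" "v \<in> V" for a v
  proof (rule ccontr)
    assume "a * v \<notin> max_ideal V"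
    then have "a * v \<noteq> 0" "inverse (a * v) \<in> V" by (auto simp: max_ideal_def)
    then have "v * inverse (a * v) \<in> V" using that c(5) by blast
    moreover have "v * inverse (a * v) = inverse a" using \<open>a * v \<noteq> 0\<close> by simp
    ultimately have "inverse a \<in> V" by metis
    then show False using that \<open>a * v \<noteq> 0\<close> by (auto simp: max_ideal_def)
  qed
  show mult': "v * a \<in> max_ideal V" if "a \<in> max_ideal V" "v \<in> V" for a v
    using mult[OF that] by (simp add: mult.commute)
  have add_aux: "a + b \<in> max_ideal V" if "a \<in> max_ideal V" "b \<in> max_ideal V" "b \<noteq> 0" "a / b \<in> V" for a b
  proof -
    have "b * (a / b + 1) \<in> max_ideal V" using that c by (intro mult) auto
    moreover have "b * (a / b + 1) = a + b" using \<open>b \<noteq> 0\<close> by (simp add: distrib_left)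
    ultimately show ?thesis by metis
  qed
  show add: "a + b \<in> max_ideal V" if "a \<in> max_ideal V" "b \<in> max_ideal V" for a b
  proof (cases "a = 0 \<or> b = 0")
    case False
    have "a / b \<in> V \<or> b / a \<in> V" using V by (metis valuation_ring_def inverse_divide)
    then show ?thesis using add_aux[of a b] add_aux[of b a] that False by (auto simp: add.commute)
  qed (use that in auto)
  show neg: "- a \<in> max_ideal V" if "a \<in> max_ideal V" for a
    using mult[OF that c(6)[OF c(1)]] by simp
  show "a - b \<in> max_ideal V" if "a \<in> max_ideal V" "b \<in> max_ideal V"
    using add[OF that(1) neg[OF that(2)]] by simp
  show "z \<in> max_ideal V \<or> w \<in> max_ideal V" if "z \<in> V" "w \<in> V" "z * w \<in> max_ideal V"
  proof (rule ccontr)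
    assume "\<not> ?thesis"
    then have "inverse z * inverse w \<in> V" "z * w \<noteq> 0" using c by (auto simp: max_ideal_def)
    then show False using that by (auto simp: max_ideal_def field_simps)
  qed
  show "inverse a \<in> max_ideal V" if "a \<notin> V" using that c(2) by (auto simp: max_ideal_def)
qed

lemma max_ideal_sum:
  assumes "valuation_ring V" "\<And>i. i \<in> I \<Longrightarrow> f i \<in> max_ideal V"
  shows "sum f I \<in> max_ideal V"
  using assms(2) by (induction I rule: infinite_finite_induct)
    (auto intro: max_ideal_add[OF assms(1)] zero_in_max_ideal[OF assms(1)])

lemma max_ideal_power:
  assumes "valuation_ring V" "a \<in> max_ideal V" "n > 0"
  shows "a ^ n \<in> max_ideal V"
  using assms(3)
proof (cases n)
  case (Suc k)
  have "a ^ k \<in> V" using assms max_ideal_subset[OF assms(1)] valuation_ring_closed(7)[OF assms(1)] by blast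
  then show ?thesis using max_ideal_mult[OF assms(1,2)] Suc by simp
qed auto

lemma prod_in_max_ideal_iff:
  assumes "valuation_ring V" "finite I" "\<And>i. i \<in> I \<Longrightarrow> f i \<in> V"
  shows "prod f I \<in> max_ideal V \<longleftrightarrow> (\<exists>i\<in>I. f i \<in> max_ideal V)"
  using assms(2,3)
proof (induction I rule: finite_induct)
  case empty then show ?case using one_notin_max_ideal[OF assms(1)] by simp
next
  case (insert i I)
  have "prod f I \<in> V" using insert by (auto intro!: valuation_ring_closed[OF assms(1)])
  then have "f i * prod f I \<in> max_ideal V \<longleftrightarrow> f i \<in> max_ideal V \<or> prod f I \<in> max_ideal V"
    using insert.prems max_ideal_prime[OF assms(1)] max_ideal_mult[OF assms(1)] max_ideal_mult'[OF assms(1)]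
    by blast
  then show ?case using insert by simp
qed

text \<open>
A special case of integral closedness: otherwise \<open>1/z\<close> would lie in the maximal ideal and so would
\<open>(1/z) ^ n * z ^ n = 1\<close>.
\<close>

lemma root_in_valuation_ring:
  assumes V: "valuation_ring V" and "z ^ n \<in> V" "n > 0"
  shows "z \<in> V"
proof (rule ccontr)
  assume "z \<notin> V"
  then have "inverse z ^ n \<in> max_ideal V" using max_ideal_inverse[OF V] max_ideal_power[OF V] assms(3) by blast
  then have "inverse z ^ n * z ^ n \<in> max_ideal V" using max_ideal_mult[OF V] assms(2) by blast
  moreover have "inverse z ^ n * z ^ n = 1" using \<open>z \<notin> V\<close> valuation_ring_closed(2)[OF V]
    by (metis left_inverse power_mult_distrib power_one)
  ultimately show False using one_notin_max_ideal[OF V] by simp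
qed

section \<open>Places of the algebraic closure of K(x)\<close>

text \<open>
The field \<open>K(x)\<close> enters only through an embedding of \<open>K[x]\<close> in an algebraically closed field \<open>'m\<close> that is
algebraic over its image.
\<close>

locale function_field =
  fixes \<iota> :: "'a::{alg_closed_field,field_char_0} poly \<Rightarrow> 'm::{alg_closed_field,field_char_0}"
  assumes inj_hom: "inj_comm_ring_hom \<iota>"
    and algebraic: "\<And>z. \<exists>p. p \<noteq> 0 \<and> poly (map_poly \<iota> p) z = 0"
begin

sublocale \<iota>: inj_comm_ring_hom \<iota> by (rule inj_hom)

text \<open>
Inside \<open>'m\<close>: the variable \<open>x\<close>, the constants \<open>K\<close> and the field \<open>K(x)\<close>.
\<close>

definition \<xi> :: 'm where "\<xi> = \<iota> [:0, 1:]"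
definition \<kappa> :: "'a \<Rightarrow> 'm" where "\<kappa> c = \<iota> [:c:]"
definition \<F> :: "'m set" where "\<F> = {\<iota> p / \<iota> q |p q. q \<noteq> 0}"

lemma x_nz [simp]: "\<xi> \<noteq> 0" by (simp add: \<xi>_def)

lemma \<kappa>_simps [simp]: "\<kappa> 0 = 0" "\<kappa> 1 = 1" "\<kappa> (a + b) = \<kappa> a + \<kappa> b" "\<kappa> (a - b) = \<kappa> a - \<kappa> b"
  "\<kappa> (a * b) = \<kappa> a * \<kappa> b" "\<kappa> (- a) = - \<kappa> a" "\<kappa> a = 0 \<longleftrightarrow> a = 0" "\<kappa> a = \<kappa> b \<longleftrightarrow> a = b"
proof -
  show [simp]: "\<kappa> 0 = 0" "\<kappa> 1 = 1" using \<iota>.hom_one unfolding \<kappa>_def one_pCons by simp_all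
  show "\<kappa> (a + b) = \<kappa> a + \<kappa> b" unfolding \<kappa>_def by (simp flip: \<iota>.hom_add)
  show [simp]: "\<kappa> (a - b) = \<kappa> a - \<kappa> b" for a b unfolding \<kappa>_def by (simp flip: \<iota>.hom_minus)
  show "\<kappa> (a * b) = \<kappa> a * \<kappa> b" unfolding \<kappa>_def by (simp flip: \<iota>.hom_mult)
  show "\<kappa> (- a) = - \<kappa> a" unfolding \<kappa>_def by (simp flip: \<iota>.hom_uminus)
  show [simp]: "\<kappa> a = 0 \<longleftrightarrow> a = 0" for a unfolding \<kappa>_def by simp
  show "\<kappa> a = \<kappa> b \<longleftrightarrow> a = b" unfolding \<kappa>_def by simp
qed

lemma \<kappa>_sum: "\<kappa> (sum f I) = (\<Sum>i\<in>I. \<kappa> (f i))"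
  by (induction I rule: infinite_finite_induct) auto

lemma \<kappa>_inverse: "\<kappa> (inverse c) = inverse (\<kappa> c)"
proof (cases "c = 0")
  case False
  then have "\<kappa> (inverse c) * \<kappa> c = 1" by (metis \<kappa>_simps(2,5) left_inverse)
  then show ?thesis by (metis inverse_unique mult.commute)
qed simp

lemma \<iota>_pCons: "\<iota> (pCons a p) = \<kappa> a + \<xi> * \<iota> p"
proof -
  have "pCons a p = [:a:] + [:0, 1:] * p" by simp
  then show ?thesis unfolding \<xi>_def \<kappa>_def by (metis \<iota>.hom_add \<iota>.hom_mult)
qed

lemma \<iota>_monom: "\<iota> (monom c n) = \<kappa> c * \<xi> ^ n"
  by (induction n) (simp_all add: monom_0 monom_Suc \<iota>_pCons)

lemma \<F>_closed:
  shows "\<iota> p \<in> \<F>" "\<kappa> c \<in> \<F>" "\<xi> \<in> \<F>"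
    and "a \<in> \<F> \<Longrightarrow> b \<in> \<F> \<Longrightarrow> a + b \<in> \<F>"
    and "a \<in> \<F> \<Longrightarrow> b \<in> \<F> \<Longrightarrow> a - b \<in> \<F>"
    and "a \<in> \<F> \<Longrightarrow> b \<in> \<F> \<Longrightarrow> a * b \<in> \<F>"
    and "a \<in> \<F> \<Longrightarrow> inverse a \<in> \<F>"
    and "a \<in> \<F> \<Longrightarrow> b \<in> \<F> \<Longrightarrow> a / b \<in> \<F>"
    and "a \<in> \<F> \<Longrightarrow> a ^ n \<in> \<F>"
    and "a \<in> \<F> \<Longrightarrow> a powi e \<in> \<F>"
proof -
  show 1: "\<iota> p \<in> \<F>" for p unfolding \<F>_def by (intro CollectI exI[of _ p] exI[of _ 1]) simp
  show "\<kappa> c \<in> \<F>" "\<xi> \<in> \<F>" unfolding \<kappa>_def \<xi>_def by (rule 1)+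
  have m: "a * b \<in> \<F>" if ab: "a \<in> \<F>" "b \<in> \<F>" for a b
  proof -
    obtain p q r s where "a = \<iota> p / \<iota> q" "b = \<iota> r / \<iota> s" "q \<noteq> 0" "s \<noteq> 0" using ab unfolding \<F>_def by auto
    then show ?thesis unfolding \<F>_def
      by (intro CollectI exI[of _ "p * r"] exI[of _ "q * s"]) (simp add: \<iota>.hom_mult)
  qed
  show "a * b \<in> \<F>" if "a \<in> \<F>" "b \<in> \<F>" using m that .
  have ad: "a + b \<in> \<F>" if ab: "a \<in> \<F>" "b \<in> \<F>" for a b
  proof -
    obtain p q r s where "a = \<iota> p / \<iota> q" "b = \<iota> r / \<iota> s" "q \<noteq> 0" "s \<noteq> 0" using ab unfolding \<F>_def by auto
    then show ?thesis unfolding \<F>_def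
      by (intro CollectI exI[of _ "p * s + r * q"] exI[of _ "q * s"])
         (simp add: \<iota>.hom_mult \<iota>.hom_add field_simps)
  qed
  show "a + b \<in> \<F>" if "a \<in> \<F>" "b \<in> \<F>" using ad that .
  show "a - b \<in> \<F>" if "a \<in> \<F>" "b \<in> \<F>" using ad[OF that(1) m[OF 1 that(2), of "-1"]]
    by (simp add: \<iota>.hom_uminus)
  have inv: "inverse a \<in> \<F>" if a: "a \<in> \<F>" for a
  proof -
    obtain p q where "a = \<iota> p / \<iota> q" "q \<noteq> 0" using a unfolding \<F>_def by auto
    show ?thesis
    proof (cases "p = 0")
      case True then show ?thesis using 1[of 0] \<open>a = _\<close> by simp
    next
      case False
      then show ?thesis unfolding \<F>_def \<open>a = _\<close> by (intro CollectI exI[of _ q] exI[of _ p]) simp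
    qed
  qed
  show "inverse a \<in> \<F>" if "a \<in> \<F>" using inv that .
  show "a / b \<in> \<F>" if "a \<in> \<F>" "b \<in> \<F>" using m[OF that(1) inv[OF that(2)]] by (simp add: field_simps)
  have pw: "a ^ n \<in> \<F>" if "a \<in> \<F>" for a n using that 1[of 1] by (induction n) (auto intro: m)
  show "a ^ n \<in> \<F>" if "a \<in> \<F>" using pw that .
  show "a powi e \<in> \<F>" if "a \<in> \<F>" using pw that inv by (simp add: power_int_def)
qed

text \<open>
A reduced fraction with a nonconstant denominator has a pole at a root \<open>a\<close> of the denominator, and a valuation
ring that contains \<open>K[x]\<close> and omits \<open>1/(x - a)\<close> detects it.
\<close>

lemma regular_everywhere_imp_polynomial:
  assumes "c \<in> \<F>" and W: "\<And>W. valuation_ring W \<Longrightarrow> range \<iota> \<subseteq> W \<Longrightarrow> c \<in> W"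
  shows "c \<in> range \<iota>"
proof -
  obtain p q where "c = \<iota> p / \<iota> q" "q \<noteq> 0" using assms(1) unfolding \<F>_def by auto
  then show ?thesis
  proof (induction "degree q" arbitrary: p q rule: less_induct)
    case less
    show ?case
    proof (cases "degree q = 0")
      case True
      then obtain e where "q = [:e:]" by (rule degree_eq_zeroE)
      then have "\<iota> q = \<kappa> e" by (simp add: \<kappa>_def)
      moreover have "\<iota> (smult (inverse e) p) = inverse (\<kappa> e) * \<iota> p"
        using \<iota>.hom_mult[of "[:inverse e:]" p] \<kappa>_inverse[of e] by (simp add: \<kappa>_def)
      ultimately have "c = \<iota> (smult (inverse e) p)" using less.prems by (simp add: divide_inverse mult.commute)
      then show ?thesis by blast
    next
      case False
      then obtain a where "poly q a = 0" using alg_closed_imp_poly_has_root[of q] by blast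
      then obtain q' where q': "q = [:-a, 1:] * q'" using poly_eq_0_iff_dvd by (metis dvdE)
      then have q'0: "q' \<noteq> 0" using less.prems by auto
      have dq: "degree q' < degree q" using q'0 unfolding q' by (subst degree_mult_eq) auto
      define t where "t = \<iota> [:-a, 1:]"
      have t0: "t \<noteq> 0" by (simp add: t_def)
      show ?thesis
      proof (cases "poly p a = 0")
        case True
        then obtain p' where p': "p = [:-a, 1:] * p'" using poly_eq_0_iff_dvd by (metis dvdE)
        then have "c = \<iota> p' / \<iota> q'"
          unfolding less.prems(1) q' p' \<iota>.hom_mult using t0 by (simp add: t_def)
        then show ?thesis using less.hyps[OF dq] q'0 by blast
      next
        case pa: False
        have "subring_set (range \<iota>)" unfolding subring_set_def
          by (metis (no_types, lifting) \<iota>.hom_minus \<iota>.hom_mult \<iota>.hom_one imageE rangeI)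
        moreover have "inverse t \<notin> range \<iota>"
        proof
          assume "inverse t \<in> range \<iota>"
          then obtain s where "inverse t = \<iota> s" by auto
          then have "\<iota> ([:-a, 1:] * s) = \<iota> 1" unfolding \<iota>.hom_mult using t0 by (simp add: t_def field_simps)
          then have "[:-a, 1:] * s = 1" by (simp only: \<iota>.eq_iff)
          then have "poly ([:-a, 1:] * s) a = 1" by simp
          then show False by simp
        qed
        ultimately obtain W where Wv: "valuation_ring W" "range \<iota> \<subseteq> W" "inverse t \<notin> W"
          using exists_valuation_ring[of "range \<iota>" t] unfolding t_def by blast
        have tm: "t \<in> max_ideal W" using Wv(3) by (auto simp: max_ideal_def)
        have "c \<in> W" using W Wv by blast
        moreover have "\<iota> q' \<in> W" using Wv by auto
        ultimately have "t * (\<iota> q' * c) \<in> max_ideal W"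
          by (intro max_ideal_mult[OF Wv(1) tm] valuation_ring_closed[OF Wv(1)])
        moreover have "t * (\<iota> q' * c) = \<iota> p"
        proof -
          have "t * \<iota> q' = \<iota> q" by (simp only: t_def q' \<iota>.hom_mult)
          moreover have "\<iota> q \<noteq> 0" using less.prems(2) by simp
          ultimately show ?thesis using less.prems(1) by (simp flip: mult.assoc)
        qed
        ultimately have pm: "\<iota> p \<in> max_ideal W" by simp
        obtain p' where "p - [:poly p a:] = [:-a, 1:] * p'"
          using poly_eq_0_iff_dvd[of "p - [:poly p a:]" a] by (auto elim!: dvdE)
        then have "\<iota> p - \<kappa> (poly p a) = t * \<iota> p'" unfolding \<kappa>_def t_def by (metis \<iota>.hom_minus \<iota>.hom_mult)
        moreover have "t * \<iota> p' \<in> max_ideal W" using Wv by (intro max_ideal_mult[OF Wv(1) tm]) auto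
        ultimately have "\<kappa> (poly p a) \<in> max_ideal W"
          using max_ideal_diff[OF Wv(1) pm, of "t * \<iota> p'"] by (metis diff_diff_eq2 add_diff_cancel_left')
        moreover have "inverse (\<kappa> (poly p a)) \<in> W" using Wv(2) \<kappa>_inverse unfolding \<kappa>_def by (metis rangeI subsetD)
        ultimately show ?thesis using pa by (auto simp: max_ideal_def)
      qed
    qed
  qed
qed

lemma exists_place_at_infinity:
  obtains V where "valuation_ring V" "range \<kappa> \<subseteq> V" "inverse \<xi> \<in> V" "\<xi> \<notin> V"
proof -
  define S where "S = adjoin (range \<kappa>) (inverse \<xi>)"
  have k: "subring_set (range \<kappa>)" unfolding subring_set_def
    by (auto simp flip: \<kappa>_simps)
  note S = subring_set_adjoin[OF k, of "inverse \<xi>", folded S_def]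
  have "\<xi> \<notin> S"
  proof
    assume "\<xi> \<in> S"
    then obtain p where p: "\<forall>i. coeff p i \<in> range \<kappa>" "\<xi> = poly p (inverse \<xi>)" by (auto simp: S_def adjoin_def)
    define c where "c i = (SOME c. coeff p i = \<kappa> c)" for i
    have c: "coeff p i = \<kappa> (c i)" for i unfolding c_def using p(1) by (metis (mono_tags, lifting) imageE someI)
    define n where "n = degree p"
    have "\<xi> * \<xi> ^ n = \<xi> ^ n * (\<Sum>i\<le>n. coeff p i * inverse \<xi> ^ i)"
      using p(2) by (simp add: poly_altdef n_def)
    also have "\<dots> = (\<Sum>i\<le>n. \<kappa> (c i) * \<xi> ^ (n - i))"
      unfolding sum_distrib_left by (intro sum.cong refl) (auto simp: c power_diff field_simps)
    also have "\<dots> = \<iota> (\<Sum>i\<le>n. monom (c i) (n - i))" by (simp add: \<iota>.hom_sum \<iota>_monom)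
    finally have "\<iota> (monom 1 (Suc n)) = \<iota> (\<Sum>i\<le>n. monom (c i) (n - i))" by (simp add: \<iota>_monom)
    then have "monom 1 (Suc n) = (\<Sum>i\<le>n. monom (c i) (n - i))" by (simp only: \<iota>.eq_iff)
    then have "coeff (monom (1::'a) (Suc n)) (Suc n) = coeff (\<Sum>i\<le>n. monom (c i) (n - i)) (Suc n)" by simp
    moreover have "(\<Sum>i\<le>n. coeff (monom (c i) (n - i)) (Suc n)) = 0" by (intro sum.neutral) auto
    ultimately show False by (simp add: coeff_sum)
  qed
  then show ?thesis
    using exists_valuation_ring[OF S(1), of "inverse \<xi>"] S(2,3) that
    by (metis inverse_inverse_eq subset_trans subsetD)
qed

end

text \<open>
A valuation ring of \<open>'m\<close> over the point \<open>x = \<infinity>\<close>. It takes the place of Puiseux expansions in \<open>1/x\<close>: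
membership in \<open>V\<close> means finite at infinity, membership in its maximal ideal means vanishing there.
\<close>

locale function_field_place = function_field \<iota> for \<iota> :: "'a::{alg_closed_field,field_char_0} poly \<Rightarrow> 'm::{alg_closed_field,field_char_0}" +
  fixes V :: "'m set"
  assumes val: "valuation_ring V"
    and const_in_V: "\<kappa> c \<in> V"
    and inverse_x_in_V: "inverse \<xi> \<in> V"
    and x_notin_V: "\<xi> \<notin> V"
begin

abbreviation \<mm> where "\<mm> \<equiv> max_ideal V"

lemmas V_closed = valuation_ring_closed[OF val]
lemmas m_props = max_ideal_props[OF val]

lemma inverse_x_in_m: "inverse \<xi> \<in> \<mm>" using x_notin_V by (rule m_props)

lemma \<kappa>_in_m_iff [simp]: "\<kappa> c \<in> \<mm> \<longleftrightarrow> c = 0"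
  using const_in_V[of "inverse c"] by (auto simp: max_ideal_def \<kappa>_inverse)

lemma poly_over_power_in_V: "degree p \<le> n \<Longrightarrow> \<iota> p * inverse \<xi> ^ n \<in> V"
proof (induction p arbitrary: n rule: pCons_induct)
  case 0 then show ?case by (simp add: V_closed)
next
  case (pCons a p)
  show ?case
  proof (cases "p = 0")
    case True
    then show ?thesis by (auto simp: \<iota>_pCons intro!: V_closed const_in_V inverse_x_in_V)
  next
    case False
    then obtain n' where n: "n = Suc n'" "degree p \<le> n'" using pCons.prems by (cases n) auto
    have "\<iota> (pCons a p) * inverse \<xi> ^ n = \<kappa> a * inverse \<xi> ^ n + \<iota> p * inverse \<xi> ^ n'"
      by (simp add: \<iota>_pCons n field_simps)
    then show ?thesis using pCons.IH[OF n(2)] by (auto intro!: V_closed const_in_V inverse_x_in_V)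
  qed
qed

lemma poly_over_power_residue:
  assumes "degree p \<le> n"
  shows "\<iota> p * inverse \<xi> ^ n - \<kappa> (coeff p n) \<in> \<mm>"
proof (cases n)
  case 0
  then obtain a where "p = [:a:]" using assms by (auto elim: degree_eq_zeroE)
  then show ?thesis using 0 by (simp add: \<iota>_pCons m_props)
next
  case (Suc n')
  define q where "q = p - monom (coeff p n) n"
  have "degree q \<le> n'"
  proof (rule degree_le, intro allI impI)
    fix i assume "n' < i"
    then show "coeff q i = 0" using assms Suc by (cases "i = n") (auto simp: q_def coeff_eq_0)
  qed
  then have "inverse \<xi> * (\<iota> q * inverse \<xi> ^ n') \<in> \<mm>"
    by (intro m_props(4) inverse_x_in_m poly_over_power_in_V)
  moreover have "\<iota> p * inverse \<xi> ^ n - \<kappa> (coeff p n) = inverse \<xi> * (\<iota> q * inverse \<xi> ^ n')"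
    by (simp add: q_def \<iota>.hom_minus \<iota>_monom Suc field_simps)
  ultimately show ?thesis by simp
qed

lemma poly_over_power_unit:
  assumes "p \<noteq> 0"
  shows "\<iota> p * inverse \<xi> ^ degree p \<in> V - \<mm>"
proof -
  have "\<iota> p * inverse \<xi> ^ degree p \<notin> \<mm>"
  proof
    assume "\<iota> p * inverse \<xi> ^ degree p \<in> \<mm>"
    from m_props(8)[OF this poly_over_power_residue[of p "degree p"]] show False using assms by simp
  qed
  then show ?thesis using poly_over_power_in_V[of p "degree p"] by simp
qed

text \<open>
Units of \<open>V\<close> can be cancelled in every question of membership.
\<close>

lemma unit_mult_in_V_iff: "u \<in> V - \<mm> \<Longrightarrow> u * z \<in> V \<longleftrightarrow> z \<in> V"
proof
  assume u: "u \<in> V - \<mm>" and "u * z \<in> V"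
  then have "inverse u * (u * z) \<in> V" using u inverse_in_valuation_ring[OF val, of u] V_closed(5) by blast
  moreover have "u \<noteq> 0" using u m_props(3) by blast
  then have "inverse u * (u * z) = z" by (simp flip: mult.assoc)
  ultimately show "z \<in> V" by metis
qed (auto intro: V_closed)

lemma unit_mult_in_m_iff: "u \<in> V - \<mm> \<Longrightarrow> u * z \<in> \<mm> \<longleftrightarrow> z \<in> \<mm>"
proof
  assume u: "u \<in> V - \<mm>" and "u * z \<in> \<mm>"
  then have "(u * z) * inverse u \<in> \<mm>" using u inverse_in_valuation_ring[OF val, of u] m_props(4) by blast
  moreover have "u \<noteq> 0" using u m_props(3) by blast
  then have "(u * z) * inverse u = z" by (simp add: mult.commute)
  ultimately show "z \<in> \<mm>" by metis
qed (auto intro: m_props)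

lemma unit_closed:
  shows "u \<in> V - \<mm> \<Longrightarrow> v \<in> V - \<mm> \<Longrightarrow> u * v \<in> V - \<mm>"
    and "u \<in> V - \<mm> \<Longrightarrow> inverse u \<in> V - \<mm>"
    and "u \<in> V - \<mm> \<Longrightarrow> u ^ n \<in> V - \<mm>"
    and "1 \<in> V - \<mm>"
proof -
  show *: "u * v \<in> V - \<mm>" if "u \<in> V - \<mm>" "v \<in> V - \<mm>" for u v
    using that m_props(9)[of u v] V_closed(5)[of u v] by auto
  show "inverse u \<in> V - \<mm>" if "u \<in> V - \<mm>" using that by (auto simp: max_ideal_def)
  show one: "1 \<in> V - \<mm>" using V_closed m_props by auto
  show "u ^ n \<in> V - \<mm>" if "u \<in> V - \<mm>" using that one * by (induction n) auto
qed

lemma x_powi_in_V_iff: "\<xi> powi e \<in> V \<longleftrightarrow> e \<le> 0"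
proof (cases "e \<le> 0")
  case True
  then have "\<xi> powi e = inverse \<xi> ^ nat (- e)" by (simp add: power_int_def)
  then show ?thesis using True by (auto intro: V_closed inverse_x_in_V)
next
  case False
  have "\<xi> powi e \<notin> V"
  proof
    assume *: "\<xi> powi e \<in> V"
    have "\<xi> powi e * inverse \<xi> ^ nat (e - 1) \<in> V" by (intro V_closed * inverse_x_in_V)
    moreover have "\<xi> powi e * inverse \<xi> ^ nat (e - 1) = \<xi>"
    proof -
      have "nat e = Suc (nat (e - 1))" using False by simp
      then show ?thesis using False by (simp add: power_int_def power_inverse)
    qed
    ultimately show False using x_notin_V by simp
  qed
  then show ?thesis using False by simp
qed

lemma x_powi_in_m_iff: "\<xi> powi e \<in> \<mm> \<longleftrightarrow> e < 0"
proof -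
  have "\<xi> powi e \<in> \<mm> \<longleftrightarrow> \<not> \<xi> powi (- e) \<in> V" by (auto simp: max_ideal_def power_int_minus)
  then show ?thesis by (auto simp: x_powi_in_V_iff)
qed

lemma poly_unit_times_power:
  assumes "p \<noteq> 0"
  obtains u where "u \<in> V - \<mm>" "\<iota> p = u * \<xi> powi (int (degree p))"
proof
  show "\<iota> p * inverse \<xi> ^ degree p \<in> V - \<mm>" using assms by (rule poly_over_power_unit)
  show "\<iota> p = \<iota> p * inverse \<xi> ^ degree p * \<xi> powi (int (degree p))" by (simp add: field_simps)
qed

text \<open>
On \<open>K(x)\<close> the order of the pole at infinity is the difference of the degrees.
\<close>

lemma fraction_powi:
  assumes "p \<noteq> 0" "q \<noteq> 0"
  obtains u where "u \<in> V - \<mm>" "\<iota> p / \<iota> q = u * \<xi> powi (int (degree p) - int (degree q))"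
proof -
  obtain u where u: "u \<in> V - \<mm>" "\<iota> p = u * \<xi> powi (int (degree p))" using poly_unit_times_power[OF assms(1)] .
  obtain v where v: "v \<in> V - \<mm>" "\<iota> q = v * \<xi> powi (int (degree q))" using poly_unit_times_power[OF assms(2)] .
  show ?thesis
  proof
    show "u * inverse v \<in> V - \<mm>" by (intro unit_closed u v)
    show "\<iota> p / \<iota> q = u * inverse v * \<xi> powi (int (degree p) - int (degree q))"
      unfolding u(2) v(2) by (simp add: power_int_diff field_simps del: power_int_of_nat)
  qed
qed

lemma fraction_in_V_iff:
  assumes "p \<noteq> 0" "q \<noteq> 0"
  shows "\<iota> p / \<iota> q \<in> V \<longleftrightarrow> degree p \<le> degree q"
  using fraction_powi[OF assms] unit_mult_in_V_iff x_powi_in_V_iff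
  by (metis diff_le_0_iff_le of_nat_le_iff)

lemma fraction_in_m_iff:
  assumes "p \<noteq> 0" "q \<noteq> 0"
  shows "\<iota> p / \<iota> q \<in> \<mm> \<longleftrightarrow> degree p < degree q"
  using fraction_powi[OF assms] unit_mult_in_m_iff x_powi_in_m_iff
  by (metis diff_less_0_iff_less of_nat_less_iff)

lemma poly_in_V_imp_const: "\<iota> p \<in> V \<Longrightarrow> degree p = 0"
  using fraction_in_V_iff[of p 1] by (cases "p = 0") auto

text \<open>
The orders of elements of \<open>K(x)\<close> are integers: a rational function that vanishes at infinity is \<open>O(1/x)\<close>.
\<close>

lemma fraction_in_m_imp: 
  assumes "r \<in> \<F>" "r \<in> \<mm>" shows "r * \<xi> \<in> V"
proof -
  obtain p q where pq: "r = \<iota> p / \<iota> q" "q \<noteq> 0" using assms unfolding \<F>_def by auto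
  show ?thesis
  proof (cases "p = 0")
    case False
    then have "degree p < degree q" using fraction_in_m_iff pq assms by blast
    then have "\<iota> (pCons 0 p) / \<iota> q \<in> V" using False pq by (subst fraction_in_V_iff) auto
    moreover have "\<iota> (pCons 0 p) / \<iota> q = r * \<xi>" by (simp add: pq(1) \<iota>_pCons)
    ultimately show ?thesis by simp
  qed (use pq V_closed in simp)
qed

lemma algebraic_relation:
  obtains p where "p \<noteq> 0" "(\<Sum>i\<le>degree p. \<iota> (coeff p i) * z ^ i) = 0"
  using algebraic[of z] that by (auto simp: poly_altdef)

text \<open>
The residue field of \<open>V\<close> is \<open>K\<close>: the residue of \<open>z\<close> is a root of the leading form in \<open>x\<close> of an algebraic relation
for \<open>z\<close>, and \<open>K\<close> is algebraically closed.
\<close>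

lemma exists_residue:
  assumes z: "z \<in> V"
  shows "\<exists>c. z - \<kappa> c \<in> \<mm>"
proof -
  obtain p where p: "p \<noteq> 0" "(\<Sum>i\<le>degree p. \<iota> (coeff p i) * z ^ i) = 0" using algebraic_relation .
  define D where "D = Max ((\<lambda>i. degree (coeff p i)) ` {i. i \<le> degree p \<and> coeff p i \<noteq> 0})"
  have fin: "finite {i. i \<le> degree p \<and> coeff p i \<noteq> 0}" and ne: "degree p \<in> {i. i \<le> degree p \<and> coeff p i \<noteq> 0}"
    using p by auto
  have D_ge: "degree (coeff p i) \<le> D" for i
  proof (cases "coeff p i = 0")
    case False
    then show ?thesis unfolding D_def using fin by (intro Max_ge) (auto intro: le_degree)
  qed simp
  have "D \<in> (\<lambda>i. degree (coeff p i)) ` {i. i \<le> degree p \<and> coeff p i \<noteq> 0}"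
    unfolding D_def by (intro Max_in) (use fin ne in blast)+
  then obtain i0 where i0: "coeff p i0 \<noteq> 0" "degree (coeff p i0) = D" "i0 \<le> degree p" by auto
  \<comment> \<open>\<open>\<gamma>\<close> collects the coefficients of \<open>x ^ D\<close>, where \<open>D\<close> is the degree of the relation in \<open>x\<close>\<close>
  define \<gamma> where "\<gamma> = (\<Sum>i\<le>degree p. monom (coeff (coeff p i) D) i)"
  have c\<gamma>: "coeff \<gamma> i = (if i \<le> degree p then coeff (coeff p i) D else 0)" for i
    unfolding \<gamma>_def by (simp add: coeff_sum)
  have "coeff \<gamma> i0 \<noteq> 0" using i0 by (auto simp: c\<gamma>)
  then have \<gamma>0: "\<gamma> \<noteq> 0" by auto
  define red where "red q = (\<Sum>i\<le>degree q. \<kappa> (coeff q i) * z ^ i)" for q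
  have red_alt: "red q = poly (map_poly \<kappa> q) z" for q
    by (simp add: red_def poly_altdef coeff_map_poly degree_map_poly)
  have "(\<Sum>i\<le>degree p. (\<iota> (coeff p i) * inverse \<xi> ^ D - \<kappa> (coeff (coeff p i) D)) * z ^ i) \<in> \<mm>"
    using z D_ge by (intro max_ideal_sum[OF val] m_props(4) poly_over_power_residue V_closed) auto
  moreover have "(\<Sum>i\<le>degree p. (\<iota> (coeff p i) * inverse \<xi> ^ D - \<kappa> (coeff (coeff p i) D)) * z ^ i) =
      inverse \<xi> ^ D * (\<Sum>i\<le>degree p. \<iota> (coeff p i) * z ^ i) - (\<Sum>i\<le>degree p. \<kappa> (coeff \<gamma> i) * z ^ i)"
    by (simp add: sum_distrib_left c\<gamma> algebra_simps sum_subtractf)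
  ultimately have "- (\<Sum>i\<le>degree p. \<kappa> (coeff \<gamma> i) * z ^ i) \<in> \<mm>" using p(2) by simp
  then have "(\<Sum>i\<le>degree p. \<kappa> (coeff \<gamma> i) * z ^ i) \<in> \<mm>" using m_props(7) by fastforce
  also have "(\<Sum>i\<le>degree p. \<kappa> (coeff \<gamma> i) * z ^ i) = red \<gamma>" unfolding red_def
    by (intro sum.mono_neutral_right) (auto simp: c\<gamma> le_degree coeff_eq_0 intro!: degree_le)
  finally have "red \<gamma> \<in> \<mm>" .
  interpret \<kappa>: comm_ring_hom \<kappa> by unfold_locales simp_all
  interpret m\<kappa>: map_poly_comm_ring_hom \<kappa> ..
  obtain A where A: "\<gamma> = smult (lead_coeff \<gamma>) (\<Prod>x\<in>#A. [:-x, 1:])"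
    using alg_closed_imp_factorization[OF \<gamma>0] by auto
  have "\<exists>x\<in>#A. z - \<kappa> x \<in> \<mm>" if "(\<Prod>x\<in>#A. z - \<kappa> x) \<in> \<mm>" for A
    using that
  proof (induction A)
    case empty then show ?case using m_props by auto
  next
    case (add x A)
    have "(\<Prod>x\<in>#A. z - \<kappa> x) \<in> V" by (induction A) (auto intro!: V_closed z const_in_V)
    then show ?case using add m_props(9)[of "z - \<kappa> x" "\<Prod>x\<in>#A. z - \<kappa> x"] z const_in_V V_closed(3) by auto
  qed
  moreover have "(\<Prod>x\<in>#A. z - \<kappa> x) \<in> \<mm>"
  proof -
    have pr: "poly (map_poly \<kappa> (\<Prod>x\<in>#A. [:-x, 1:])) z = (\<Prod>x\<in>#A. z - \<kappa> x)" for A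
      by (induction A) (simp_all add: m\<kappa>.hom_mult hom_distribs del: mult_pCons_left)
    have "red \<gamma> = poly (map_poly \<kappa> (smult (lead_coeff \<gamma>) (\<Prod>x\<in>#A. [:-x, 1:]))) z" 
      unfolding red_alt using A by metis
    also have "\<dots> = \<kappa> (lead_coeff \<gamma>) * (\<Prod>x\<in>#A. z - \<kappa> x)"
      using pr[of A] by (simp add: hom_distribs)
    finally have "\<kappa> (lead_coeff \<gamma>) * (\<Prod>x\<in>#A. z - \<kappa> x) \<in> \<mm>" using \<open>red \<gamma> \<in> \<mm>\<close> by simp
    then show ?thesis using \<gamma>0 const_in_V by (subst (asm) unit_mult_in_m_iff) auto
  qed
  ultimately show ?thesis by blast
qed

text \<open>
Divisibility in a valuation ring is a total preorder.
\<close>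

lemma exists_dominant:
  assumes "finite J" "J \<noteq> {}" "\<And>i. i \<in> J \<Longrightarrow> T i \<noteq> 0"
  shows "\<exists>i\<in>J. \<forall>j\<in>J. T j / T i \<in> V"
  using assms
proof (induction J rule: finite_ne_induct)
  case (singleton i) then show ?case using V_closed(1) by auto
next
  case (insert k J)
  then obtain i where i: "i \<in> J" "\<forall>j\<in>J. T j / T i \<in> V" by auto
  have ik: "T i \<noteq> 0" "T k \<noteq> 0" using i insert.prems by auto
  show ?case
  proof (cases "T k / T i \<in> V")
    case True then show ?thesis using i by auto
  next
    case False
    then have ki: "T i / T k \<in> V" using val ik by (metis valuation_ring_def inverse_divide)
    have "T j / T k \<in> V" if "j \<in> insert k J" for j
    proof (cases "j = k")
      case False
      then have "(T j / T i) * (T i / T k) \<in> V" using that i ki by (intro V_closed) auto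
      then show ?thesis using ik by simp
    qed (use ik V_closed in simp)
    then show ?thesis by blast
  qed
qed

text \<open>
The value group is torsion over the integers: in an algebraic relation for \<open>z\<close> the dominant order must be attained by
two terms, and comparing them gives a power of \<open>z\<close> with the order of a power of \<open>x\<close>.
\<close>

lemma exists_power_unit:
  assumes z: "z \<noteq> 0"
  obtains n :: nat and e :: int where "n > 0" "z ^ n * \<xi> powi e \<in> V - \<mm>"
proof -
  obtain p where p: "p \<noteq> 0" "(\<Sum>i\<le>degree p. \<iota> (coeff p i) * z ^ i) = 0" using algebraic_relation .
  define I where "I = {i. i \<le> degree p \<and> coeff p i \<noteq> 0}"
  define T where "T i = \<iota> (coeff p i) * z ^ i" for i
  have I: "finite I" "degree p \<in> I" using p by (auto simp: I_def)
  have T0: "T i \<noteq> 0" if "i \<in> I" for i using that z by (auto simp: T_def I_def)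
  have sumI: "sum T I = 0"
  proof -
    have "sum T I = (\<Sum>i\<le>degree p. T i)"
      unfolding I_def by (intro sum.mono_neutral_left) (auto simp: T_def)
    then show ?thesis using p(2) by (simp add: T_def)
  qed
  have "\<exists>i\<in>I. \<forall>j\<in>I. T j / T i \<in> V" by (rule exists_dominant) (use I T0 in auto)
  then obtain i where i: "i \<in> I" "\<forall>j\<in>I. T j / T i \<in> V" by blast
  have "\<exists>j\<in>I - {i}. T j / T i \<notin> \<mm>"
  proof (rule ccontr)
    assume "\<not> ?thesis"
    then have "(\<Sum>j\<in>I - {i}. T j / T i) \<in> \<mm>" by (intro max_ideal_sum[OF val]) auto
    moreover have "(\<Sum>j\<in>I - {i}. T j / T i) = (sum T I - T i) / T i"
      using i I by (simp add: sum_diff1 sum_divide_distrib[symmetric])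
    moreover have "\<dots> = - 1" using T0[OF i(1)] sumI by simp
    ultimately show False using m_props(2,7) by fastforce
  qed
  then obtain j where j: "j \<in> I" "j \<noteq> i" "T j / T i \<in> V - \<mm>" using i by auto
  note goal = that
  have gen: thesis if u: "\<iota> a * z ^ k / (\<iota> b * z ^ l) \<in> V - \<mm>" and ab: "a \<noteq> 0" "b \<noteq> 0" and kl: "l < k" for a b k l
  proof -
    obtain w where w: "w \<in> V - \<mm>" "\<iota> a / \<iota> b = w * \<xi> powi (int (degree a) - int (degree b))"
      using fraction_powi[OF ab] .
    have w0: "w \<noteq> 0" using w m_props by auto
    show thesis
    proof (rule goal[of "k - l" "int (degree a) - int (degree b)"])
      show "0 < k - l" using kl by simp
      have "\<iota> a * z ^ k / (\<iota> b * z ^ l) = (\<iota> a / \<iota> b) * z ^ (k - l)"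
        using kl z by (simp add: power_diff)
      then have "\<iota> a * z ^ k / (\<iota> b * z ^ l) = w * (z ^ (k - l) * \<xi> powi (int (degree a) - int (degree b)))"
        unfolding w(2) by simp
      then have "inverse w * (\<iota> a * z ^ k / (\<iota> b * z ^ l)) = z ^ (k - l) * \<xi> powi (int (degree a) - int (degree b))"
        using w0 by simp
      then show "z ^ (k - l) * \<xi> powi (int (degree a) - int (degree b)) \<in> V - \<mm>"
        using unit_closed(1)[OF unit_closed(2)[OF w(1)] u] by simp
    qed
  qed
  show thesis
  proof (cases "i < j")
    case True
    then show ?thesis using gen[of "coeff p j" j "coeff p i" i] j i by (auto simp: T_def I_def)
  next
    case False
    have "T i / T j \<in> V - \<mm>" using unit_closed(2)[OF j(3)] by simp
    then show ?thesis using False gen[of "coeff p i" i "coeff p j" j] j i by (auto simp: T_def I_def)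
  qed
qed

text \<open>
A power of \<open>z\<close> has the order of a power of \<open>x\<close>, so high powers of \<open>1/x\<close> outweigh \<open>z\<close>.
\<close>

lemma eventually_in_m: "\<exists>N. \<forall>n\<ge>N. z * inverse \<xi> ^ n \<in> \<mm>"
proof (cases "z = 0")
  case False
  then obtain n e where ne: "n > 0" "z ^ n * \<xi> powi e \<in> V - \<mm>" using exists_power_unit by blast
  define N where "N = nat \<bar>e\<bar> + 1"
  have "z * inverse \<xi> ^ k \<in> \<mm>" if "k \<ge> N" for k
  proof -
    define N' where "N' = k - 1"
    have N': "k = Suc N'" "int N' \<ge> - e" using that by (auto simp: N_def N'_def)
    have "(z * inverse \<xi> ^ N') ^ n = z ^ n * \<xi> powi (- int (N' * n))"
      by (simp add: power_mult_distrib power_int_minus power_mult power_inverse del: of_nat_mult)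
    also have "\<dots> = (z ^ n * \<xi> powi e) * \<xi> powi (- e - int (N' * n))"
      by (simp add: power_int_diff power_int_minus field_simps del: of_nat_mult power_int_of_nat)
    also have "\<dots> \<in> V"
    proof (rule V_closed(5))
      have "int N' * 1 \<le> int N' * int n" using ne(1) by (intro mult_left_mono) auto
      then show "\<xi> powi (- e - int (N' * n)) \<in> V" using N' by (simp add: x_powi_in_V_iff)
    qed (use ne in auto)
    finally have "z * inverse \<xi> ^ N' \<in> V" using root_in_valuation_ring[OF val] ne(1) by blast
    then have "z * inverse \<xi> ^ N' * inverse \<xi> \<in> \<mm>" by (intro m_props(5) inverse_x_in_m)
    then show ?thesis by (simp add: N' mult_ac)
  qed
  then show ?thesis by blast
qed (auto simp: m_props)

end

section \<open>Resultants and irreducible polynomials over K[x]\<close>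

text \<open>
The Brown-Traub identities for subresultants at level 0; for a constant remainder the level equals its degree, which is a boundary case.
\<close>

lemma resultant_euclid_step:
  fixes F B G H :: "'a::idom poly"
  assumes "F + B * G = H" "degree F \<ge> degree G" "degree G > degree H"
  shows "resultant F G = (-1) ^ (degree F * degree G) * lead_coeff G ^ (degree F - degree H) * resultant G H"
proof (cases "degree H = 0")
  case False
  have "coeff (subresultant 0 F G) 0 = 
    (-1) ^ (degree F * degree G) * lead_coeff G ^ (degree F - degree H) * coeff (subresultant 0 G H) 0"
    by (subst BT_lemma_1_12[OF assms(1,2)]) (use assms(3) False in auto)
  then show ?thesis by (simp only: coeff_subresultant_0_0_resultant)
next
  case True
  then obtain h where h: "H = [:h:]" by (rule degree_eq_zeroE)
  have "coeff (subresultant (degree H) F G) 0 = 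
    (-1) ^ (degree F * degree G) * lead_coeff G ^ (degree F) * h ^ (degree G - 1) * coeff H 0"
    by (subst BT_lemma_1_13'[OF assms(1,2)]) (use assms(3) h in auto)
  moreover have "h ^ (degree G - 1) * coeff H 0 = h ^ degree G"
    using assms(3) h by (cases "degree G") auto
  ultimately show ?thesis using True by (simp add: coeff_subresultant_0_0_resultant h mult.assoc)
qed

definition split_poly :: "'a::idom \<Rightarrow> 'a multiset \<Rightarrow> 'a poly" where
  "split_poly a A = smult a (\<Prod>x\<in>#A. [:-x, 1:])"

lemma split_poly_simps:
  assumes "a \<noteq> 0"
  shows "degree (split_poly a A) = size A" "lead_coeff (split_poly a A) = a"
    "poly (split_poly a A) z = a * (\<Prod>x\<in>#A. z - x)"
proof -
  have *: "degree (\<Prod>x\<in>#A. [:-x, 1:]) = size A \<and> lead_coeff (\<Prod>x\<in>#A. [:-x, 1:]) = 1"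
  proof (induction A)
    case (add x A)
    then have "(\<Prod>x\<in>#A. [:-x, 1:]) \<noteq> 0" by auto
    then have "degree ([:-x, 1:] * (\<Prod>x\<in>#A. [:-x, 1:])) = Suc (size A)"
      using add by (subst degree_mult_eq) auto
    moreover have "lead_coeff ([:-x, 1:] * (\<Prod>x\<in>#A. [:-x, 1:])) = 1"
      using add by (subst lead_coeff_mult) auto
    ultimately show ?case by simp
  qed simp
  show "degree (split_poly a A) = size A" "lead_coeff (split_poly a A) = a"
    using * assms by (auto simp: split_poly_def)
  have "poly (\<Prod>x\<in>#A. [:-x, 1:]) z = (\<Prod>x\<in>#A. z - x)" by (induction A) (auto simp: algebra_simps)
  then show "poly (split_poly a A) z = a * (\<Prod>x\<in>#A. z - x)" by (simp add: split_poly_def)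
qed

lemma prod_differences_swap:
  fixes A B :: "'a::comm_ring_1 multiset"
  shows "(\<Prod>x\<in>#A. \<Prod>y\<in>#B. x - y) = (-1) ^ (size A * size B) * (\<Prod>y\<in>#B. \<Prod>x\<in>#A. y - x)"
proof -
  have 1: "(\<Prod>y\<in>#B. x - y) = (-1) ^ size B * (\<Prod>y\<in>#B. y - x)" for x
    by (induction B) (auto simp: algebra_simps)
  have "(\<Prod>x\<in>#A. \<Prod>y\<in>#B. x - y) = (-1) ^ (size A * size B) * (\<Prod>x\<in>#A. \<Prod>y\<in>#B. y - x)"
    by (induction A) (simp_all add: 1 power_add algebra_simps)
  also have "(\<Prod>x\<in>#A. \<Prod>y\<in>#B. y - x) = (\<Prod>y\<in>#B. \<Prod>x\<in>#A. y - x)"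
    by (rule prod_mset.swap)
  finally show ?thesis .
qed

lemma prod_mset_const_mult:
  "(\<Prod>x\<in>#A. (c::'a::comm_monoid_mult) * f x) = c ^ size A * (\<Prod>x\<in>#A. f x)"
  by (induction A) (auto simp: mult_ac)

text \<open>
Both sides satisfy the same Euclidean recursion: the remainder \<open>H\<close> of \<open>F\<close> modulo \<open>G\<close> agrees with \<open>F\<close> at the roots
of \<open>G\<close>.
\<close>

lemma resultant_split_polys:
  fixes a b :: "'a::alg_closed_field"
  assumes "a \<noteq> 0" "b \<noteq> 0"
  shows "resultant (split_poly a A) (split_poly b B) =
    a ^ size B * b ^ size A * (\<Prod>x\<in>#A. \<Prod>y\<in>#B. x - y)"
  using assms
proof (induction "min (size A) (size B)" arbitrary: a b A B rule: less_induct)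
  case less
  have main: "resultant (split_poly a A) (split_poly b B) = a ^ size B * b ^ size A * (\<Prod>x\<in>#A. \<Prod>y\<in>#B. x - y)"
    if le: "size B \<le> size A" and ab: "a \<noteq> 0" "b \<noteq> 0"
      and IH: "\<And>c C. size C < size B \<Longrightarrow> c \<noteq> 0 \<Longrightarrow> resultant (split_poly b B) (split_poly c C) =
         b ^ size C * c ^ size B * (\<Prod>x\<in>#B. \<Prod>y\<in>#C. x - y)" for a b :: 'a and A B
  proof (cases "B = {#}")
    case True
    then have "split_poly b B = [:b:]" by (simp add: split_poly_def)
    then show ?thesis using True split_poly_simps[OF ab(1), of A] by simp
  next
    case False
    define F G where "F = split_poly a A" and "G = split_poly b B"
    note F = split_poly_simps[OF ab(1), of A, folded F_def]
    note G = split_poly_simps[OF ab(2), of B, folded G_def]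
    define H where "H = F mod G"
    have G0: "G \<noteq> 0" "degree G > 0" using G(1,2) ab False by (auto simp: nonempty_has_size)
    have dH: "degree H < degree G" using degree_mod_less[of G F] G0 by (auto simp: H_def)
    have FH: "F + (- (F div G)) * G = H" using div_mult_mod_eq[of F G] by (simp add: H_def algebra_simps)
    have euc: "resultant F G = (-1) ^ (size A * size B) * b ^ (size A - degree H) * resultant G H"
      using resultant_euclid_step[OF FH _ dH] F G le by simp
    have Hev: "poly H y = poly F y" if "y \<in># B" for y
    proof -
      have "poly G y = 0" using that G(3) by (auto simp: prod_mset_zero_iff)
      then show ?thesis unfolding FH[symmetric] by simp
    qed
    have RGH: "resultant G H = b ^ degree H * (\<Prod>y\<in>#B. poly H y)"
    proof (cases "H = 0")
      case True
      then show ?thesis using G0 False by (auto simp: resultant_0(2) prod_mset_zero_iff nonempty_has_size)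
    next
      case H0: False
      obtain C where "size C = degree H" and C: "H = split_poly (lead_coeff H) C"
        using alg_closed_imp_factorization[OF H0] by (auto simp: split_poly_def)
      have "resultant G H = b ^ size C * (lead_coeff H ^ size B * (\<Prod>x\<in>#B. \<Prod>y\<in>#C. x - y))"
        unfolding G_def mult.assoc[symmetric] by (subst C, rule IH) (use dH \<open>size C = degree H\<close> G H0 in auto)
      also have "lead_coeff H ^ size B * (\<Prod>x\<in>#B. \<Prod>y\<in>#C. x - y) = (\<Prod>x\<in>#B. poly H x)"
      proof -
        have "poly H x = lead_coeff H * (\<Prod>y\<in>#C. x - y)" for x
          by (subst (1) C, rule split_poly_simps(3)) (use H0 in simp)
        then show ?thesis by (simp add: prod_mset_const_mult)
      qed
      finally show ?thesis using \<open>size C = degree H\<close> by (simp add: mult.assoc)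
    qed
    have "(\<Prod>y\<in>#B. poly H y) = (\<Prod>y\<in>#B. a * (\<Prod>x\<in>#A. y - x))"
      using Hev F(3) by (intro arg_cong[where f = prod_mset] image_mset_cong) auto
    also have "\<dots> = a ^ size B * (\<Prod>y\<in>#B. \<Prod>x\<in>#A. y - x)" by (simp add: prod_mset_const_mult)
    finally have "resultant F G = (-1) ^ (size A * size B) * (b ^ (size A - degree H) * b ^ degree H) *
       (a ^ size B * (\<Prod>y\<in>#B. \<Prod>x\<in>#A. y - x))" using euc RGH by (simp add: mult_ac)
    also have "b ^ (size A - degree H) * b ^ degree H = b ^ size A"
      using dH G le by (simp flip: power_add)
    finally have E: "resultant F G = (-1) ^ (size A * size B) * b ^ size A * (a ^ size B * (\<Prod>y\<in>#B. \<Prod>x\<in>#A. y - x))" .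
    let ?n = "size A * size B" and ?P = "\<Prod>x\<in>#A. \<Prod>y\<in>#B. x - y"
    have "resultant F G = (-1) ^ ?n * b ^ size A * (a ^ size B * ((-1) ^ ?n * ?P))"
      by (simp only: E prod_differences_swap[where A = B and B = A] mult.commute[of "size B"])
    also have "\<dots> = ((-1) ^ ?n * (-1) ^ ?n) * (a ^ size B * b ^ size A * ?P)" by (simp only: mult_ac)
    also have "\<dots> = a ^ size B * b ^ size A * ?P" by (simp flip: power_mult_distrib)
    finally show ?thesis unfolding F_def G_def .
  qed
  show ?case
  proof (cases "size B \<le> size A")
    case True
    show ?thesis
      by (rule main[OF True less.prems], rule less.hyps) (use less.prems True in auto)
  next
    case False
    have "resultant (split_poly b B) (split_poly a A) = b ^ size A * a ^ size B * (\<Prod>x\<in>#B. \<Prod>y\<in>#A. x - y)"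
      by (rule main, use False in simp, use less.prems in simp, use less.prems in simp, rule less.hyps)
         (use less.prems False in auto)
    note R = this
    let ?n = "size A * size B" and ?P = "\<Prod>x\<in>#A. \<Prod>y\<in>#B. x - y"
    have "resultant (split_poly a A) (split_poly b B) = (-1) ^ ?n * resultant (split_poly b B) (split_poly a A)"
      by (subst resultant_swap) (simp add: split_poly_simps less.prems)
    also have "\<dots> = (-1) ^ ?n * (b ^ size A * a ^ size B * ((-1) ^ ?n * ?P))"
      by (simp only: R prod_differences_swap[where A = B and B = A] mult.commute[of "size B"])
    also have "\<dots> = ((-1) ^ ?n * (-1) ^ ?n) * (a ^ size B * b ^ size A * ?P)" by (simp only: mult_ac)
    also have "\<dots> = a ^ size B * b ^ size A * ?P" by (simp flip: power_mult_distrib)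
    finally show ?thesis .
  qed
qed

lemma resultant_eq_prod_roots:
  fixes F G :: "'a::alg_closed_field poly"
  assumes "F = smult a (\<Prod>x\<in>#A. [:-x, 1:])" "a \<noteq> 0" "G \<noteq> 0"
  shows "resultant F G = a ^ degree G * (\<Prod>x\<in>#A. poly G x)"
proof -
  have F: "F = split_poly a A" using assms by (simp add: split_poly_def)
  obtain B where B: "size B = degree G" "G = split_poly (lead_coeff G) B"
    using alg_closed_imp_factorization[OF assms(3)] by (auto simp: split_poly_def)
  have l: "lead_coeff G \<noteq> 0" using assms by simp
  have "resultant F G = a ^ size B * (lead_coeff G ^ size A * (\<Prod>x\<in>#A. \<Prod>y\<in>#B. x - y))"
    unfolding F mult.assoc[symmetric] by (subst B(2), rule resultant_split_polys) (use assms in auto)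
  also have "lead_coeff G ^ size A * (\<Prod>x\<in>#A. \<Prod>y\<in>#B. x - y) = (\<Prod>x\<in>#A. poly G x)"
  proof -
    have "poly G x = lead_coeff G * (\<Prod>y\<in>#B. x - y)" for x
      by (subst (1) B(2), rule split_poly_simps(3)) (use l in simp)
    then show ?thesis by (simp add: prod_mset_const_mult)
  qed
  finally show ?thesis using B(1) by (simp add: mult.assoc)
qed

lemma linear_dvd_coeffs:
  fixes q :: "'a::idom poly poly"
  assumes "\<And>i. poly (coeff q i) a = 0"
  obtains q' where "q = smult [:-a, 1:] q'" "degree q' = degree q"
proof -
  have "\<exists>q'. q = smult [:-a, 1:] q'" using assms
  proof (induction q rule: pCons_induct)
    case 0 then show ?case by (auto intro: exI[of _ 0])
  next
    case (pCons c q)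
    have "poly c a = 0" using pCons.prems[of 0] by simp
    then obtain c' where c': "c = [:-a, 1:] * c'" using poly_eq_0_iff_dvd by (metis dvdE)
    have "poly (coeff q i) a = 0" for i using pCons.prems[of "Suc i"] by simp
    then obtain q' where "q = smult [:-a, 1:] q'" using pCons.IH by auto
    then show ?case using c' by (intro exI[of _ "pCons c' q'"]) simp
  qed
  then obtain q' where "q = smult [:-a, 1:] q'" by auto
  then show ?thesis using that by simp
qed

lemma degree_unit_poly: "p dvd 1 \<Longrightarrow> degree p = 0" for p :: "'a::idom poly"
proof -
  assume "p dvd 1"
  then obtain q where "1 = p * q" by (rule dvdE)
  then show "degree p = 0" using degree_mult_eq[of p q] by (cases "p = 0 \<or> q = 0") (auto simp: degree_1)
qed

lemma smult_cancel_left: "c \<noteq> 0 \<Longrightarrow> smult c p = smult c q \<Longrightarrow> p = q" for c :: "'a::idom"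
  by (simp add: poly_eq_iff)

text \<open>
Gauss's lemma for \<open>K[x][y]\<close>. The primes of \<open>K[x]\<close> are the linear polynomials \<open>x - a\<close>, so a root \<open>a\<close> of \<open>c\<close> can be
cancelled: at \<open>x = a\<close> the product \<open>q * p\<close> vanishes, hence one of its factors does.
\<close>

lemma irreducible_no_scalar_factorization:
  fixes f :: "'a::alg_closed_field poly poly"
  assumes irr: "irreducible f" and "c \<noteq> 0" "smult c f = q * p"
  shows "degree q = 0 \<or> degree p = 0"
  using assms(2,3)
proof (induction "degree c" arbitrary: c q p rule: less_induct)
  case less
  show ?case
  proof (cases "degree c = 0")
    case True
    then obtain e where e: "c = [:e:]" by (rule degree_eq_zeroE)
    then have "f = smult [:inverse e:] (smult c f)" using less.prems(1) by simp
    also have "\<dots> = smult [:inverse e:] q * p" using less.prems(2) by simp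
    finally have "smult [:inverse e:] q dvd 1 \<or> p dvd 1" by (rule Factorial_Ring.irreducibleD[OF irr])
    then have "degree (smult [:inverse e:] q) = 0 \<or> degree p = 0"
      by (elim disj_forward degree_unit_poly)
    then show ?thesis using e less.prems(1) by simp
  next
    case False
    then obtain a where a: "poly c a = 0" using alg_closed_imp_poly_has_root[of c] by blast
    obtain c' where c': "c = [:-a, 1:] * c'" using a poly_eq_0_iff_dvd by (metis dvdE)
    have c'0: "c' \<noteq> 0" using c' less.prems(1) by auto
    have dc': "degree c' < degree c" using c'0 unfolding c' by (subst degree_mult_eq) auto
    interpret ev: comm_ring_hom "\<lambda>p. poly p a" by unfold_locales auto
    interpret mev: map_poly_comm_ring_hom "\<lambda>p. poly p a" ..
    have "map_poly (\<lambda>p. poly p a) q * map_poly (\<lambda>p. poly p a) p = map_poly (\<lambda>p. poly p a) (smult c f)"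
      unfolding less.prems(2) by (simp add: mev.hom_mult)
    also have "\<dots> = 0" using a by (simp add: poly_eq_iff coeff_map_poly)
    finally have "map_poly (\<lambda>p. poly p a) q = 0 \<or> map_poly (\<lambda>p. poly p a) p = 0" by simp
    then show ?thesis
    proof
      assume "map_poly (\<lambda>p. poly p a) q = 0"
      then have "poly (coeff q i) a = 0" for i by (simp add: poly_eq_iff coeff_map_poly)
      then obtain q' where q': "q = smult [:-a, 1:] q'" "degree q' = degree q" using linear_dvd_coeffs by blast
      have "smult [:-a, 1:] (smult c' f) = smult [:-a, 1:] (q' * p)"
        using less.prems(2) unfolding c' q'(1) by (simp only: smult_smult mult_smult_left)
      then have "smult c' f = q' * p" by (rule smult_cancel_left[rotated]) simp
      from less.hyps[OF dc' c'0 this] show ?thesis using q'(2) by simp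
    next
      assume "map_poly (\<lambda>p. poly p a) p = 0"
      then have "poly (coeff p i) a = 0" for i by (simp add: poly_eq_iff coeff_map_poly)
      then obtain p' where p': "p = smult [:-a, 1:] p'" "degree p' = degree p" using linear_dvd_coeffs by blast
      have "smult [:-a, 1:] (smult c' f) = smult [:-a, 1:] (q * p')"
        using less.prems(2) unfolding c' p'(1) by (simp only: smult_smult mult_smult_right)
      then have "smult c' f = q * p'" by (rule smult_cancel_left[rotated]) simp
      from less.hyps[OF dc' c'0 this] show ?thesis using p'(2) by simp
    qed
  qed
qed

text \<open>
The ideal generated by an irreducible \<open>f\<close> and some \<open>v\<close> over the field \<open>K(x)\<close> is either everything or generated by \<open>f\<close>;
here with denominators cleared. The proof takes an element \<open>r\<close> of least degree in the ideal and uses pseudo-division.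
\<close>

lemma pseudo_bezout:
  fixes f v :: "'a::alg_closed_field poly poly"
  assumes irr: "irreducible f" and df: "degree f > 0"
  obtains (bezout) \<alpha> \<beta> c where "c \<noteq> 0" "\<alpha> * f + \<beta> * v = [:c:]"
  | (multiple) q c where "c \<noteq> 0" "smult c v = q * f"
proof -
  define I where "I = {r. r \<noteq> 0 \<and> (\<exists>\<alpha> \<beta>. r = \<alpha> * f + \<beta> * v)}"
  have fc: "\<exists>\<alpha> \<beta>. f = \<alpha> * f + \<beta> * v" by (rule exI[of _ 1], rule exI[of _ 0]) simp
  have vc: "\<exists>\<alpha> \<beta>. v = \<alpha> * f + \<beta> * v" by (rule exI[of _ 0], rule exI[of _ 1]) simp
  have f0: "f \<noteq> 0" using irr by (auto simp: irreducible_def)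
  have fI: "f \<in> I" using f0 fc unfolding I_def by blast
  define r where "r = arg_min degree (\<lambda>r. r \<in> I)"
  have r: "r \<in> I" and rmin: "\<And>s. s \<in> I \<Longrightarrow> degree r \<le> degree s"
    unfolding r_def using fI arg_min_natI[of "\<lambda>r. r \<in> I" f degree] arg_min_nat_le[of "\<lambda>r. r \<in> I" _ degree]
    by blast+
  obtain \<alpha> \<beta> where ab: "r = \<alpha> * f + \<beta> * v" "r \<noteq> 0" using r by (auto simp: I_def)
  show ?thesis
  proof (cases "degree r = 0")
    case True
    then obtain c where "r = [:c:]" by (rule degree_eq_zeroE)
    then show ?thesis using bezout[of c \<alpha> \<beta>] ab by auto
  next
    case False
    have divide: "\<exists>c q. c \<noteq> 0 \<and> smult c h = q * r" if h: "\<exists>\<alpha> \<beta>. h = \<alpha> * f + \<beta> * v" for h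
    proof -
      obtain q s where qs: "pseudo_divmod h r = (q, s)" by (cases "pseudo_divmod h r")
      note pd = pseudo_divmod[OF ab(2) qs]
      define c where "c = lead_coeff r ^ (Suc (degree h) - degree r)"
      have c: "smult c h = r * q + s" "c \<noteq> 0" using pd(1) ab(2) by (auto simp: c_def)
      have "s = 0"
      proof (rule ccontr)
        assume "s \<noteq> 0"
        obtain \<alpha>' \<beta>' where h': "h = \<alpha>' * f + \<beta>' * v" using h by auto
        have "s = smult c h - r * q" using c by simp
        also have "\<dots> = (smult c \<alpha>' - \<alpha> * q) * f + (smult c \<beta>' - \<beta> * q) * v"
          unfolding h' ab(1) by (simp add: algebra_simps smult_add_right)
        finally have "s \<in> I" using \<open>s \<noteq> 0\<close> unfolding I_def by blast
        then show False using rmin[of s] pd(2) \<open>s \<noteq> 0\<close> by simp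
      qed
      then show ?thesis using c by (auto simp: mult.commute)
    qed
    obtain c q where c: "c \<noteq> 0" "smult c f = q * r"
      using divide[OF fc] by blast
    obtain c' q' where c': "c' \<noteq> 0" "smult c' v = q' * r"
      using divide[OF vc] by blast
    have "degree q = 0" using irreducible_no_scalar_factorization[OF irr c] False by simp
    then obtain e where e: "q = [:e:]" by (rule degree_eq_zeroE)
    have e0: "e \<noteq> 0" using c e f0 by auto
    have "smult (e * c') v = q' * smult e r" using c' by (simp flip: smult_smult)
    also have "smult e r = smult c f" using c e by simp
    finally have "smult (e * c') v = smult c q' * f" by simp
    then show ?thesis by (rule multiple[rotated]) (use e0 c' in simp)
  qed
qed

section \<open>The function field of a plane curve\<close>

text \<open>
The curve \<open>f = 0\<close> over the \<open>x\<close>-line. The nonvanishing resultant says that the \<open>d\<close> roots of \<open>f\<close> are distinct.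
\<close>

locale plane_curve = function_field_place \<iota> V for \<iota> :: "'a::{alg_closed_field,field_char_0} poly \<Rightarrow> 'm::{alg_closed_field,field_char_0}" and V +
  fixes f :: "'a poly poly"
  assumes irr: "irreducible f" and deg: "degree f \<ge> 2" and sep: "resultant f (pderiv f) \<noteq> 0"
begin

sublocale m\<iota>: map_poly_inj_comm_ring_hom \<iota> ..

definition fM where "fM = map_poly \<iota> f"
definition R where "R = {\<theta>. poly fM \<theta> = 0}"
definition d where "d = degree f"
definition lc where "lc = \<iota> (lead_coeff f)"
definition ev where "ev v \<theta> = poly (map_poly \<iota> v) \<theta>"

lemma ev_simps [simp]:
  "ev 0 \<theta> = 0" "ev (v + w) \<theta> = ev v \<theta> + ev w \<theta>" "ev (v - w) \<theta> = ev v \<theta> - ev w \<theta>"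
  "ev (v * w) \<theta> = ev v \<theta> * ev w \<theta>" "ev [:c:] \<theta> = \<iota> c" "ev (smult c v) \<theta> = \<iota> c * ev v \<theta>"
  "ev 1 \<theta> = 1" "ev (v ^ n) \<theta> = ev v \<theta> ^ n"
  by (simp_all add: ev_def hom_distribs)

lemma f_nz [simp]: "f \<noteq> 0" using deg by auto

lemma lc_nz [simp]: "lc \<noteq> 0" by (simp add: lc_def)

lemma degree_fM: "degree fM = d" "lead_coeff fM = lc"
  by (simp_all add: fM_def d_def lc_def)

lemma ev_f: "\<theta> \<in> R \<Longrightarrow> ev f \<theta> = 0" by (simp add: R_def ev_def fM_def)

lemma pderiv_fM: "pderiv fM = map_poly \<iota> (pderiv f)"
  by (rule poly_eqI) (simp add: fM_def coeff_pderiv coeff_map_poly \<iota>.hom_mult hom_distribs)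

lemma resultant_pderiv_M: "resultant fM (pderiv fM) = \<iota> (resultant f (pderiv f))"
  unfolding pderiv_fM by (simp add: fM_def \<iota>.resultant_hom)

lemma roots_multiset:
  obtains A where "size A = d" "fM = smult lc (\<Prod>x\<in>#A. [:-x, 1:])" "A = mset_set R"
    "\<And>x. x \<in> R \<Longrightarrow> poly (pderiv fM) x \<noteq> 0" "finite R"
proof -
  have fM0: "fM \<noteq> 0" by (simp add: fM_def)
  obtain A where A: "size A = d" "fM = smult lc (\<Prod>x\<in>#A. [:-x, 1:])"
    using alg_closed_imp_factorization[OF fM0] by (metis degree_fM)
  have pd0: "pderiv fM \<noteq> 0" using deg by (simp add: pderiv_eq_0_iff degree_fM d_def)
  have "lc ^ degree (pderiv fM) * (\<Prod>x\<in>#A. poly (pderiv fM) x) \<noteq> 0"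
  proof -
    have "resultant fM (pderiv fM) \<noteq> 0" using resultant_pderiv_M sep by simp
    then show ?thesis using resultant_eq_prod_roots[OF A(2) lc_nz pd0] by simp
  qed
  then have nz: "poly (pderiv fM) x \<noteq> 0" if "x \<in># A" for x
    using that by (auto simp: prod_mset_zero_iff)
  have RA: "R = set_mset A"
  proof -
    have "poly fM x = lc * (\<Prod>y\<in>#A. x - y)" for x
      using split_poly_simps(3)[OF lc_nz, of A x] A(2) by (simp add: split_poly_def)
    then show ?thesis by (auto simp: R_def prod_mset_zero_iff)
  qed
  have "count A x \<le> 1" for x
  proof (rule ccontr)
    assume "\<not> count A x \<le> 1"
    then obtain B where "A = {#x, x#} + B"
      by (metis One_nat_def count_le_replicate_mset_subset_eq mset_subset_eq_exists_conv not_less_eq_eq numeral_2_eq_2 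
          replicate_mset_Suc replicate_mset_0 not_le Suc_leI)
    then have eq: "fM = [:-x, 1:] * ([:-x, 1:] * smult lc (\<Prod>x\<in>#B. [:-x, 1:]))" and "x \<in># A"
      unfolding A(2) by simp_all
    have "poly (pderiv fM) x = 0" unfolding eq pderiv_mult poly_add poly_mult by simp
    then show False using nz \<open>x \<in># A\<close> by blast
  qed
  then have "A = mset_set R" unfolding RA
    by (intro multiset_eqI) (metis count_eq_zero_iff count_mset_set(1,3) finite_set_mset le_antisym One_nat_def Suc_leI neq0_conv)
  then show ?thesis using that A nz RA by (metis finite_set_mset)
qed

lemma finite_R [simp, intro]: "finite R" using roots_multiset by metis

lemma card_R: "card R = d" using roots_multiset by (metis size_mset_set)

lemma pderiv_root_nz: "\<theta> \<in> R \<Longrightarrow> poly (pderiv fM) \<theta> \<noteq> 0" using roots_multiset by metis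

lemma fM_factorization: "fM = smult lc (\<Prod>\<theta>\<in>R. [:-\<theta>, 1:])"
  using roots_multiset by (metis prod_unfold_prod_mset)

lemma resultant_f: "v \<noteq> 0 \<Longrightarrow> \<iota> (resultant f v) = lc ^ degree v * (\<Prod>\<theta>\<in>R. ev v \<theta>)"
proof -
  assume "v \<noteq> 0"
  obtain A where A: "fM = smult lc (\<Prod>x\<in>#A. [:-x, 1:])" "A = mset_set R" using roots_multiset by metis
  have "\<iota> (resultant f v) = resultant fM (map_poly \<iota> v)" by (simp add: fM_def \<iota>.resultant_hom)
  also have "\<dots> = lc ^ degree v * (\<Prod>x\<in>#A. ev v x)"
    using resultant_eq_prod_roots[OF A(1), of "map_poly \<iota> v"] \<open>v \<noteq> 0\<close> by (simp add: ev_def)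
  finally show ?thesis by (simp add: A(2) prod_unfold_prod_mset)
qed

text \<open>
The function field of the curve. A rational function is recorded by its values at all roots of \<open>f\<close>, that is, by all its
conjugates over \<open>K(x)\<close>; maps that agree on \<open>R\<close> stand for the same function. Norm and trace are then the product and the sum over \<open>R\<close>.
\<close>

definition L :: "('m \<Rightarrow> 'm) set" where
  "L = {z. \<exists>v c. c \<noteq> 0 \<and> (\<forall>\<theta>\<in>R. z \<theta> = ev v \<theta> / \<iota> c)}"

lemma L_I: "c \<noteq> 0 \<Longrightarrow> (\<And>\<theta>. \<theta> \<in> R \<Longrightarrow> z \<theta> = ev v \<theta> / \<iota> c) \<Longrightarrow> z \<in> L"
  unfolding L_def by blast

lemma L_cong: "z \<in> L \<Longrightarrow> (\<And>\<theta>. \<theta> \<in> R \<Longrightarrow> w \<theta> = z \<theta>) \<Longrightarrow> w \<in> L"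
  unfolding L_def by simp

lemma L_add: assumes "z \<in> L" "w \<in> L" shows "(\<lambda>\<theta>. z \<theta> + w \<theta>) \<in> L"
proof -
  obtain v c v' c' where "c \<noteq> 0" "\<forall>\<theta>\<in>R. z \<theta> = ev v \<theta> / \<iota> c" "c' \<noteq> 0" "\<forall>\<theta>\<in>R. w \<theta> = ev v' \<theta> / \<iota> c'"
    using assms unfolding L_def by blast
  then show ?thesis
    by (intro L_I[of "c * c'" _ "smult c' v + smult c v'"]) (auto simp: \<iota>.hom_mult field_simps)
qed

lemma L_mult: assumes "z \<in> L" "w \<in> L" shows "(\<lambda>\<theta>. z \<theta> * w \<theta>) \<in> L"
proof -
  obtain v c v' c' where "c \<noteq> 0" "\<forall>\<theta>\<in>R. z \<theta> = ev v \<theta> / \<iota> c" "c' \<noteq> 0" "\<forall>\<theta>\<in>R. w \<theta> = ev v' \<theta> / \<iota> c'"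
    using assms unfolding L_def by blast
  then show ?thesis
    by (intro L_I[of "c * c'" _ "v * v'"]) (auto simp: \<iota>.hom_mult field_simps)
qed

lemma L_ev: "ev v \<in> L" by (rule L_I[of 1 _ v]) auto

lemma L_const: "r \<in> \<F> \<Longrightarrow> (\<lambda>_. r) \<in> L"
  unfolding \<F>_def by (auto intro: L_I[of _ _ "[:_:]"])

lemma L_smult: "r \<in> \<F> \<Longrightarrow> z \<in> L \<Longrightarrow> (\<lambda>\<theta>. r * z \<theta>) \<in> L"
  using L_mult[OF L_const] .

lemma L_diff: assumes "z \<in> L" "w \<in> L" shows "(\<lambda>\<theta>. z \<theta> - w \<theta>) \<in> L"
  using L_add[OF assms(1) L_smult[OF _ assms(2)], of "-1"] \<F>_closed(1)[of "-1"]
  by (simp add: \<iota>.hom_uminus)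

lemma L_power: "z \<in> L \<Longrightarrow> (\<lambda>\<theta>. z \<theta> ^ n) \<in> L"
proof (induction n)
  case 0 then show ?case using L_const[OF \<F>_closed(1)[of 1]] by simp
next
  case (Suc n) then show ?case using L_mult[of z "\<lambda>\<theta>. z \<theta> ^ n"] by simp
qed

lemma L_sum: "(\<And>i. i \<in> I \<Longrightarrow> z i \<in> L) \<Longrightarrow> (\<lambda>\<theta>. \<Sum>i\<in>I. z i \<theta>) \<in> L"
  by (induction I rule: infinite_finite_induct) (use L_const[of 0] \<F>_closed(1)[of 0] in \<open>auto intro: L_add\<close>)

text \<open>
\<open>L\<close> is a field because \<open>f\<close> is irreducible: a function that vanishes at one root vanishes at all of them.
\<close>

lemma L_inverse:
  assumes "z \<in> L" "\<theta>\<^sub>0 \<in> R" "z \<theta>\<^sub>0 \<noteq> 0"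
  shows "(\<lambda>\<theta>. inverse (z \<theta>)) \<in> L" "\<And>\<theta>. \<theta> \<in> R \<Longrightarrow> z \<theta> \<noteq> 0"
proof -
  obtain v c where v: "c \<noteq> 0" "\<forall>\<theta>\<in>R. z \<theta> = ev v \<theta> / \<iota> c" using assms(1) unfolding L_def by blast
  have df: "degree f > 0" using deg by simp
  have "\<exists>\<beta> c'. c' \<noteq> 0 \<and> (\<forall>\<theta>\<in>R. ev \<beta> \<theta> * ev v \<theta> = \<iota> c')"
    using irr df
  proof (cases rule: pseudo_bezout[where v = v])
    case (bezout \<alpha> \<beta> c')
    have "ev \<beta> \<theta> * ev v \<theta> = \<iota> c'" if "\<theta> \<in> R" for \<theta>
    proof -
      have "ev (\<alpha> * f + \<beta> * v) \<theta> = \<iota> c'" unfolding bezout(2) by simp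
      then show ?thesis using ev_f[OF that] by simp
    qed
    then show ?thesis using bezout(1) by blast
  next
    case (multiple q c')
    have "ev (smult c' v) \<theta>\<^sub>0 = ev (q * f) \<theta>\<^sub>0" unfolding multiple(2) ..
    then show ?thesis using ev_f[OF assms(2)] multiple(1) assms v by auto
  qed
  then obtain \<beta> c' where b: "c' \<noteq> 0" "\<forall>\<theta>\<in>R. ev \<beta> \<theta> * ev v \<theta> = \<iota> c'" by blast
  have nz: "ev v \<theta> \<noteq> 0" if "\<theta> \<in> R" for \<theta> using b that by (metis \<iota>.hom_0_iff mult_zero_right)
  then show "z \<theta> \<noteq> 0" if "\<theta> \<in> R" for \<theta> using that v by auto
  show "(\<lambda>\<theta>. inverse (z \<theta>)) \<in> L"
  proof (rule L_I[OF b(1), of _ "smult c \<beta>"])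
    fix \<theta> assume "\<theta> \<in> R"
    then have "inverse (z \<theta>) = \<iota> c / ev v \<theta>" using v by simp
    also have "\<dots> = \<iota> c * ev \<beta> \<theta> / \<iota> c'" using nz[OF \<open>\<theta> \<in> R\<close>] b \<open>\<theta> \<in> R\<close> by (auto simp: field_simps)
    finally show "inverse (z \<theta>) = ev (smult c \<beta>) \<theta> / \<iota> c'" by simp
  qed
qed

lemma L_reduce:
  assumes "z \<in> L"
  obtains v c where "c \<noteq> 0" "degree v < d" "\<And>\<theta>. \<theta> \<in> R \<Longrightarrow> z \<theta> = ev v \<theta> / \<iota> c"
proof -
  obtain v c where v: "c \<noteq> 0" "\<forall>\<theta>\<in>R. z \<theta> = ev v \<theta> / \<iota> c" using assms unfolding L_def by blast
  obtain q s where qs: "pseudo_divmod v f = (q, s)" by (cases "pseudo_divmod v f")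
  note pd = pseudo_divmod[OF f_nz qs]
  define e where "e = lead_coeff f ^ (Suc (degree v) - degree f)"
  have e0: "e \<noteq> 0" by (simp add: e_def)
  have e: "smult e v = f * q + s" using pd(1) by (simp add: e_def)
  show ?thesis
  proof (rule that[of "e * c" s])
    show "e * c \<noteq> 0" using e0 v by simp
    show "degree s < d" using pd(2) deg by (auto simp: d_def)
    fix \<theta> assume \<theta>: "\<theta> \<in> R"
    have "ev (smult e v) \<theta> = ev s \<theta>" unfolding e using ev_f[OF \<theta>] by simp
    then show "z \<theta> = ev s \<theta> / \<iota> (e * c)" using v \<theta> e0 by (simp add: \<iota>.hom_mult flip: \<open>ev (smult e v) \<theta> = ev s \<theta>\<close>)
  qed
qed

lemma L_norm: assumes "z \<in> L" shows "(\<Prod>\<theta>\<in>R. z \<theta>) \<in> \<F>"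
proof -
  obtain v c where v: "c \<noteq> 0" "\<forall>\<theta>\<in>R. z \<theta> = ev v \<theta> / \<iota> c" using assms unfolding L_def by blast
  have "(\<Prod>\<theta>\<in>R. z \<theta>) = (\<Prod>\<theta>\<in>R. ev v \<theta>) / \<iota> c ^ d" using v by (simp add: prod_dividef card_R)
  moreover have "(\<Prod>\<theta>\<in>R. ev v \<theta>) \<in> \<F>"
  proof (cases "v = 0")
    case True
    then show ?thesis using \<F>_closed(1)[of 0] deg by (simp add: card_R d_def power_0_left)
  next
    case False
    then have "(\<Prod>\<theta>\<in>R. ev v \<theta>) = \<iota> (resultant f v) / lc ^ degree v" using resultant_f by simp
    then show ?thesis using \<F>_closed by (simp add: lc_def)
  qed
  ultimately show ?thesis using \<F>_closed by simp
qed

text \<open>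
The coefficients of \<open>f(y) / (y - \<theta>)\<close>. Divided by \<open>f'(\<theta>)\<close> they form the basis dual to the powers of \<open>\<theta>\<close> for the
trace form (Euler).
\<close>

definition H where "H k \<theta> = coeff (synthetic_div fM \<theta>) k"

lemma poly_eq_sum_upto:
  fixes p :: "'b::comm_semiring_1 poly"
  assumes "degree p \<le> n" shows "poly p x = (\<Sum>i\<le>n. coeff p i * x ^ i)"
  unfolding poly_altdef using assms by (intro sum.mono_neutral_left) (auto simp: coeff_eq_0)

lemma coeff_synthetic_div: "coeff (synthetic_div p c) k = poly (poly_shift (Suc k) p) c"
  for p :: "'b::comm_ring_1 poly"
proof (induction p arbitrary: k)
  case (pCons a p)
  have "poly_shift (Suc k) (pCons a p) = poly_shift k p" 
    by (rule poly_eqI) (simp add: coeff_poly_shift)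
  moreover have "poly_shift 0 p = p" by (rule poly_eqI) (simp add: coeff_poly_shift)
  ultimately show ?case using pCons.IH by (cases k) auto
qed simp

lemma H_ev: "H k = ev (poly_shift (Suc k) f)"
proof
  fix \<theta>
  have "poly_shift (Suc k) fM = map_poly \<iota> (poly_shift (Suc k) f)"
    by (rule poly_eqI) (simp add: coeff_poly_shift fM_def coeff_map_poly)
  then show "H k \<theta> = ev (poly_shift (Suc k) f) \<theta>" by (simp add: H_def coeff_synthetic_div ev_def)
qed

lemma H_L: "H k \<in> L" unfolding H_ev by (rule L_ev)

lemma H_top: "H (d - 1) \<theta> = lc"
proof -
  have "poly_shift d f = [:lead_coeff f:]"
    by (rule poly_eqI) (simp add: coeff_poly_shift d_def coeff_pCons coeff_eq_0 split: nat.split)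
  then show ?thesis using deg by (simp add: H_ev lc_def d_def)
qed

lemma synthetic_div_root:
  assumes "\<theta> \<in> R" "\<eta> \<in> R"
  shows "poly (synthetic_div fM \<theta>) \<eta> = (if \<eta> = \<theta> then poly (pderiv fM) \<theta> else 0)"
proof -
  have eq: "fM = [:-\<theta>, 1:] * synthetic_div fM \<theta>"
    using synthetic_div_correct'[of \<theta> fM] assms(1) by (simp add: R_def)
  have "pderiv fM = [:-\<theta>, 1:] * pderiv (synthetic_div fM \<theta>) + synthetic_div fM \<theta>"
    by (subst eq, subst pderiv_mult) (simp add: pderiv_pCons)
  moreover have "(\<eta> - \<theta>) * poly (synthetic_div fM \<theta>) \<eta> = 0"
  proof -
    have "poly fM \<eta> = (\<eta> - \<theta>) * poly (synthetic_div fM \<theta>) \<eta>" by (subst eq) (simp add: algebra_simps)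
    then show ?thesis using assms(2) by (simp add: R_def)
  qed
  ultimately show ?thesis by auto
qed

lemma synthetic_div_sum: "poly (synthetic_div fM \<theta>) \<eta> = (\<Sum>k<d. H k \<theta> * \<eta> ^ k)"
proof -
  have "degree (synthetic_div fM \<theta>) = d - 1" by (simp add: degree_synthetic_div degree_fM)
  moreover have "{..d - 1} = {..<d}" using deg by (auto simp: d_def)
  ultimately show ?thesis by (simp add: poly_altdef H_def)
qed

lemma lagrange_interpolation:
  assumes "degree v < d"
  shows "(\<Sum>\<theta>\<in>R. smult (poly v \<theta> / poly (pderiv fM) \<theta>) (synthetic_div fM \<theta>)) = v" (is "?S = v")
proof (rule poly_eqI_degree[of R])
  fix \<eta> assume \<eta>: "\<eta> \<in> R"
  have "poly ?S \<eta> = (\<Sum>\<theta>\<in>R. if \<theta> = \<eta> then poly v \<eta> else 0)"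
    unfolding poly_sum using \<eta> pderiv_root_nz by (intro sum.cong) (auto simp: synthetic_div_root)
  then show "poly ?S \<eta> = poly v \<eta>" using \<eta> by simp
next
  have "degree ?S \<le> d - 1"
    by (intro degree_sum_le order_trans[OF degree_smult_le]) (auto simp: degree_synthetic_div degree_fM)
  then show "degree ?S < card R" using deg by (simp add: card_R d_def)
  show "degree v < card R" using assms by (simp add: card_R)
qed

text \<open>
Comparing coefficients in the interpolation formula gives Euler's duality.
\<close>

lemma trace_dual:
  assumes "degree v < d"
  shows "(\<Sum>\<theta>\<in>R. poly v \<theta> / poly (pderiv fM) \<theta> * H k \<theta>) = coeff v k"
  using arg_cong[OF lagrange_interpolation[OF assms], of "\<lambda>p. coeff p k"]
  by (simp add: coeff_sum H_def)

text \<open>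
The expansion of a function in the basis of the \<open>H k\<close>, with traces as coefficients.
\<close>

lemma L_expand:
  assumes "\<eta> \<in> R"
  shows "z \<eta> = (\<Sum>k<d. (\<Sum>\<theta>\<in>R. z \<theta> * \<theta> ^ k / poly (pderiv fM) \<theta>) * H k \<eta>)"
proof -
  have "(\<Sum>k<d. (\<Sum>\<theta>\<in>R. z \<theta> * \<theta> ^ k / poly (pderiv fM) \<theta>) * H k \<eta>)
      = (\<Sum>\<theta>\<in>R. z \<theta> / poly (pderiv fM) \<theta> * (\<Sum>k<d. H k \<eta> * \<theta> ^ k))"
    unfolding sum_distrib_right sum_distrib_left by (subst sum.swap) (simp add: mult_ac)
  also have "\<dots> = (\<Sum>\<theta>\<in>R. if \<theta> = \<eta> then z \<eta> else 0)"
    using assms pderiv_root_nz by (intro sum.cong) (auto simp: synthetic_div_root simp flip: synthetic_div_sum)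
  finally show ?thesis using assms by simp
qed

lemma pderiv_L: "poly (pderiv fM) \<in> L" "(\<lambda>\<theta>. inverse (poly (pderiv fM) \<theta>)) \<in> L"
proof -
  show *: "poly (pderiv fM) \<in> L" using L_ev[of "pderiv f"] by (simp add: pderiv_fM ev_def[abs_def])
  have "R \<noteq> {}" using card_R deg by (auto simp: d_def)
  then show "(\<lambda>\<theta>. inverse (poly (pderiv fM) \<theta>)) \<in> L" using L_inverse(1)[OF *] pderiv_root_nz by blast
qed

text \<open>
After division by \<open>f'\<close> the trace is, by Euler duality with the constant \<open>H (d - 1)\<close>, a coefficient of a polynomial over
\<open>K(x)\<close>.
\<close>

lemma trace_in_\<F>: assumes "z \<in> L" shows "(\<Sum>\<theta>\<in>R. z \<theta>) \<in> \<F>"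
proof -
  obtain v c where v: "c \<noteq> 0" "degree v < d" "\<And>\<theta>. \<theta> \<in> R \<Longrightarrow> z \<theta> * poly (pderiv fM) \<theta> = ev v \<theta> / \<iota> c"
    using L_reduce[OF L_mult[OF assms pderiv_L(1)]] by metis
  have "lc * (\<Sum>\<theta>\<in>R. z \<theta>) = (\<Sum>\<theta>\<in>R. (ev v \<theta> / poly (pderiv fM) \<theta> * H (d - 1) \<theta>) / \<iota> c)"
    unfolding sum_distrib_left
  proof (intro sum.cong refl)
    fix \<theta> assume "\<theta> \<in> R"
    then have "z \<theta> = ev v \<theta> / \<iota> c / poly (pderiv fM) \<theta>" using v(3) pderiv_root_nz by (metis nonzero_mult_div_cancel_right)
    then show "lc * z \<theta> = ev v \<theta> / poly (pderiv fM) \<theta> * H (d - 1) \<theta> / \<iota> c" by (simp add: H_top[simplified] mult_ac)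
  qed
  also have "\<dots> = coeff (map_poly \<iota> v) (d - 1) / \<iota> c"
  proof -
    have "degree (map_poly \<iota> v) < d" using v(2) by simp
    from trace_dual[OF this, of "d - 1"] show ?thesis
      unfolding sum_divide_distrib[symmetric] ev_def by (simp only:)
  qed
  finally have "lc * (\<Sum>\<theta>\<in>R. z \<theta>) = \<iota> (coeff v (d - 1)) / \<iota> c" by (simp add: coeff_map_poly)
  moreover have "(\<Sum>\<theta>\<in>R. z \<theta>) = lc * (\<Sum>\<theta>\<in>R. z \<theta>) / lc" by simp
  ultimately have "(\<Sum>\<theta>\<in>R. z \<theta>) = \<iota> (coeff v (d - 1)) / \<iota> c / lc" by metis
  then show ?thesis using \<F>_closed by (simp add: lc_def)
qed

text \<open>
The \<open>H k\<close> are integral over \<open>K[x]\<close> although the roots need not be: if \<open>\<theta>\<close> has a pole, the equation \<open>f(\<theta>) = 0\<close> rewrites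
\<open>H k \<theta>\<close> as a polynomial in \<open>1/\<theta>\<close>.
\<close>

lemma H_integral:
  assumes W: "valuation_ring W" "range \<iota> \<subseteq> W" and \<theta>: "\<theta> \<in> R"
  shows "H k \<theta> \<in> W"
proof -
  note c = valuation_ring_closed[OF W(1)]
  have ev_in: "ev v \<eta> \<in> W" if "\<eta> \<in> W" for v \<eta>
    unfolding ev_def poly_altdef using W(2) that by (intro c) (auto simp: coeff_map_poly intro!: c)
  show ?thesis
  proof (cases "\<theta> \<in> W")
    case True then show ?thesis unfolding H_ev by (rule ev_in)
  next
    case False
    then have inv: "inverse \<theta> \<in> W" and \<theta>0: "\<theta> \<noteq> 0" using W(1) c(2) by (auto simp: valuation_ring_def)
    have "fM = poly_cutoff (Suc k) fM + monom 1 (Suc k) * poly_shift (Suc k) fM"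
      by (rule poly_eqI) (auto simp: coeff_poly_cutoff coeff_monom_mult coeff_poly_shift)
    then have "poly fM \<theta> = poly (poly_cutoff (Suc k) fM) \<theta> + \<theta> ^ Suc k * poly (poly_shift (Suc k) fM) \<theta>"
      by (metis mult_1 poly_add poly_monom poly_mult)
    then have "\<theta> ^ Suc k * H k \<theta> = - poly (poly_cutoff (Suc k) fM) \<theta>"
      using \<theta> by (simp add: R_def H_def coeff_synthetic_div add_eq_0_iff)
    also have "poly (poly_cutoff (Suc k) fM) \<theta> = (\<Sum>i\<le>k. coeff fM i * \<theta> ^ i)"
    proof -
      have "degree (poly_cutoff (Suc k) fM) \<le> k"
        by (intro degree_le) (simp add: coeff_poly_cutoff)
      then have "poly (poly_cutoff (Suc k) fM) \<theta> = (\<Sum>i\<le>k. coeff (poly_cutoff (Suc k) fM) i * \<theta> ^ i)"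
        by (rule poly_eq_sum_upto)
      then show ?thesis by (simp add: coeff_poly_cutoff)
    qed
    finally have "H k \<theta> = - (\<Sum>i\<le>k. coeff fM i * \<theta> ^ i) * inverse \<theta> ^ Suc k"
      using \<theta>0 by (simp add: field_simps)
    also have "\<dots> = - (\<Sum>i\<le>k. coeff fM i * inverse \<theta> ^ (Suc k - i))"
      unfolding sum_distrib_right minus_mult_left[symmetric] minus_mult_right
      by (simp add: sum_negf[symmetric] sum_distrib_right power_diff \<theta>0 field_simps)
    also have "\<dots> \<in> W" using W(2) inv by (intro c) (auto simp: fM_def coeff_map_poly)
    finally show ?thesis .
  qed
qed

end

section \<open>Residue duality and the places at infinity\<close>

text \<open>
Apply a polynomial without constant term that vanishes at all values of \<open>\<mu>\<close> except the given one: the sum of its values is a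
positive multiple of a nonzero number, and it is a combination of power sums.
\<close>

lemma sum_powers_nonzero:
  fixes \<mu> :: "'i \<Rightarrow> 'a::field_char_0"
  assumes "finite I" "i \<in> I" "\<mu> i \<noteq> 0"
  shows "\<exists>k>0. (\<Sum>j\<in>I. \<mu> j ^ k) \<noteq> 0"
proof (rule ccontr)
  assume no: "\<not> ?thesis"
  define P where "P = monom 1 1 * (\<Prod>x\<in>\<mu> ` I - {0, \<mu> i}. [:-x, 1:])"
  have P0: "coeff P 0 = 0" by (simp add: P_def coeff_monom_mult)
  have "(\<Sum>j\<in>I. poly P (\<mu> j)) = (\<Sum>k\<le>degree P. coeff P k * (\<Sum>j\<in>I. \<mu> j ^ k))"
    unfolding poly_altdef by (subst sum.swap) (simp add: sum_distrib_left)
  also have "\<dots> = 0"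
    using no P0 by (intro sum.neutral ballI) (metis gr0I mult_eq_0_iff)
  finally have sum0: "(\<Sum>j\<in>I. poly P (\<mu> j)) = 0" .
  have Pi: "poly P (\<mu> i) \<noteq> 0"
    using assms by (auto simp: P_def poly_monom poly_prod)
  have "(\<Sum>j\<in>I. poly P (\<mu> j)) = (\<Sum>j\<in>{j\<in>I. \<mu> j = \<mu> i}. poly P (\<mu> j))"
  proof (rule sum.mono_neutral_right)
    show "\<forall>j\<in>I - {j\<in>I. \<mu> j = \<mu> i}. poly P (\<mu> j) = 0"
    proof
      fix j assume j: "j \<in> I - {j\<in>I. \<mu> j = \<mu> i}"
      show "poly P (\<mu> j) = 0"
      proof (cases "\<mu> j = 0")
        case True then show ?thesis by (simp add: P_def poly_monom)
      next
        case False
        then have "\<mu> j \<in> \<mu> ` I - {0, \<mu> i}" using j by auto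
        then have "(\<Prod>x\<in>\<mu> ` I - {0, \<mu> i}. \<mu> j - x) = 0" using assms(1) by (intro prod_zero) auto
        then show ?thesis by (simp add: P_def poly_prod)
      qed
    qed
  qed (use assms in auto)
  also have "\<dots> = of_nat (card {j\<in>I. \<mu> j = \<mu> i}) * poly P (\<mu> i)" by simp
  finally have "card {j\<in>I. \<mu> j = \<mu> i} = 0" using sum0 Pi by simp
  moreover have "finite {j\<in>I. \<mu> j = \<mu> i}" "i \<in> {j\<in>I. \<mu> j = \<mu> i}" using assms by auto
  ultimately show False by (metis card_0_eq empty_iff)
qed

context plane_curve
begin

text \<open>
The functions regular on the affine part of the curve, and the functions that vanish at all points over infinity.
\<close>

definition affine_ring where "affine_ring = {z \<in> L. \<forall>\<theta>\<in>R. \<forall>W. valuation_ring W \<longrightarrow> range \<iota> \<subseteq> W \<longrightarrow> z \<theta> \<in> W}"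
definition infinity_ideal where "infinity_ideal = {z \<in> L. \<forall>\<theta>\<in>R. z \<theta> \<in> \<mm>}"

lemma affine_ringI: "z \<in> L \<Longrightarrow> (\<And>\<theta> W. \<theta> \<in> R \<Longrightarrow> valuation_ring W \<Longrightarrow> range \<iota> \<subseteq> W \<Longrightarrow> z \<theta> \<in> W) \<Longrightarrow> z \<in> affine_ring"
  by (simp add: affine_ring_def)

lemma infinity_idealI: "z \<in> L \<Longrightarrow> (\<And>\<theta>. \<theta> \<in> R \<Longrightarrow> z \<theta> \<in> \<mm>) \<Longrightarrow> z \<in> infinity_ideal"
  by (simp add: infinity_ideal_def)

lemma \<kappa>_in_range: "\<kappa> c \<in> range \<iota>" by (simp add: \<kappa>_def)

text \<open>
A function without poles is constant. Subtract the value \<open>c\<close> that it takes modulo the maximal ideal at one root: the norm of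
the difference is a polynomial in \<open>x\<close> that vanishes at infinity, hence 0.
\<close>

lemma global_const:
  assumes z: "z \<in> affine_ring" and zV: "\<And>\<theta>. \<theta> \<in> R \<Longrightarrow> z \<theta> \<in> V"
  shows "\<exists>c. \<forall>\<theta>\<in>R. z \<theta> = \<kappa> c"
proof -
  have "card R > 0" using card_R deg by (simp add: d_def)
  then obtain \<theta>\<^sub>1 where \<theta>\<^sub>1: "\<theta>\<^sub>1 \<in> R" by (metis card_gt_0_iff ex_in_conv)
  obtain c where c: "z \<theta>\<^sub>1 - \<kappa> c \<in> \<mm>" using exists_residue[OF zV[OF \<theta>\<^sub>1]] by blast
  define y where "y \<theta> = z \<theta> - \<kappa> c" for \<theta>
  have zL: "z \<in> L" using z by (simp add: affine_ring_def)
  then have yL: "y \<in> L" unfolding y_def by (intro L_diff L_const \<F>_closed)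
  have yV: "y \<theta> \<in> V" if "\<theta> \<in> R" for \<theta> using zV[OF that] const_in_V by (auto simp: y_def intro: V_closed)
  define N where "N = (\<Prod>\<theta>\<in>R. y \<theta>)"
  have "N \<in> range \<iota>"
  proof (rule regular_everywhere_imp_polynomial)
    show "N \<in> \<F>" unfolding N_def by (rule L_norm[OF yL])
    fix W assume W: "valuation_ring W" "range \<iota> \<subseteq> W"
    have "y \<theta> \<in> W" if "\<theta> \<in> R" for \<theta>
      unfolding y_def using that z W \<kappa>_in_range
      by (intro valuation_ring_closed(3)[OF W(1)]) (auto simp: affine_ring_def)
    then show "N \<in> W" unfolding N_def by (intro valuation_ring_closed[OF W(1)])
  qed
  then obtain p where p: "N = \<iota> p" by auto
  have "N \<in> V" unfolding N_def using yV by (intro V_closed) 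
  then have "degree p = 0" unfolding p by (rule poly_in_V_imp_const)
  then obtain e where "p = [:e:]" by (rule degree_eq_zeroE)
  then have Ne: "N = \<kappa> e" by (simp add: p \<kappa>_def)
  have "N \<in> \<mm>" unfolding N_def
    using prod_in_max_ideal_iff[OF val finite_R, of y] yV c \<theta>\<^sub>1 by (auto simp: y_def)
  then have "N = 0" unfolding Ne by simp
  then obtain \<theta>\<^sub>0 where "\<theta>\<^sub>0 \<in> R" "y \<theta>\<^sub>0 = 0" by (auto simp: N_def)
  then have "y \<theta> = 0" if "\<theta> \<in> R" for \<theta> using L_inverse(2)[OF yL that] by blast
  then show ?thesis by (auto simp: y_def)
qed

lemma eventually_in_m_R: "\<exists>N. \<forall>n\<ge>N. \<forall>\<theta>\<in>R. z \<theta> * inverse \<xi> ^ n \<in> \<mm>"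
proof -
  obtain N where N: "\<And>\<theta> n. n \<ge> N \<theta> \<Longrightarrow> z \<theta> * inverse \<xi> ^ n \<in> \<mm>"
    using choice[of "\<lambda>\<theta> N. \<forall>n\<ge>N. z \<theta> * inverse \<xi> ^ n \<in> \<mm>"] eventually_in_m by blast
  have "N \<theta> \<le> (\<Sum>\<theta>\<in>R. N \<theta>)" if "\<theta> \<in> R" for \<theta> using that by (intro member_le_sum) auto
  then show ?thesis using N by (intro exI[of _ "\<Sum>\<theta>\<in>R. N \<theta>"]) (meson order_trans)
qed

text \<open>
The expansion of \<open>r\<close> at infinity is a polynomial plus \<open>c/x\<close> plus \<open>O(1/x^2)\<close>; so \<open>c\<close> is minus the residue of \<open>r dx\<close> there.
\<close>

definition has_residue where "has_residue r c \<longleftrightarrow> (\<exists>p. (r - \<iota> p - \<kappa> c / \<xi>) * \<xi>\<^sup>2 \<in> V)"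

lemma has_residue_add: assumes "has_residue r c" "has_residue s e" shows "has_residue (r + s) (c + e)"
proof -
  obtain p q where "(r - \<iota> p - \<kappa> c / \<xi>) * \<xi>\<^sup>2 \<in> V" "(s - \<iota> q - \<kappa> e / \<xi>) * \<xi>\<^sup>2 \<in> V"
    using assms unfolding has_residue_def by blast
  then have "(r - \<iota> p - \<kappa> c / \<xi>) * \<xi>\<^sup>2 + (s - \<iota> q - \<kappa> e / \<xi>) * \<xi>\<^sup>2 \<in> V" by (rule V_closed(4))
  then show ?thesis unfolding has_residue_def
    by (intro exI[of _ "p + q"]) (simp add: \<iota>.hom_add algebra_simps add_divide_distrib)
qed

lemma has_residue_scale: assumes "has_residue r c" shows "has_residue (\<kappa> a * r) (a * c)"
proof -
  obtain p where "(r - \<iota> p - \<kappa> c / \<xi>) * \<xi>\<^sup>2 \<in> V" using assms unfolding has_residue_def by blast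
  then have "\<kappa> a * ((r - \<iota> p - \<kappa> c / \<xi>) * \<xi>\<^sup>2) \<in> V" by (rule V_closed(5)[OF const_in_V])
  moreover have "\<kappa> a * ((r - \<iota> p - \<kappa> c / \<xi>) * \<xi>\<^sup>2) = (\<kappa> a * r - \<iota> ([:a:] * p) - \<kappa> (a * c) / \<xi>) * \<xi>\<^sup>2"
    by (simp only: \<iota>.hom_mult \<kappa>_def[symmetric] \<kappa>_simps) (simp add: algebra_simps)
  ultimately show ?thesis unfolding has_residue_def by metis
qed

lemma has_residue_poly: "has_residue (\<iota> p) 0" unfolding has_residue_def by (intro exI[of _ p]) (simp add: V_closed)

lemma has_residue_small: "r * \<xi>\<^sup>2 \<in> V \<Longrightarrow> has_residue r 0" unfolding has_residue_def by (intro exI[of _ 0]) simp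

lemma has_residue_sum: "finite I \<Longrightarrow> (\<And>i. i \<in> I \<Longrightarrow> has_residue (r i) (c i)) \<Longrightarrow> has_residue (sum r I) (sum c I)"
  by (induction I rule: finite_induct) (use has_residue_poly[of 0] in \<open>auto intro: has_residue_add\<close>)

text \<open>
Multiplied by \<open>x^2\<close>, the difference of two expansions is a polynomial divisible by \<open>x\<close>, and it is finite at infinity.
\<close>

lemma has_residue_unique: assumes "has_residue r c" "has_residue r e" shows "c = e"
proof -
  obtain p q where "(r - \<iota> p - \<kappa> c / \<xi>) * \<xi>\<^sup>2 \<in> V" "(r - \<iota> q - \<kappa> e / \<xi>) * \<xi>\<^sup>2 \<in> V"
    using assms unfolding has_residue_def by blast
  then have "(r - \<iota> q - \<kappa> e / \<xi>) * \<xi>\<^sup>2 - (r - \<iota> p - \<kappa> c / \<xi>) * \<xi>\<^sup>2 \<in> V" by (intro V_closed(3))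
  moreover define s where "s = pCons 0 (pCons (c - e) (p - q))"
  moreover have "(r - \<iota> q - \<kappa> e / \<xi>) * \<xi>\<^sup>2 - (r - \<iota> p - \<kappa> c / \<xi>) * \<xi>\<^sup>2 = \<iota> s"
    by (simp add: s_def \<iota>_pCons \<iota>.hom_minus field_simps power2_eq_square)
  ultimately have "degree s = 0" using poly_in_V_imp_const by metis
  then have "pCons (c - e) (p - q) = 0" by (auto simp: s_def split: if_splits)
  then show ?thesis by simp
qed

lemma has_residue_monom: "has_residue (\<iota> G * inverse \<xi> ^ Suc n) (coeff G n)"
proof (induction n arbitrary: G)
  case 0
  obtain a G' where G: "G = pCons a G'" by (rule pCons_cases)
  have "\<iota> G * inverse \<xi> = \<iota> G' + \<kappa> a / \<xi>" by (simp add: G \<iota>_pCons field_simps)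
  then show ?case unfolding has_residue_def by (intro exI[of _ G']) (simp add: G V_closed)
next
  case (Suc n)
  obtain a G' where G: "G = pCons a G'" by (rule pCons_cases)
  have "\<iota> G * inverse \<xi> ^ Suc (Suc n) = \<iota> G' * inverse \<xi> ^ Suc n + \<kappa> a * inverse \<xi> ^ Suc (Suc n)"
    by (simp add: G \<iota>_pCons field_simps)
  moreover have "has_residue (\<kappa> a * inverse \<xi> ^ Suc (Suc n)) 0"
  proof (rule has_residue_small)
    have "\<kappa> a * inverse \<xi> ^ Suc (Suc n) * \<xi>\<^sup>2 = \<kappa> a * inverse \<xi> ^ n" by (simp add: field_simps power2_eq_square)
    also have "\<dots> \<in> V" by (intro V_closed const_in_V inverse_x_in_V)
    finally show "\<kappa> a * inverse \<xi> ^ Suc (Suc n) * \<xi>\<^sup>2 \<in> V" .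
  qed
  ultimately have "has_residue (\<iota> G * inverse \<xi> ^ Suc (Suc n)) (coeff G' n + 0)" using has_residue_add[OF Suc.IH[of G']] by metis
  then show ?case by (simp only: G coeff_pCons_Suc add_0_right)
qed

text \<open>
A subspace and a vector outside it are separated by a linear functional.
\<close>

lemma exists_functional:
  fixes S :: "('m \<Rightarrow> 'm) set"
  assumes S0: "(\<lambda>_. 0) \<in> S" and Sadd: "\<And>y z. y \<in> S \<Longrightarrow> z \<in> S \<Longrightarrow> (\<lambda>\<theta>. y \<theta> + z \<theta>) \<in> S"
    and Sscale: "\<And>c z. z \<in> S \<Longrightarrow> (\<lambda>\<theta>. \<kappa> c * z \<theta>) \<in> S" and w: "w \<notin> S"
  obtains \<phi> :: "('m \<Rightarrow> 'm) \<Rightarrow> 'a" where "\<And>y z. \<phi> (\<lambda>\<theta>. y \<theta> + z \<theta>) = \<phi> y + \<phi> z"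
    "\<And>c z. \<phi> (\<lambda>\<theta>. \<kappa> c * z \<theta>) = c * \<phi> z" "\<And>z. z \<in> S \<Longrightarrow> \<phi> z = 0" "\<phi> w = 1"
proof -
  define sc where "sc = (\<lambda>c (z :: 'm \<Rightarrow> 'm) \<theta>. \<kappa> c * z \<theta>)"
  interpret vs: vector_space sc
    by unfold_locales (auto simp: sc_def fun_eq_iff algebra_simps)
  interpret vf: vector_space "(*) :: 'a \<Rightarrow> 'a \<Rightarrow> 'a"
    by unfold_locales (auto simp: algebra_simps)
  interpret vp: vector_space_pair sc "(*) :: 'a \<Rightarrow> 'a \<Rightarrow> 'a" ..
  have sub: "vs.subspace S"
    unfolding vs.subspace_def using S0 Sadd Sscale by (auto simp: sc_def zero_fun_def plus_fun_def)
  obtain B where B: "B \<subseteq> S" "vs.independent B" "S \<subseteq> vs.span B"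
    using vs.maximal_independent_subset[of S] by blast
  have "vs.span B \<subseteq> S" using vs.span_minimal[OF B(1) sub] .
  then have wB: "w \<notin> vs.span B" using w by blast
  then have ind: "vs.independent (insert w B)" using B(2) by (simp add: vs.independent_insert)
  obtain g where g: "Vector_Spaces.linear sc (*) g" "\<forall>x\<in>insert w B. g x = (if x = w then 1 else 0)"
    using vp.linear_independent_extend[OF ind, of "\<lambda>x. if x = w then 1 else 0"] by blast
  have wnB: "w \<notin> B" using wB vs.span_superset by blast
  have "g z = 0" if "z \<in> S" for z
  proof (rule vp.linear_eq_0_on_span[OF g(1), of B])
    show "z \<in> vs.span B" using that B(3) by blast
    show "g x = 0" if "x \<in> B" for x using g(2) that wnB by auto
  qed
  moreover have "g (\<lambda>\<theta>. y \<theta> + z \<theta>) = g y + g z" for y z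
    using vp.linear_add[OF g(1), of y z] by (simp add: plus_fun_def)
  moreover have "g (\<lambda>\<theta>. \<kappa> c * z \<theta>) = c * g z" for c z
    using vp.linear_scale[OF g(1), of c z] by (simp add: sc_def)
  moreover have "g w = 1" using g(2) by simp
  ultimately show ?thesis using that by metis
qed

end

text \<open>
A linear functional that annihilates the regular functions and those vanishing at infinity. Serre duality predicts that it is
the residue pairing with a differential \<open>g dx / f_y\<close> that is regular on the affine part and has at most simple poles at infinity;
the lemmas below construct \<open>g\<close>.
\<close>

locale residue_functional = plane_curve \<iota> V f
  for \<iota> :: "'a::{alg_closed_field,field_char_0} poly \<Rightarrow> 'm::{alg_closed_field,field_char_0}" and V f +
  fixes \<phi> :: "('m \<Rightarrow> 'm) \<Rightarrow> 'a"
  assumes \<phi>_add: "\<And>y z. \<phi> (\<lambda>\<theta>. y \<theta> + z \<theta>) = \<phi> y + \<phi> z"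
    and \<phi>_scale: "\<And>c z. \<phi> (\<lambda>\<theta>. \<kappa> c * z \<theta>) = c * \<phi> z"
    and \<phi>_affine_ring: "\<And>z. z \<in> affine_ring \<Longrightarrow> \<phi> z = 0"
    and \<phi>_infinity_ideal: "\<And>z. z \<in> infinity_ideal \<Longrightarrow> \<phi> z = 0"
begin

lemma \<phi>_cong: assumes "y \<in> L" "z \<in> L" "\<And>\<theta>. \<theta> \<in> R \<Longrightarrow> y \<theta> = z \<theta>" shows "\<phi> y = \<phi> z"
proof -
  have "(\<lambda>\<theta>. z \<theta> - y \<theta>) \<in> infinity_ideal" using assms by (intro infinity_idealI L_diff) (auto simp: m_props)
  then show ?thesis using \<phi>_add[of y "\<lambda>\<theta>. z \<theta> - y \<theta>"] \<phi>_infinity_ideal by simp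
qed

lemma \<phi>_zero: "\<phi> (\<lambda>_. 0) = 0" using \<phi>_scale[of 0 "\<lambda>_. 0"] by simp

lemma \<phi>_sum: "finite I \<Longrightarrow> \<phi> (\<lambda>\<theta>. \<Sum>i\<in>I. z i \<theta>) = (\<Sum>i\<in>I. \<phi> (z i))"
  by (induction I rule: finite_induct) (auto simp: \<phi>_zero \<phi>_add)

text \<open>
A rational function of \<open>x\<close> alone is a polynomial plus a proper fraction.
\<close>

lemma \<phi>_const: assumes "r \<in> \<F>" shows "\<phi> (\<lambda>_. r) = 0"
proof -
  obtain p q where pq: "r = \<iota> p / \<iota> q" "q \<noteq> 0" using assms unfolding \<F>_def by auto
  have "p = p div q * q + p mod q" by simp
  then have "\<iota> p = \<iota> (p div q) * \<iota> q + \<iota> (p mod q)" by (metis \<iota>.hom_add \<iota>.hom_mult)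
  then have r: "r = \<iota> (p div q) + \<iota> (p mod q) / \<iota> q" using pq by (simp add: add_divide_distrib)
  have "(\<lambda>_. \<iota> (p div q)) \<in> affine_ring" by (intro affine_ringI L_const \<F>_closed) auto
  moreover have "\<iota> (p mod q) / \<iota> q \<in> \<mm>"
  proof (cases "p mod q = 0")
    case False
    then show ?thesis using fraction_in_m_iff[OF False pq(2)] degree_mod_less[OF pq(2), of p] by simp
  qed (simp add: m_props)
  then have "(\<lambda>_. \<iota> (p mod q) / \<iota> q) \<in> infinity_ideal" by (intro infinity_idealI L_const \<F>_closed) auto
  ultimately show ?thesis using \<phi>_add[of "\<lambda>_. \<iota> (p div q)" "\<lambda>_. \<iota> (p mod q) / \<iota> q"] \<phi>_affine_ring \<phi>_infinity_ideal r by simp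
qed

lemma G_exists: "\<exists>G. \<forall>n. coeff G n = \<phi> (\<lambda>\<theta>. inverse \<xi> ^ Suc n * H k \<theta>)"
proof -
  obtain N where N: "\<forall>n\<ge>N. \<forall>\<theta>\<in>R. H k \<theta> * inverse \<xi> ^ n \<in> \<mm>" using eventually_in_m_R by blast
  have "\<phi> (\<lambda>\<theta>. inverse \<xi> ^ Suc n * H k \<theta>) = 0" if "n \<ge> N" for n
    using N that by (intro \<phi>_infinity_ideal infinity_idealI L_smult H_L \<F>_closed) (simp add: mult.commute[of "_ ^ _"] del: power_Suc)
  then show ?thesis
    by (intro exI[of _ "Poly (map (\<lambda>n. \<phi> (\<lambda>\<theta>. inverse \<xi> ^ Suc n * H k \<theta>)) [0..<N])"])
       (auto simp: nth_default_def)
qed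

text \<open>
The candidate for the coefficients of \<open>g\<close>: by the residue pairing, \<open>\<phi> (H k / x ^ (n + 1))\<close> must be the coefficient of \<open>x ^ n\<close> in
the trace of \<open>H k\<close> times the differential.
\<close>

definition G where "G k = (SOME G. \<forall>n. coeff G n = \<phi> (\<lambda>\<theta>. inverse \<xi> ^ Suc n * H k \<theta>))"

lemma coeff_G: "coeff (G k) n = \<phi> (\<lambda>\<theta>. inverse \<xi> ^ Suc n * H k \<theta>)"
  using someI_ex[OF G_exists[of k]] unfolding G_def by blast

text \<open>
The vanishing on \<open>K(x)\<close> kills the top coefficient; this saves the one degree that the norm estimate needs.
\<close>

lemma G_top: "G (d - 1) = 0"
  by (rule poly_eqI) (simp only: coeff_G H_top coeff_0, intro \<phi>_const \<F>_closed, simp add: lc_def \<F>_closed)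

lemma has_residue_H_monom: "has_residue (\<xi> powi j * \<iota> (G k)) (\<phi> (\<lambda>\<theta>. \<xi> powi j * H k \<theta>))"
proof (cases "j \<ge> 0")
  case True
  then have xj: "\<xi> powi j = \<iota> (monom 1 (nat j))" by (simp add: \<iota>_monom power_int_def)
  have "(\<lambda>\<theta>. \<xi> powi j * H k \<theta>) \<in> affine_ring"
  proof (intro affine_ringI L_smult H_L)
    show "\<xi> powi j \<in> \<F>" by (simp add: xj \<F>_closed)
    fix \<theta> W assume "\<theta> \<in> R" "valuation_ring W" "range \<iota> \<subseteq> W"
    then show "\<xi> powi j * H k \<theta> \<in> W" unfolding xj
      using valuation_ring_closed(5) H_integral by blast
  qed
  then show ?thesis using has_residue_poly[of "monom 1 (nat j) * G k"] \<phi>_affine_ring by (simp add: xj \<iota>.hom_mult)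
next
  case False
  then obtain n where n: "j = - int (Suc n)" by (metis int_cases2 nat_int negative_zle not_le nonneg_int_cases not0_implies_Suc of_nat_0 minus_zero int_cases)
  have "\<xi> powi j = inverse \<xi> ^ Suc n" unfolding n power_int_minus power_int_of_nat by (simp add: power_inverse)
  then show ?thesis using has_residue_monom[of "G k" n] by (simp only: coeff_G mult.commute)
qed

text \<open>
The pairing formula for \<open>r * H k\<close> with \<open>r\<close> in \<open>K(x)\<close>. Both sides vanish if \<open>r\<close> is small at infinity, and both sides are
right for powers of \<open>x\<close>; splitting off leading terms \<open>c * x ^ j\<close> reduces a general \<open>r\<close> to a small one.
\<close>

lemma has_residue_H: assumes "r \<in> \<F>" shows "has_residue (r * \<iota> (G k)) (\<phi> (\<lambda>\<theta>. r * H k \<theta>))"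
proof -
  obtain N1 where N1: "\<forall>n\<ge>N1. \<forall>\<theta>\<in>R. H k \<theta> * inverse \<xi> ^ n \<in> \<mm>" using eventually_in_m_R by blast
  obtain N2 where N2: "\<forall>n\<ge>N2. \<iota> (G k) * \<xi>\<^sup>2 * inverse \<xi> ^ n \<in> \<mm>" using eventually_in_m by blast
  define N where "N = max N1 N2"
  have *: "r \<in> \<F> \<Longrightarrow> r * \<xi> powi (int N - int e) \<in> V \<Longrightarrow> has_residue (r * \<iota> (G k)) (\<phi> (\<lambda>\<theta>. r * H k \<theta>))" for e r
  proof (induction e arbitrary: r)
    case 0
    then have rV: "r * \<xi> ^ N \<in> V" by simp
    have "r * H k \<theta> \<in> \<mm>" if "\<theta> \<in> R" for \<theta>
    proof -
      have "(H k \<theta> * inverse \<xi> ^ N) * (r * \<xi> ^ N) \<in> \<mm>" by (rule m_props(4)[OF _ rV]) (use N1 that in \<open>auto simp: N_def\<close>)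
      moreover have "(H k \<theta> * inverse \<xi> ^ N) * (r * \<xi> ^ N) = r * H k \<theta>" by (simp add: field_simps)
      ultimately show ?thesis by simp
    qed
    then have "\<phi> (\<lambda>\<theta>. r * H k \<theta>) = 0" using 0 by (intro \<phi>_infinity_ideal infinity_idealI L_smult H_L)
    moreover have "(\<iota> (G k) * \<xi>\<^sup>2 * inverse \<xi> ^ N) * (r * \<xi> ^ N) \<in> V"
    proof (rule V_closed(5)[OF _ rV])
      show "\<iota> (G k) * \<xi>\<^sup>2 * inverse \<xi> ^ N \<in> V" using N2 m_props(1) by (auto simp: N_def)
    qed
    then have "has_residue (r * \<iota> (G k)) 0" by (intro has_residue_small) (simp add: field_simps)
    ultimately show ?case by simp
  next
    case (Suc e)
    define j where "j = int (Suc e) - int N"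
    define s where "s = r * \<xi> powi (- j)"
    have sV: "s \<in> V" and sF: "s \<in> \<F>" using Suc.prems by (auto simp: s_def j_def intro!: \<F>_closed)
    obtain c where c: "s - \<kappa> c \<in> \<mm>" using exists_residue[OF sV] by blast
    have rs: "r = s * \<xi> powi j" by (simp add: s_def power_int_minus)
    define r' where "r' = r - \<kappa> c * \<xi> powi j"
    have "(s - \<kappa> c) * \<xi> \<in> V" using c sF by (intro fraction_in_m_imp \<F>_closed)
    moreover have "r' * \<xi> powi (int N - int e) = (s - \<kappa> c) * \<xi>"
    proof -
      have e1: "int N - int e = 1 - j" by (simp add: j_def)
      have "\<xi> powi j * \<xi> powi (int N - int e) = \<xi>"
        unfolding e1 by (simp flip: power_int_add)
      then show ?thesis by (simp add: r'_def rs algebra_simps flip: mult.assoc)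
         (simp add: mult.assoc)
    qed
    moreover have "r' \<in> \<F>" unfolding r'_def using Suc.prems by (intro \<F>_closed)
    ultimately have "has_residue (r' * \<iota> (G k)) (\<phi> (\<lambda>\<theta>. r' * H k \<theta>))" using Suc.IH by metis
    then have "has_residue (\<kappa> c * (\<xi> powi j * \<iota> (G k)) + r' * \<iota> (G k))
        (c * \<phi> (\<lambda>\<theta>. \<xi> powi j * H k \<theta>) + \<phi> (\<lambda>\<theta>. r' * H k \<theta>))"
      by (intro has_residue_add has_residue_scale has_residue_H_monom)
    moreover have "\<kappa> c * (\<xi> powi j * \<iota> (G k)) + r' * \<iota> (G k) = r * \<iota> (G k)"
      by (simp add: r'_def algebra_simps)
    moreover have "c * \<phi> (\<lambda>\<theta>. \<xi> powi j * H k \<theta>) + \<phi> (\<lambda>\<theta>. r' * H k \<theta>) = \<phi> (\<lambda>\<theta>. r * H k \<theta>)"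
      unfolding \<phi>_scale[symmetric] \<phi>_add[symmetric] by (simp add: r'_def algebra_simps)
    ultimately show ?case by simp
  qed
  obtain M where M: "\<forall>n\<ge>M. r * inverse \<xi> ^ n \<in> \<mm>" using eventually_in_m by blast
  have "r * \<xi> powi (int N - int (N + M)) \<in> V"
    using M m_props(1) by (auto simp: power_int_minus power_inverse)
  then show ?thesis using * assms by blast
qed

text \<open>
The numerator of the differential, and the differential divided by \<open>dx\<close>.
\<close>

definition g where "g = (\<Sum>k<d. monom (G k) k)"
definition u where "u \<theta> = ev g \<theta> / poly (pderiv fM) \<theta>"

lemma coeff_g: "coeff g k = (if k < d then G k else 0)"
  by (simp add: g_def coeff_sum)

lemma degree_g: "degree g \<le> d - 2"
proof (rule degree_le, intro allI impI)
  fix i assume "d - 2 < i"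
  then have "i = d - 1 \<or> i \<ge> d" using deg by (auto simp: d_def)
  then show "coeff g i = 0" using G_top by (auto simp: coeff_g)
qed

lemma u_L: "u \<in> L"
  unfolding u_def divide_inverse by (intro L_mult L_ev pderiv_L)

lemma trace_u_H: "k < d \<Longrightarrow> (\<Sum>\<theta>\<in>R. u \<theta> * H k \<theta>) = \<iota> (G k)"
proof -
  assume k: "k < d"
  have "degree (map_poly \<iota> g) < d" using degree_g deg by (simp add: d_def)
  from trace_dual[OF this, of k] show ?thesis using k by (simp add: u_def ev_def coeff_map_poly coeff_g)
qed

text \<open>
Expand \<open>z\<close> in the \<open>H k\<close> and use the formula for each term.
\<close>

lemma residue_duality: assumes z: "z \<in> L" shows "has_residue (\<Sum>\<theta>\<in>R. u \<theta> * z \<theta>) (\<phi> z)"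
proof -
  define \<rho> where "\<rho> k = (\<Sum>\<theta>\<in>R. z \<theta> * \<theta> ^ k / poly (pderiv fM) \<theta>)" for k
  have "(\<lambda>\<theta>. z \<theta> * \<theta> ^ k / poly (pderiv fM) \<theta>) \<in> L" for k
  proof -
    have "(\<lambda>\<theta>. \<theta> ^ k) \<in> L"
      by (rule L_cong[OF L_ev[of "monom 1 k"]]) (simp add: ev_def map_poly_monom poly_monom)
    then show ?thesis unfolding divide_inverse by (intro L_mult z pderiv_L)
  qed
  then have \<rho>F: "\<rho> k \<in> \<F>" for k unfolding \<rho>_def by (rule trace_in_\<F>)
  have zexp: "z \<theta> = (\<Sum>k<d. \<rho> k * H k \<theta>)" if "\<theta> \<in> R" for \<theta> using L_expand[OF that] by (simp add: \<rho>_def)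
  have "\<phi> z = \<phi> (\<lambda>\<theta>. \<Sum>k<d. \<rho> k * H k \<theta>)"
    by (rule \<phi>_cong[OF z]) (auto intro!: L_sum L_smult H_L \<rho>F zexp)
  also have "\<dots> = (\<Sum>k<d. \<phi> (\<lambda>\<theta>. \<rho> k * H k \<theta>))" by (rule \<phi>_sum) simp
  finally have \<phi>z: "\<phi> z = (\<Sum>k<d. \<phi> (\<lambda>\<theta>. \<rho> k * H k \<theta>))" .
  have "(\<Sum>\<theta>\<in>R. u \<theta> * z \<theta>) = (\<Sum>\<theta>\<in>R. \<Sum>k<d. \<rho> k * (u \<theta> * H k \<theta>))"
    by (intro sum.cong refl) (simp add: zexp sum_distrib_left mult_ac)
  also have "\<dots> = (\<Sum>k<d. \<rho> k * \<iota> (G k))"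
    by (subst sum.swap) (simp add: trace_u_H flip: sum_distrib_left)
  finally show ?thesis unfolding \<phi>z by (auto intro!: has_residue_sum has_residue_H \<rho>F)
qed

lemma u_nonzero:
  assumes "w \<in> L" "\<phi> w \<noteq> 0" "\<theta> \<in> R" shows "u \<theta> \<noteq> 0"
proof -
  have "\<exists>\<theta>\<in>R. u \<theta> \<noteq> 0"
  proof (rule ccontr)
    assume "\<not> ?thesis"
    then have "(\<Sum>\<theta>\<in>R. u \<theta> * w \<theta>) = 0" by simp
    then have "has_residue 0 (\<phi> w)" using residue_duality[OF assms(1)] by simp
    moreover have "has_residue 0 0" using has_residue_poly[of 0] by simp
    ultimately show False using has_residue_unique assms(2) by blast
  qed
  then show ?thesis using L_inverse(2)[OF u_L] assms(3) by blast
qed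

lemma residue_power:
  assumes "z \<in> V" "z - \<kappa> c \<in> \<mm>" shows "z ^ k - \<kappa> (c ^ k) \<in> \<mm>"
proof (induction k)
  case (Suc k)
  have "z ^ Suc k - \<kappa> (c ^ Suc k) = (z - \<kappa> c) * z ^ k + \<kappa> c * (z ^ k - \<kappa> (c ^ k))"
    by (simp add: algebra_simps)
  also have "\<dots> \<in> \<mm>" using Suc assms const_in_V by (intro m_props(6) m_props(4) m_props(5)) (auto intro: V_closed)
  finally show ?case .
qed (simp add: m_props)

text \<open>
The differential has at most simple poles at infinity. Otherwise let \<open>\<theta>\<^sub>1\<close> be a root where its pole is largest. A suitable
monomial in \<open>u\<close> and \<open>x\<close> is a unit at \<open>\<theta>\<^sub>1\<close> and finite at the other roots; divided by \<open>x * u\<close> it vanishes at infinity, so \<open>\<phi>\<close>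
kills it, whereas its pairing with \<open>u\<close> is the sum of \<open>k\<close>-th powers of residues. For some \<open>k\<close> that sum is not 0.
\<close>

lemma u_bound:
  assumes nz: "\<And>\<theta>. \<theta> \<in> R \<Longrightarrow> u \<theta> \<noteq> 0" and "\<theta> \<in> R"
  shows "\<xi> * u \<theta> \<in> V"
proof (rule ccontr)
  assume neg: "\<xi> * u \<theta> \<notin> V"
  obtain \<theta>\<^sub>1 where \<theta>\<^sub>1: "\<theta>\<^sub>1 \<in> R" "\<forall>\<eta>\<in>R. u \<eta> / u \<theta>\<^sub>1 \<in> V"
    using exists_dominant[of R u] nz assms(2) by auto
  have u1: "u \<theta>\<^sub>1 \<noteq> 0" using nz \<theta>\<^sub>1 by blast
  have xu1: "\<xi> * u \<theta>\<^sub>1 \<notin> V"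
  proof
    assume "\<xi> * u \<theta>\<^sub>1 \<in> V"
    then have "u \<theta> / u \<theta>\<^sub>1 * (\<xi> * u \<theta>\<^sub>1) \<in> V" using \<theta>\<^sub>1 assms(2) by (intro V_closed(5)[OF _ \<open>\<xi> * u \<theta>\<^sub>1 \<in> V\<close>]) auto
    then show False using neg u1 by (simp add: mult.commute)
  qed
  obtain n e where ne: "n > 0" "u \<theta>\<^sub>1 ^ n * \<xi> powi e \<in> V - \<mm>" using exists_power_unit[OF u1] .
  define \<zeta> where "\<zeta> \<eta> = u \<eta> ^ n * \<xi> powi e" for \<eta>
  have \<zeta>1: "\<zeta> \<theta>\<^sub>1 \<in> V - \<mm>" using ne by (simp add: \<zeta>_def)
  have \<zeta>q: "\<zeta> \<eta> = (u \<eta> / u \<theta>\<^sub>1) ^ n * \<zeta> \<theta>\<^sub>1" for \<eta> using u1 by (simp add: \<zeta>_def power_divide)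
  have \<zeta>V: "\<zeta> \<eta> \<in> V" if "\<eta> \<in> R" for \<eta>
    unfolding \<zeta>q[of \<eta>] using \<theta>\<^sub>1 that \<zeta>1 by (intro V_closed(5) V_closed(7)) auto
  obtain \<mu> where \<mu>: "\<And>\<eta>. \<eta> \<in> R \<Longrightarrow> \<zeta> \<eta> - \<kappa> (\<mu> \<eta>) \<in> \<mm>" using exists_residue[OF \<zeta>V] by metis
  have "\<mu> \<theta>\<^sub>1 \<noteq> 0" using \<mu>[OF \<theta>\<^sub>1(1)] \<zeta>1 by auto
  then obtain k where k: "k > 0" "(\<Sum>\<eta>\<in>R. \<mu> \<eta> ^ k) \<noteq> 0"
    using sum_powers_nonzero[OF finite_R \<theta>\<^sub>1(1)] by blast
  define s where "s = (\<Sum>\<eta>\<in>R. \<mu> \<eta> ^ k)"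
  define T where "T = (\<Sum>\<eta>\<in>R. \<zeta> \<eta> ^ k)"
  have \<zeta>L: "(\<lambda>\<eta>. \<zeta> \<eta> ^ k) \<in> L" unfolding \<zeta>_def
    by (intro L_power L_mult u_L L_const \<F>_closed)
  have "T - \<kappa> s = (\<Sum>\<eta>\<in>R. \<zeta> \<eta> ^ k - \<kappa> (\<mu> \<eta> ^ k))" by (simp add: T_def s_def \<kappa>_sum sum_subtractf)
  then have "T - \<kappa> s \<in> \<mm>" using \<mu> \<zeta>V by (auto intro!: max_ideal_sum[OF val] residue_power)
  moreover have "T - \<kappa> s \<in> \<F>" unfolding T_def by (intro \<F>_closed trace_in_\<F> \<zeta>L)
  ultimately have "(T - \<kappa> s) * \<xi> \<in> V" by (intro fraction_in_m_imp)
  moreover have "(inverse \<xi> * T - \<iota> 0 - \<kappa> s / \<xi>) * \<xi>\<^sup>2 = (T - \<kappa> s) * \<xi>"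
    by (simp add: left_diff_distrib power2_eq_square)
  ultimately have DT: "has_residue (inverse \<xi> * T) s" unfolding has_residue_def by metis
  \<comment> \<open>chosen such that \<open>u * z = \<zeta> ^ k / x\<close>\<close>
  define z where "z \<eta> = (inverse \<xi> * (\<xi> powi e) ^ k) * u \<eta> ^ (n * k - 1)" for \<eta>
  have nk: "n * k = Suc (n * k - 1)" using ne k by simp
  have zL: "z \<in> L" unfolding z_def by (intro L_smult L_power u_L \<F>_closed)
  have uz: "u \<eta> * z \<eta> = inverse \<xi> * \<zeta> \<eta> ^ k" for \<eta>
  proof -
    have "u \<eta> * u \<eta> ^ (n * k - 1) = (u \<eta> ^ n) ^ k" using nk by (metis power_Suc power_mult)
    then show ?thesis by (simp add: z_def \<zeta>_def power_mult_distrib mult_ac)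
  qed
  have "z \<eta> \<in> \<mm>" if "\<eta> \<in> R" for \<eta>
  proof -
    have "inverse (\<xi> * u \<theta>\<^sub>1) \<in> \<mm>" using xu1 by (rule m_props(10))
    moreover have "\<zeta> \<theta>\<^sub>1 ^ k * (u \<eta> / u \<theta>\<^sub>1) ^ (n * k - 1) \<in> V"
      using \<zeta>1 \<theta>\<^sub>1 that by (intro V_closed(5) V_closed(7)) auto
    ultimately have "inverse (\<xi> * u \<theta>\<^sub>1) * (\<zeta> \<theta>\<^sub>1 ^ k * (u \<eta> / u \<theta>\<^sub>1) ^ (n * k - 1)) \<in> \<mm>" by (rule m_props(4))
    moreover have "inverse (\<xi> * u \<theta>\<^sub>1) * (\<zeta> \<theta>\<^sub>1 ^ k * (u \<eta> / u \<theta>\<^sub>1) ^ (n * k - 1)) = z \<eta>"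
    proof -
      have "\<zeta> \<theta>\<^sub>1 ^ k = u \<theta>\<^sub>1 * u \<theta>\<^sub>1 ^ (n * k - 1) * (\<xi> powi e) ^ k"
        unfolding \<zeta>_def power_mult_distrib using nk by (metis power_Suc power_mult)
      then show ?thesis using u1 by (simp add: z_def power_divide)
    qed
    ultimately show ?thesis by simp
  qed
  then have "\<phi> z = 0" by (intro \<phi>_infinity_ideal infinity_idealI zL)
  moreover have "(\<Sum>\<eta>\<in>R. u \<eta> * z \<eta>) = inverse \<xi> * T" by (simp add: uz T_def sum_distrib_left)
  ultimately have "has_residue (inverse \<xi> * T) 0" using residue_duality[OF zL] by simp
  then show False using has_residue_unique DT k by (auto simp: s_def)
qed

text \<open>
Otherwise \<open>x ^ d\<close> times the norm of \<open>u\<close> is finite at infinity. By the product formula for resultants, and since \<open>g\<close> has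
degree at most \<open>d - 2\<close>, this bounds the degree of the resultant of \<open>f\<close> and its derivative from below.
\<close>

lemma \<phi>_vanishes:
  assumes small: "degree (resultant f (pderiv f)) < degree (lead_coeff f) + d" and "w \<in> L"
  shows "\<phi> w = 0"
proof (rule ccontr)
  assume "\<phi> w \<noteq> 0"
  then have nz: "u \<theta> \<noteq> 0" if "\<theta> \<in> R" for \<theta> using u_nonzero assms(2) that by blast
  have evg: "ev g \<theta> \<noteq> 0" if "\<theta> \<in> R" for \<theta> using nz[OF that] by (auto simp: u_def)
  have "card R > 0" using card_R deg by (simp add: d_def)
  then obtain \<theta>\<^sub>1 where "\<theta>\<^sub>1 \<in> R" by (metis card_gt_0_iff ex_in_conv)
  then have g0: "g \<noteq> 0" using evg by force
  define e where "e = d - 1 - degree g"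
  have e: "e \<ge> 1" "degree g + e = d - 1" using degree_g deg by (auto simp: e_def d_def)
  have "pderiv f \<noteq> 0" using deg by (simp add: pderiv_eq_0_iff)
  have res1: "\<iota> (resultant f g) = lc ^ degree g * (\<Prod>\<theta>\<in>R. ev g \<theta>)" by (rule resultant_f[OF g0])
  have res2: "\<iota> (resultant f (pderiv f)) = lc ^ (d - 1) * (\<Prod>\<theta>\<in>R. poly (pderiv fM) \<theta>)"
    using resultant_f[OF \<open>pderiv f \<noteq> 0\<close>] by (simp add: degree_pderiv d_def ev_def pderiv_fM)
  have Rg0: "resultant f g \<noteq> 0" using res1 evg by (metis \<iota>.hom_0_iff finite_R lc_nz no_zero_divisors power_not_zero prod_zero_iff)
  define q where "q = monom 1 d * resultant f g * lead_coeff f ^ e"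
  have lf0: "lead_coeff f \<noteq> 0" by simp
  have q0: "q \<noteq> 0" using Rg0 lf0 by (simp add: q_def)
  have "(\<Prod>\<theta>\<in>R. \<xi> * u \<theta>) \<in> V" by (rule V_closed(9)) (rule u_bound[OF nz])
  moreover have "(\<Prod>\<theta>\<in>R. \<xi> * u \<theta>) = \<iota> q / \<iota> (resultant f (pderiv f))"
  proof -
    have lce: "lc ^ e * lc ^ degree g = lc ^ (d - 1)" by (simp only: power_add[symmetric] e(2)[symmetric] add.commute)
    have "(\<Prod>\<theta>\<in>R. \<xi> * u \<theta>) = \<xi> ^ d * (\<Prod>\<theta>\<in>R. ev g \<theta>) / (\<Prod>\<theta>\<in>R. poly (pderiv fM) \<theta>)"
      by (simp add: u_def prod.distrib prod_dividef card_R)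
    moreover have "\<iota> q = \<xi> ^ d * (lc ^ (d - 1) * (\<Prod>\<theta>\<in>R. ev g \<theta>))"
      unfolding lce[symmetric] by (simp add: q_def \<iota>.hom_mult \<iota>.hom_power \<iota>_monom res1 lc_def[symmetric] mult_ac)
    ultimately show ?thesis by (simp add: res2)
  qed
  ultimately have "degree q \<le> degree (resultant f (pderiv f))"
    using fraction_in_V_iff[OF q0 sep] by simp
  moreover have "degree q = d + degree (resultant f g) + degree (lead_coeff f) * e"
    using Rg0 lf0 by (simp add: q_def degree_mult_eq degree_power_eq degree_monom_eq mult.commute)
  moreover have "degree (lead_coeff f) * 1 \<le> degree (lead_coeff f) * e" using e(1) by (intro mult_left_mono) auto
  ultimately show False using small by simp
qed

end

context plane_curve
begin

text \<open>
If \<open>w\<close> took two values over infinity, it would not be a sum of a regular function \<open>a\<close> and a function \<open>j\<close> vanishing at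
infinity: \<open>a = w - j\<close> would have no poles at all and hence be constant. A functional that separates \<open>w\<close> from these sums then
violates the previous lemma.
\<close>

theorem one_place_at_infinity:
  assumes small: "degree (resultant f (pderiv f)) < degree (lead_coeff f) + d"
    and w: "w \<in> L" "\<And>\<theta>. \<theta> \<in> R \<Longrightarrow> w \<theta> \<in> V"
  shows "\<exists>c. \<forall>\<theta>\<in>R. w \<theta> - \<kappa> c \<in> \<mm>"
proof (rule ccontr)
  assume no: "\<not> ?thesis"
  define S where "S = {z. \<exists>a\<in>affine_ring. \<exists>j\<in>infinity_ideal. z = (\<lambda>\<theta>. a \<theta> + j \<theta>)}"
  have A0: "(\<lambda>_. 0) \<in> affine_ring" using valuation_ring_closed(2) by (intro affine_ringI) (use L_const[OF \<F>_closed(1)[of 0]] in auto)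
  have J0: "(\<lambda>_. 0) \<in> infinity_ideal" by (intro infinity_idealI) (use L_const[OF \<F>_closed(1)[of 0]] in \<open>auto simp: m_props\<close>)
  have wS: "w \<notin> S"
  proof
    assume "w \<in> S"
    then obtain a j where aj: "a \<in> affine_ring" "j \<in> infinity_ideal" "w = (\<lambda>\<theta>. a \<theta> + j \<theta>)" unfolding S_def by blast
    have "a \<theta> \<in> V" if "\<theta> \<in> R" for \<theta>
    proof -
      have "w \<theta> - j \<theta> \<in> V" using aj(2) w(2) that m_props(1) by (intro V_closed(3)) (auto simp: infinity_ideal_def)
      then show ?thesis using aj(3) by simp
    qed
    then obtain c where "\<forall>\<theta>\<in>R. a \<theta> = \<kappa> c" using global_const[OF aj(1)] by blast
    then have "\<forall>\<theta>\<in>R. w \<theta> - \<kappa> c \<in> \<mm>" using aj by (auto simp: infinity_ideal_def)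
    then show False using no by blast
  qed
  obtain \<phi> where \<phi>: "\<And>y z. \<phi> (\<lambda>\<theta>. y \<theta> + z \<theta>) = \<phi> y + \<phi> z"
    "\<And>c z. \<phi> (\<lambda>\<theta>. \<kappa> c * z \<theta>) = c * \<phi> z" "\<And>z. z \<in> S \<Longrightarrow> \<phi> z = 0" "\<phi> w = 1"
  proof (rule exists_functional[of S w])
    show "(\<lambda>_. 0) \<in> S" unfolding S_def using A0 J0 by (intro CollectI bexI) auto
    show "(\<lambda>\<theta>. y \<theta> + z \<theta>) \<in> S" if yz: "y \<in> S" "z \<in> S" for y z
    proof -
      obtain a j a' j' where "a \<in> affine_ring" "j \<in> infinity_ideal" "y = (\<lambda>\<theta>. a \<theta> + j \<theta>)" "a' \<in> affine_ring" "j' \<in> infinity_ideal" "z = (\<lambda>\<theta>. a' \<theta> + j' \<theta>)"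
        using yz unfolding S_def by blast
      moreover from this have "(\<lambda>\<theta>. a \<theta> + a' \<theta>) \<in> affine_ring" "(\<lambda>\<theta>. j \<theta> + j' \<theta>) \<in> infinity_ideal"
        by (auto simp: affine_ring_def infinity_ideal_def intro!: L_add valuation_ring_closed m_props)
      ultimately show ?thesis unfolding S_def
        by (intro CollectI bexI[of _ "\<lambda>\<theta>. a \<theta> + a' \<theta>"] bexI[of _ "\<lambda>\<theta>. j \<theta> + j' \<theta>"]) (auto simp: add_ac)
    qed
    show "(\<lambda>\<theta>. \<kappa> c * z \<theta>) \<in> S" if z: "z \<in> S" for c z
    proof -
      obtain a j where aj: "a \<in> affine_ring" "j \<in> infinity_ideal" "z = (\<lambda>\<theta>. a \<theta> + j \<theta>)" using z unfolding S_def by blast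
      then have "(\<lambda>\<theta>. \<kappa> c * a \<theta>) \<in> affine_ring" using \<kappa>_in_range
        by (auto simp: affine_ring_def intro!: L_smult valuation_ring_closed \<F>_closed)
      moreover have "(\<lambda>\<theta>. \<kappa> c * j \<theta>) \<in> infinity_ideal" using aj const_in_V
        by (auto simp: infinity_ideal_def intro!: L_smult m_props(5) \<F>_closed)
      ultimately show ?thesis unfolding S_def using aj(3)
        by (intro CollectI bexI[of _ "\<lambda>\<theta>. \<kappa> c * a \<theta>"] bexI[of _ "\<lambda>\<theta>. \<kappa> c * j \<theta>"]) (auto simp: algebra_simps)
    qed
    show "w \<notin> S" by (rule wS)
  qed blast
  have "z \<in> S" if "z \<in> affine_ring" for z unfolding S_def using that J0 by (intro CollectI bexI[of _ z] bexI[of _ "\<lambda>_. 0"]) auto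
  moreover have "z \<in> S" if "z \<in> infinity_ideal" for z unfolding S_def using that A0 by (intro CollectI bexI[of _ z] bexI[of _ "\<lambda>_. 0"]) auto
  ultimately interpret residue_functional \<iota> V f \<phi> using \<phi> by unfold_locales auto
  show False using \<phi>_vanishes[OF small w(1)] \<phi>(4) by simp
qed

end

section \<open>The Newton polygon at infinity\<close>

lemma coeff_linear_mult: "coeff ([:-a, 1:] * p) k = (if k = 0 then 0 else coeff p (k - 1)) - a * coeff p k"
  for a :: "'b::comm_ring_1"
  by (cases k) auto

text \<open>
Scaling all roots by \<open>s\<close> multiplies the coefficient of \<open>y ^ k\<close> by \<open>s ^ (n - k)\<close>, where \<open>n\<close> is the number of roots; stated without
division or subtraction.
\<close>

lemma coeff_prod_linear_scale:
  fixes \<rho> :: "'i \<Rightarrow> 'b::comm_ring_1"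
  assumes "finite I"
  shows "s ^ k * coeff (\<Prod>i\<in>I. [:- (s * \<rho> i), 1:]) k = s ^ card I * coeff (\<Prod>i\<in>I. [:- \<rho> i, 1:]) k"
  using assms
proof (induction I arbitrary: k rule: finite_induct)
  case empty
  then show ?case by (cases k) (auto simp: coeff_1)
next
  case (insert i I)
  define P where "P = (\<Prod>i\<in>I. [:- (s * \<rho> i), 1:])"
  define Q where "Q = (\<Prod>i\<in>I. [:- \<rho> i, 1:])"
  have IH: "s ^ k * coeff P k = s ^ card I * coeff Q k" for k using insert.IH by (simp add: P_def Q_def)
  have E: "s ^ k * coeff ([:- (s * \<rho> i), 1:] * P) k = s ^ Suc (card I) * coeff ([:- \<rho> i, 1:] * Q) k"
  proof (cases k)
    case 0
    then show ?thesis using IH[of 0] by (simp add: coeff_linear_mult algebra_simps)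
  next
    case (Suc k')
    have "s ^ k * coeff ([:- (s * \<rho> i), 1:] * P) k = s * (s ^ k' * coeff P k') - s * \<rho> i * (s ^ k * coeff P k)"
      unfolding coeff_linear_mult by (simp add: Suc algebra_simps)
    also have "\<dots> = s * (s ^ card I * coeff Q k') - s * \<rho> i * (s ^ card I * coeff Q k)" by (simp only: IH)
    also have "\<dots> = s ^ Suc (card I) * coeff ([:- \<rho> i, 1:] * Q) k"
      unfolding coeff_linear_mult by (simp add: Suc algebra_simps)
    finally show ?thesis .
  qed
  show ?case
    unfolding prod.insert[OF insert.hyps] card_insert_disjoint[OF insert.hyps] P_def[symmetric] Q_def[symmetric]
    by (rule E)
qed

lemma degree_prod_linear:
  fixes \<rho> :: "'i \<Rightarrow> 'b::idom"
  assumes "finite I"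
  shows "degree (\<Prod>i\<in>I. [:- \<rho> i, 1:]) = card I" "coeff (\<Prod>i\<in>I. [:- \<rho> i, 1:]) (card I) = 1"
proof -
  show *: "degree (\<Prod>i\<in>I. [:- \<rho> i, 1:]) = card I"
    by (subst degree_prod_eq_sum_degree) auto
  have "lead_coeff (\<Prod>i\<in>I. [:- \<rho> i, 1:]) = 1" by (subst lead_coeff_prod) simp
  then show "coeff (\<Prod>i\<in>I. [:- \<rho> i, 1:]) (card I) = 1" by (metis *)
qed

lemma irreducible_coeff_0_nz:
  fixes f :: "'a::idom poly"
  assumes "irreducible f" "degree f \<ge> 2"
  shows "coeff f 0 \<noteq> 0"
proof
  assume 0: "coeff f 0 = 0"
  obtain a q where q: "f = pCons a q" by (rule pCons_cases)
  then have "f = [:0, 1:] * q" using 0 by simp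
  then have "[:0, 1:] dvd (1::'a poly) \<or> q dvd 1" by (rule Factorial_Ring.irreducibleD[OF assms(1)])
  moreover have "degree q \<ge> 1" using assms(2) q by (cases "q = 0") auto
  ultimately show False using degree_unit_poly[of "[:0, 1:]"] degree_unit_poly[of q] by auto
qed

context function_field_place
begin

lemma coeff_prod_linear_in_V:
  assumes "finite I" "\<And>i. i \<in> I \<Longrightarrow> \<rho> i \<in> V"
  shows "coeff (\<Prod>i\<in>I. [:- \<rho> i, 1:]) k \<in> V"
  using assms
proof (induction I arbitrary: k rule: finite_induct)
  case empty
  then show ?case by (auto simp: coeff_1 V_closed)
next
  case (insert i I)
  then have "coeff ([:- \<rho> i, 1:] * (\<Prod>i\<in>I. [:- \<rho> i, 1:])) k \<in> V"
    unfolding coeff_linear_mult by (auto intro!: V_closed)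
  then show ?case using insert.hyps by simp
qed

lemma coeff_prod_linear_in_m:
  assumes "finite I" "\<And>i. i \<in> I \<Longrightarrow> \<rho> i \<in> \<mm>" "k < card I"
  shows "coeff (\<Prod>i\<in>I. [:- \<rho> i, 1:]) k \<in> \<mm>"
  using assms
proof (induction I arbitrary: k rule: finite_induct)
  case (insert i I)
  define P where "P = (\<Prod>i\<in>I. [:- \<rho> i, 1:])"
  have "coeff P k \<in> V" unfolding P_def
    using insert m_props(1) by (intro coeff_prod_linear_in_V) auto
  then have "\<rho> i * coeff P k \<in> \<mm>" using insert.prems by (intro m_props(4)) auto
  moreover have "(if k = 0 then 0 else coeff P (k - 1)) \<in> \<mm>"
    using insert.IH[of "k - 1"] insert.prems insert.hyps by (auto simp: P_def m_props)
  ultimately have "coeff ([:- \<rho> i, 1:] * P) k \<in> \<mm>" unfolding coeff_linear_mult by (intro m_props(8))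
  then show ?case using insert.hyps by (simp add: P_def)
qed simp

text \<open>
The translation \<open>y \<mapsto> y + c x^m\<close> moves a root \<open>\<rho> i\<close> to \<open>\<rho> i - c x^m\<close>. If all the new roots are \<open>o(x^m)\<close>, all coefficients except
the leading one fall strictly below the edge of slope \<open>m\<close>.
\<close>

lemma pcompose_shift_degree:
  fixes p :: "'a poly poly"
  assumes I: "finite I" and p0: "p \<noteq> 0" and fac: "map_poly \<iota> p = smult e (\<Prod>i\<in>I. [:- \<rho> i, 1:])"
    and res: "\<And>i. i \<in> I \<Longrightarrow> \<rho> i * inverse \<xi> ^ m - \<kappa> c \<in> \<mm>"
    and k: "k < degree p" and nz: "coeff (pcompose p [:monom c m, 1:]) k \<noteq> 0"
  shows "degree (coeff (pcompose p [:monom c m, 1:]) k) < degree (lead_coeff p) + (degree p - k) * m"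
proof -
  interpret m\<iota>: map_poly_inj_comm_ring_hom \<iota> ..
  define \<beta> where "\<beta> = \<kappa> c * \<xi> ^ m"
  define h where "h = pcompose p [:monom c m, 1:]"
  have e0: "e \<noteq> 0" using fac p0 by auto
  have dp: "degree p = card I" using arg_cong[OF fac, of degree] e0 degree_prod_linear(1)[OF I, of \<rho>] by simp
  have "coeff (map_poly \<iota> p) (card I) = e" using degree_prod_linear(2)[OF I, of \<rho>] by (simp add: fac)
  then have e: "e = \<iota> (lead_coeff p)" by (simp add: dp)
  have comp: "poly (map_poly \<iota> (pcompose q [:monom c m, 1:])) t = poly (map_poly \<iota> q) (t + \<beta>)" for q t
    by (induction q) (simp_all add: pcompose_pCons m\<iota>.hom_add m\<iota>.hom_mult map_poly_pCons \<iota>_monom \<beta>_def algebra_simps hom_distribs)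
  define \<sigma> where "\<sigma> i = \<rho> i * inverse \<xi> ^ m - \<kappa> c" for i
  have \<rho>\<sigma>: "\<rho> i - \<beta> = \<xi> ^ m * \<sigma> i" for i by (simp add: \<sigma>_def \<beta>_def right_diff_distrib power_inverse)
  have "map_poly \<iota> h = smult e (\<Prod>i\<in>I. [:- (\<xi> ^ m * \<sigma> i), 1:])"
  proof (subst poly_eq_poly_eq_iff[symmetric], rule ext)
    fix t
    show "poly (map_poly \<iota> h) t = poly (smult e (\<Prod>i\<in>I. [:- (\<xi> ^ m * \<sigma> i), 1:])) t"
      unfolding h_def comp fac \<rho>\<sigma>[symmetric] by (simp add: poly_prod algebra_simps)
  qed
  then have ch: "\<iota> (coeff h k) = e * coeff (\<Prod>i\<in>I. [:- (\<xi> ^ m * \<sigma> i), 1:]) k"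
    by (metis coeff_smult coeff_map_poly \<iota>.hom_zero)
  define C where "C = coeff (\<Prod>i\<in>I. [:- \<sigma> i, 1:]) k"
  have Cm: "C \<in> \<mm>" unfolding C_def using I k res by (intro coeff_prod_linear_in_m) (auto simp: \<sigma>_def dp)
  have "(\<xi> ^ m) ^ k * \<iota> (coeff h k) = e * ((\<xi> ^ m) ^ card I * C)"
    unfolding ch C_def coeff_prod_linear_scale[OF I, symmetric] by (simp add: mult_ac)
  also have "(\<xi> ^ m) ^ card I = (\<xi> ^ m) ^ k * (\<xi> ^ m) ^ (card I - k)" using k dp by (simp flip: power_add)
  finally have "\<iota> (coeff h k) = e * ((\<xi> ^ m) ^ (card I - k) * C)" by simp
  also have "e * ((\<xi> ^ m) ^ (card I - k) * C) = \<iota> (lead_coeff p * monom 1 ((card I - k) * m)) * C"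
    by (simp add: e \<iota>.hom_mult \<iota>_monom power_mult[symmetric] mult_ac)
  finally have hC: "\<iota> (coeff h k) = \<iota> (lead_coeff p * monom 1 ((card I - k) * m)) * C" .
  define r where "r = lead_coeff p * monom 1 ((card I - k) * m)"
  have r0: "r \<noteq> 0" using p0 by (simp add: r_def)
  have "\<iota> (coeff h k) / \<iota> r = C" using hC r0 by (simp add: r_def[symmetric])
  then have "degree (coeff h k) < degree r"
    using Cm fraction_in_m_iff[of "coeff h k" r] nz r0 by (simp add: h_def)
  also have "degree r = degree (lead_coeff p) + (card I - k) * m"
    using p0 by (simp add: r_def degree_mult_eq degree_monom_eq)
  finally show ?thesis by (simp add: h_def dp)
qed

end

text \<open>
The degree condition is that of a discriminant of degree less than \<open>d\<close>.
\<close>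

locale one_place_curve = plane_curve \<iota> V f
  for \<iota> :: "'a::{alg_closed_field,field_char_0} poly \<Rightarrow> 'm::{alg_closed_field,field_char_0}" and V f +
  assumes small: "degree (resultant f (pderiv f)) < degree (lead_coeff f) + d"
begin

lemma f0_nz: "coeff f 0 \<noteq> 0" using irreducible_coeff_0_nz irr deg by blast

lemma root_nz: "\<theta> \<in> R \<Longrightarrow> \<theta> \<noteq> 0"
  using f0_nz by (auto simp: R_def fM_def poly_0_coeff_0)

lemma R_ne: "R \<noteq> {}" using card_R deg by (auto simp: d_def)

lemma id_L: "(\<lambda>\<theta>. \<theta>) \<in> L"
  by (rule L_cong[OF L_ev[of "[:0, 1:]"]]) (simp add: ev_def map_poly_pCons)

text \<open>
A power of the root function times a power of \<open>x\<close> is finite and nonzero at the roots with the largest pole. Having one value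
at infinity, it is nonzero at all roots.
\<close>

lemma roots_same_order:
  assumes "\<theta> \<in> R" "\<eta> \<in> R" shows "\<theta> / \<eta> \<in> V - \<mm>"
proof -
  obtain \<theta>\<^sub>1 where \<theta>\<^sub>1: "\<theta>\<^sub>1 \<in> R" "\<forall>\<eta>\<in>R. \<eta> / \<theta>\<^sub>1 \<in> V"
    using exists_dominant[of R "\<lambda>\<theta>. \<theta>"] root_nz R_ne by auto
  note nz = root_nz[OF \<theta>\<^sub>1(1)]
  obtain n e where ne: "n > 0" "\<theta>\<^sub>1 ^ n * \<xi> powi e \<in> V - \<mm>" using exists_power_unit[OF nz] .
  define w where "w \<eta> = \<eta> ^ n * \<xi> powi e" for \<eta> :: 'm
  have w1: "w \<theta>\<^sub>1 \<in> V - \<mm>" using ne by (simp add: w_def)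
  have wq: "w \<eta> = (\<eta> / \<theta>\<^sub>1) ^ n * w \<theta>\<^sub>1" for \<eta> using nz by (simp add: w_def power_divide)
  have wL: "w \<in> L" unfolding w_def by (intro L_mult L_power id_L L_const \<F>_closed)
  have wV: "w \<eta> \<in> V" if "\<eta> \<in> R" for \<eta>
    unfolding wq[of \<eta>] using \<theta>\<^sub>1 that w1 by (intro V_closed(5) V_closed(7)) auto
  obtain c where c: "\<forall>\<eta>\<in>R. w \<eta> - \<kappa> c \<in> \<mm>" using one_place_at_infinity[OF small wL wV] by blast
  have c0: "c \<noteq> 0" using c \<theta>\<^sub>1(1) w1 by auto
  have unit: "\<eta> / \<theta>\<^sub>1 \<in> V - \<mm>" if \<eta>: "\<eta> \<in> R" for \<eta>
  proof -
    have "\<eta> / \<theta>\<^sub>1 \<notin> \<mm>"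
    proof
      assume "\<eta> / \<theta>\<^sub>1 \<in> \<mm>"
      then have "w \<eta> \<in> \<mm>" unfolding wq[of \<eta>] using w1 ne(1) by (intro m_props(4) max_ideal_power[OF val]) auto
      then have "w \<eta> - (w \<eta> - \<kappa> c) \<in> \<mm>" by (rule m_props(8)) (use c \<eta> in blast)
      then show False using c0 by simp
    qed
    then show ?thesis using \<theta>\<^sub>1(2) \<eta> by blast
  qed
  have "\<theta> / \<theta>\<^sub>1 * inverse (\<eta> / \<theta>\<^sub>1) \<in> V - \<mm>" by (intro unit_closed unit assms)
  then show ?thesis using nz by (simp add: field_simps)
qed

lemma coeff_0_root:
  assumes "\<theta> \<in> R"
  obtains v where "v \<in> V - \<mm>" "\<iota> (coeff f 0) = lc * v * \<theta> ^ d"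
proof
  define v where "v = (\<Prod>\<eta>\<in>R. - (\<eta> / \<theta>))"
  have "- 1 \<in> V - \<mm>" using m_props(2,7) unit_closed(4) V_closed(6) by force
  then have u: "- (\<eta> / \<theta>) \<in> V - \<mm>" if "\<eta> \<in> R" for \<eta>
    using unit_closed(1)[OF _ roots_same_order[OF that assms], of "-1"] by simp
  then have "v \<in> V" unfolding v_def by (intro V_closed(9)) auto
  moreover have "v \<notin> \<mm>" unfolding v_def using u by (subst prod_in_max_ideal_iff[OF val]) auto
  ultimately show "v \<in> V - \<mm>" by simp
  have "\<iota> (coeff f 0) = poly fM 0" by (simp add: fM_def poly_0_coeff_0 coeff_map_poly)
  also have "\<dots> = lc * (\<Prod>\<eta>\<in>R. - \<eta>)" by (subst fM_factorization) (simp add: poly_prod)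
  also have "(\<Prod>\<eta>\<in>R. - \<eta>) = (\<Prod>\<eta>\<in>R. - (\<eta> / \<theta>) * \<theta>)" using root_nz[OF assms] by simp
  also have "\<dots> = v * \<theta> ^ d" unfolding v_def by (subst prod.distrib) (simp add: card_R)
  finally show "\<iota> (coeff f 0) = lc * v * \<theta> ^ d" by simp
qed

text \<open>
As all roots have the same order, dividing them by one of them makes the polynomial integral over \<open>V\<close>. Taking \<open>d\<close>-th powers
removes the root from the resulting estimate.
\<close>

lemma newton_polygon_slope:
  assumes "k \<le> d"
  shows "d * degree (coeff f k) \<le> k * degree (lead_coeff f) + (d - k) * degree (coeff f 0)"
proof (cases "coeff f k = 0")
  case False
  obtain \<theta> where \<theta>: "\<theta> \<in> R" using R_ne by blast
  obtain v where v: "v \<in> V - \<mm>" "\<iota> (coeff f 0) = lc * v * \<theta> ^ d" using coeff_0_root[OF \<theta>] .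
  have v0: "v \<noteq> 0" using v(1) m_props(3) by blast
  define C where "C = coeff (\<Prod>\<eta>\<in>R. [:- (\<eta> / \<theta>), 1:]) k"
  have CV: "C \<in> V" unfolding C_def
    by (intro coeff_prod_linear_in_V finite_R) (use roots_same_order[OF _ \<theta>] in auto)
  have "\<theta> ^ k * coeff (\<Prod>\<eta>\<in>R. [:- (\<theta> * (\<eta> / \<theta>)), 1:]) k = \<theta> ^ d * C"
    unfolding C_def using coeff_prod_linear_scale[OF finite_R, of \<theta> k "\<lambda>\<eta>. \<eta> / \<theta>"] by (simp add: card_R)
  then have tc: "\<theta> ^ k * coeff (\<Prod>\<eta>\<in>R. [:- \<eta>, 1:]) k = \<theta> ^ d * C"
    using root_nz[OF \<theta>] by simp
  have "\<iota> (coeff f k) = coeff fM k" by (simp add: fM_def coeff_map_poly)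
  also have "\<dots> = lc * coeff (\<Prod>\<eta>\<in>R. [:- \<eta>, 1:]) k" by (subst fM_factorization) simp
  finally have "\<theta> ^ k * \<iota> (coeff f k) = lc * (\<theta> ^ d * C)" using tc by (simp add: mult_ac)
  also have "\<theta> ^ d = \<theta> ^ k * \<theta> ^ (d - k)" using assms by (simp flip: power_add)
  finally have ak: "\<iota> (coeff f k) = lc * \<theta> ^ (d - k) * C" using root_nz[OF \<theta>] by simp
  define q where "q = lead_coeff f ^ k * coeff f 0 ^ (d - k)"
  have q0: "q \<noteq> 0" using f0_nz by (simp add: q_def)
  have "\<iota> q = lc ^ k * (lc * v * \<theta> ^ d) ^ (d - k)" by (simp add: q_def \<iota>.hom_mult \<iota>.hom_power lc_def v(2))
  also have "\<dots> = lc ^ k * lc ^ (d - k) * v ^ (d - k) * (\<theta> ^ (d - k)) ^ d"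
    by (simp add: power_mult_distrib flip: power_mult) (simp add: mult.commute)
  also have "lc ^ k * lc ^ (d - k) = lc ^ d" using assms by (simp flip: power_add)
  finally have \<iota>q: "\<iota> q = lc ^ d * v ^ (d - k) * (\<theta> ^ (d - k)) ^ d" .
  have "\<iota> (coeff f k ^ d) = lc ^ d * (\<theta> ^ (d - k)) ^ d * C ^ d"
    by (simp add: \<iota>.hom_power ak power_mult_distrib)
  then have "\<iota> (coeff f k ^ d) / \<iota> q = C ^ d * inverse v ^ (d - k)"
    unfolding \<iota>q using root_nz[OF \<theta>] v0 by (simp add: field_simps)
  moreover have "C ^ d * inverse v ^ (d - k) \<in> V"
    using CV v(1) by (intro V_closed(5) V_closed(7) inverse_in_valuation_ring[OF val]) auto
  ultimately have "degree (coeff f k ^ d) \<le> degree q"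
    using fraction_in_V_iff[of "coeff f k ^ d" q] False q0 by simp
  moreover have "degree q = k * degree (lead_coeff f) + (d - k) * degree (coeff f 0)"
    using f0_nz by (simp add: q_def degree_mult_eq degree_power_eq)
  ultimately show ?thesis using False by (simp add: degree_power_eq mult.commute)
qed simp

text \<open>
A function of the order of \<open>x ^ m\<close> or smaller is \<open>c x^m + o(x^m)\<close> with the same \<open>c\<close> at all roots.
\<close>

lemma residue_of_scaled:
  assumes z: "z \<in> L" "\<And>\<theta>. \<theta> \<in> R \<Longrightarrow> z \<theta> ^ d * inverse \<xi> ^ (d * m) \<in> V"
  shows "\<exists>c. \<forall>\<theta>\<in>R. z \<theta> * inverse \<xi> ^ m - \<kappa> c \<in> \<mm>"
proof (rule one_place_at_infinity[OF small])
  show "(\<lambda>\<theta>. z \<theta> * inverse \<xi> ^ m) \<in> L" by (intro L_mult z L_const \<F>_closed)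
  fix \<theta> assume "\<theta> \<in> R"
  then have "(z \<theta> * inverse \<xi> ^ m) ^ d \<in> V" using z(2)
    by (simp add: power_mult_distrib mult.commute[of d] flip: power_mult)
  then show "z \<theta> * inverse \<xi> ^ m \<in> V" by (rule root_in_valuation_ring[OF val]) (use deg in \<open>simp add: d_def\<close>)
qed

text \<open>
The roots are of order \<open>x ^ m\<close>, because the \<open>d\<close>-th power of each of them has the order of the quotient of the extreme
coefficients; so they have a common leading term, which a translation removes.
\<close>

lemma shift_reduces:
  assumes "degree (coeff f 0) = degree (lead_coeff f) + d * m"
  obtains c where "\<And>k. k < d \<Longrightarrow> coeff (pcompose f [:monom c m, 1:]) k \<noteq> 0 \<Longrightarrow>
     degree (coeff (pcompose f [:monom c m, 1:]) k) < degree (lead_coeff f) + (d - k) * m"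
proof -
  have "\<exists>c. \<forall>\<theta>\<in>R. \<theta> * inverse \<xi> ^ m - \<kappa> c \<in> \<mm>"
  proof (rule residue_of_scaled[OF id_L])
    fix \<theta> assume \<theta>: "\<theta> \<in> R"
    obtain v where v: "v \<in> V - \<mm>" "\<iota> (coeff f 0) = lc * v * \<theta> ^ d" using coeff_0_root[OF \<theta>] .
    have v0: "v \<noteq> 0" using v(1) m_props(3) by blast
    have "\<iota> (coeff f 0) / \<iota> (lead_coeff f * monom 1 (d * m)) \<in> V"
      using f0_nz assms by (subst fraction_in_V_iff) (auto simp: degree_mult_eq degree_monom_eq)
    then have "inverse v * (\<iota> (coeff f 0) / \<iota> (lead_coeff f * monom 1 (d * m))) \<in> V"
      using v(1) by (intro V_closed(5) inverse_in_valuation_ring[OF val]) auto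
    moreover have "inverse v * (\<iota> (coeff f 0) / \<iota> (lead_coeff f * monom 1 (d * m))) = \<theta> ^ d * inverse \<xi> ^ (d * m)"
      unfolding v(2) \<iota>.hom_mult \<iota>_monom lc_def[symmetric] using v0 by (simp add: field_simps)
    ultimately show "\<theta> ^ d * inverse \<xi> ^ (d * m) \<in> V" by simp
  qed
  then obtain c where c: "\<And>\<theta>. \<theta> \<in> R \<Longrightarrow> \<theta> * inverse \<xi> ^ m - \<kappa> c \<in> \<mm>" by blast
  show ?thesis
    using pcompose_shift_degree[OF finite_R f_nz fM_factorization[unfolded fM_def] c] that[of c]
    by (simp add: d_def)
qed

text \<open>
The same for the reciprocals of the roots.
\<close>

lemma reflect_shift_reduces:
  assumes "degree (lead_coeff f) = degree (coeff f 0) + d * m"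
  obtains c where "\<And>k. k < d \<Longrightarrow> coeff (pcompose (reflect_poly f) [:monom c m, 1:]) k \<noteq> 0 \<Longrightarrow>
     degree (coeff (pcompose (reflect_poly f) [:monom c m, 1:]) k) < degree (coeff f 0) + (d - k) * m"
proof -
  obtain \<theta>\<^sub>0 where "\<theta>\<^sub>0 \<in> R" using R_ne by blast
  then have invL: "(\<lambda>\<theta>. inverse \<theta>) \<in> L" using L_inverse(1)[OF id_L] root_nz by blast
  have "\<exists>c. \<forall>\<theta>\<in>R. inverse \<theta> * inverse \<xi> ^ m - \<kappa> c \<in> \<mm>"
  proof (rule residue_of_scaled[OF invL])
    fix \<theta> assume \<theta>: "\<theta> \<in> R"
    obtain v where v: "v \<in> V - \<mm>" "\<iota> (coeff f 0) = lc * v * \<theta> ^ d" using coeff_0_root[OF \<theta>] .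
    have v0: "v \<noteq> 0" using v(1) m_props(3) by blast
    have "\<iota> (lead_coeff f) / \<iota> (coeff f 0 * monom 1 (d * m)) \<in> V"
      using f0_nz assms by (subst fraction_in_V_iff) (auto simp: degree_mult_eq degree_monom_eq)
    then have "v * (\<iota> (lead_coeff f) / \<iota> (coeff f 0 * monom 1 (d * m))) \<in> V"
      using v(1) by (intro V_closed(5)) auto
    moreover have "v * (\<iota> (lead_coeff f) / \<iota> (coeff f 0 * monom 1 (d * m))) = inverse \<theta> ^ d * inverse \<xi> ^ (d * m)"
      unfolding \<iota>.hom_mult v(2) \<iota>_monom lc_def[symmetric] using v0 root_nz[OF \<theta>] by (simp add: field_simps)
    ultimately show "inverse \<theta> ^ d * inverse \<xi> ^ (d * m) \<in> V" by simp
  qed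
  then obtain c where c: "\<And>\<theta>. \<theta> \<in> R \<Longrightarrow> inverse \<theta> * inverse \<xi> ^ m - \<kappa> c \<in> \<mm>" by blast
  have "map_poly \<iota> (reflect_poly f) = reflect_poly fM"
    by (rule poly_eqI) (auto simp: coeff_reflect_poly coeff_map_poly fM_def)
  also have "\<dots> = smult lc (\<Prod>\<theta>\<in>R. reflect_poly [:-\<theta>, 1:])"
    by (subst fM_factorization) (simp only: reflect_poly_smult reflect_poly_prod)
  also have "(\<Prod>\<theta>\<in>R. reflect_poly [:-\<theta>, 1:]) = (\<Prod>\<theta>\<in>R. smult (- \<theta>) [:- inverse \<theta>, 1:])"
    using root_nz by (intro prod.cong refl) (simp add: reflect_poly_pCons)
  also have "\<dots> = smult (\<Prod>\<theta>\<in>R. - \<theta>) (\<Prod>\<theta>\<in>R. [:- inverse \<theta>, 1:])" by (rule prod_smult)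
  finally have fac: "map_poly \<iota> (reflect_poly f) = smult (lc * (\<Prod>\<theta>\<in>R. - \<theta>)) (\<Prod>\<theta>\<in>R. [:- inverse \<theta>, 1:])"
    by simp
  have r: "reflect_poly f \<noteq> 0" "degree (reflect_poly f) = d" "coeff (reflect_poly f) d = coeff f 0"
    using f0_nz by (auto simp: d_def coeff_reflect_poly)
  show ?thesis
    using pcompose_shift_degree[OF finite_R r(1) fac c] that[of c] r(2,3) by simp
qed

end

instance fract :: ("{idom, ring_char_0}") ring_char_0
proof
  have "of_nat n = (Fract (of_nat n) 1 :: 'a fract)" for n
    by (induction n) (auto simp: Zero_fract_def One_fract_def add_fract)
  then show "inj (of_nat :: nat \<Rightarrow> 'a fract)" by (auto simp: inj_on_def eq_fract)
qed

instance fract :: ("{idom, ring_char_0}") field_char_0 ..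

text \<open>
The concrete field: the algebraic closure of the field of fractions of \<open>K[x]\<close>.
\<close>

definition embed :: "'a::{alg_closed_field, field_char_0} poly \<Rightarrow> 'a poly fract alg_closure" where
  "embed p = to_ac (to_fract p)"

lemma clear_denominators:
  fixes p :: "'b::idom fract poly"
  shows "\<exists>c q. c \<noteq> 0 \<and> smult (to_fract c) p = map_poly to_fract q"
proof (induction p rule: pCons_induct)
  case 0 then show ?case by (intro exI[of _ 1] exI[of _ 0]) simp
next
  case (pCons a p)
  obtain c q where cq: "c \<noteq> 0" "smult (to_fract c) p = map_poly to_fract q" using pCons.IH by blast
  obtain x y where a: "a = Fract x y" "y \<noteq> 0" by (cases a) auto
  have "to_fract (c * y) * a = to_fract (c * x)" using a by (simp add: Fract_conv_to_fract)
  moreover have "smult (to_fract (c * y)) p = map_poly to_fract (smult y q)"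
  proof -
    have "smult (to_fract (c * y)) p = smult (to_fract y) (smult (to_fract c) p)" by (simp add: mult.commute)
    also have "\<dots> = map_poly to_fract (smult y q)" unfolding cq(2) by (rule poly_eqI) (simp add: coeff_map_poly)
    finally show ?thesis .
  qed
  moreover have "map_poly to_fract (pCons (c * x) (smult y q)) = pCons (to_fract (c * x)) (map_poly to_fract (smult y q))"
    by (rule poly_eqI) (simp add: coeff_map_poly coeff_pCons split: nat.split)
  ultimately have "smult (to_fract (c * y)) (pCons a p) = map_poly to_fract (pCons (c * x) (smult y q))"
    by (simp only: smult_pCons)
  then show ?case using cq(1) a(2) by (metis no_zero_divisors)
qed

interpretation embed: function_field "embed :: 'a::{alg_closed_field,field_char_0} poly \<Rightarrow> 'a poly fract alg_closure"
proof (unfold function_field_def, intro conjI allI)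
  show "inj_comm_ring_hom (embed :: 'a poly \<Rightarrow> 'a poly fract alg_closure)" by unfold_locales (auto simp: embed_def)
  fix z :: "'a poly fract alg_closure"
  obtain p where p: "p \<noteq> 0" "poly (map_poly to_ac p) z = 0" by (rule alg_closure_algebraic)
  obtain c q where cq: "c \<noteq> 0" "smult (to_fract c) p = map_poly to_fract q" using clear_denominators by blast
  have "map_poly embed q = map_poly to_ac (map_poly to_fract q)"
    by (rule poly_eqI) (simp add: coeff_map_poly embed_def)
  also have "\<dots> = smult (embed c) (map_poly to_ac p)"
    unfolding cq(2)[symmetric] by (rule poly_eqI) (simp add: coeff_map_poly embed_def)
  finally have "poly (map_poly embed q) z = 0" using p by simp
  moreover have "q \<noteq> 0" using cq p by auto
  ultimately show "\<exists>p. p \<noteq> 0 \<and> poly (map_poly embed p) z = 0" by blast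
qed

text \<open>
The discriminant is the quotient of the resultant by the leading coefficient. The degree of a polynomial quotient is the
difference of the degrees, so the degree of the resultant is known.
\<close>

lemma minimal_resultant:
  fixes f :: "'a::{alg_closed_field, field_char_0} poly poly"
  assumes "minimal_poly2 f" "degree f \<ge> 2"
  shows "resultant f (pderiv f) \<noteq> 0"
    "degree (resultant f (pderiv f)) < degree (lead_coeff f) + degree f"
proof -
  define r where "r = resultant f (pderiv f)"
  define l where "l = lead_coeff f"
  have l0: "l \<noteq> 0" using assms(2) by (auto simp: l_def)
  have "degree (discriminant f) = degree (r div l)"
  proof (cases "even (degree f * (degree f - 1) div 2)")
    case True then show ?thesis by (simp add: discriminant_def r_def l_def)
  next
    case False
    have "(-1::'a poly) ^ (degree f * (degree f - 1) div 2) = -1" using False by (simp add: uminus_power_if)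
    then show ?thesis by (simp add: discriminant_def r_def l_def)
  qed
  moreover have "degree (discriminant f) = degree f - 1" using assms unfolding minimal_poly2_def by linarith
  ultimately have dr: "degree (r div l) = degree f - 1" by simp
  then have q0: "r div l \<noteq> 0" using assms(2) by auto
  then show "resultant f (pderiv f) \<noteq> 0" by (auto simp: r_def)
  have "r = r div l * l + r mod l" by simp
  have "degree (r div l * l) = degree f - 1 + degree l" using q0 l0 dr by (simp add: degree_mult_eq)
  moreover have "degree (r mod l) \<le> degree l" using degree_mod_less[OF l0, of r] by auto
  ultimately have "degree (r div l * l + r mod l) \<le> degree f - 1 + degree l"
    by (intro degree_add_le) auto
  then show "degree (resultant f (pderiv f)) < degree (lead_coeff f) + degree f"
    using assms(2) by (simp add: r_def[symmetric] l_def[symmetric])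
qed

theorem minimal_newton_polygon:
  fixes f :: "'a::{alg_closed_field, field_char_0} poly poly"
  assumes "minimal_poly2 f" "degree f \<ge> 2"
  shows "\<And>k. k \<le> degree f \<Longrightarrow> degree f * degree (coeff f k) \<le>
      k * degree (lead_coeff f) + (degree f - k) * degree (coeff f 0)"
    and "\<And>m. degree (coeff f 0) = degree (lead_coeff f) + degree f * m \<Longrightarrow>
      \<exists>\<beta>. \<forall>k<degree f. coeff (pcompose f [:\<beta>, 1:]) k \<noteq> 0 \<longrightarrow>
        degree (coeff (pcompose f [:\<beta>, 1:]) k) < degree (lead_coeff f) + (degree f - k) * m"
    and "\<And>m. degree (lead_coeff f) = degree (coeff f 0) + degree f * m \<Longrightarrow>
      \<exists>\<beta>. \<forall>k<degree f. coeff (pcompose (reflect_poly f) [:\<beta>, 1:]) k \<noteq> 0 \<longrightarrow>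
        degree (coeff (pcompose (reflect_poly f) [:\<beta>, 1:]) k) < degree (coeff f 0) + (degree f - k) * m"
proof -
  obtain V :: "'a poly fract alg_closure set" where V: "valuation_ring V" "range embed.\<kappa> \<subseteq> V" "inverse embed.\<xi> \<in> V" "embed.\<xi> \<notin> V"
    using embed.exists_place_at_infinity .
  interpret P: function_field_place embed V using V by unfold_locales auto
  interpret C: plane_curve embed V f
    using assms minimal_resultant[OF assms] by unfold_locales (auto simp: minimal_poly2_def)
  interpret O: one_place_curve embed V f
    using minimal_resultant[OF assms] by unfold_locales (auto simp: C.d_def)
  show "degree f * degree (coeff f k) \<le> k * degree (lead_coeff f) + (degree f - k) * degree (coeff f 0)"
    if "k \<le> degree f" for k
    using O.newton_polygon_slope that by (simp add: C.d_def)
  show "\<exists>\<beta>. \<forall>k<degree f. coeff (pcompose f [:\<beta>, 1:]) k \<noteq> 0 \<longrightarrow>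
        degree (coeff (pcompose f [:\<beta>, 1:]) k) < degree (lead_coeff f) + (degree f - k) * m"
    if "degree (coeff f 0) = degree (lead_coeff f) + degree f * m" for m
    using O.shift_reduces[of m] that by (simp add: C.d_def) blast
  show "\<exists>\<beta>. \<forall>k<degree f. coeff (pcompose (reflect_poly f) [:\<beta>, 1:]) k \<noteq> 0 \<longrightarrow>
        degree (coeff (pcompose (reflect_poly f) [:\<beta>, 1:]) k) < degree (coeff f 0) + (degree f - k) * m"
    if "degree (lead_coeff f) = degree (coeff f 0) + degree f * m" for m
    using O.reflect_shift_reduces[of m] that by (simp add: C.d_def) blast
qed

section \<open>Areas, orbits and minimality\<close>

text \<open>
The convex hull of \<open>(0,0)\<close>, \<open>(0,d)\<close>, \<open>(a,0)\<close> and \<open>(b,d)\<close>, as an intersection of half-planes.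
\<close>

definition trapezoid :: "real \<Rightarrow> real \<Rightarrow> real \<Rightarrow> (real \<times> real) set" where
  "trapezoid d a b = {(x, y). 0 \<le> y \<and> y \<le> d \<and> 0 \<le> x \<and> d * x \<le> a * (d - y) + b * y}"

lemma trapezoid_halfspaces:
  "trapezoid d a b = {z. (0, -1) \<bullet> z \<le> 0} \<inter> {z. (0, 1) \<bullet> z \<le> d} \<inter> {z. (-1, 0) \<bullet> z \<le> 0} \<inter>
     {z. (d, a - b) \<bullet> z \<le> a * d}"
  by (auto simp: trapezoid_def inner_Pair algebra_simps)

lemma convex_trapezoid: "convex (trapezoid d a b)"
  unfolding trapezoid_halfspaces by (intro convex_Int convex_halfspace_le)

lemma closed_trapezoid: "closed (trapezoid d a b)"
  unfolding trapezoid_halfspaces by (intro closed_Int closed_halfspace_le)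

text \<open>
Integrate the lengths of the horizontal slices.
\<close>

lemma emeasure_trapezoid:
  assumes "d > 0" "a \<ge> 0" "b \<ge> 0"
  shows "emeasure lborel (trapezoid d a b) = ennreal (d * (a + b) / 2)"
proof -
  define w where "w y = a + (b - a) * y / d" for y
  define W where "W y = a * y + (b - a) * y\<^sup>2 / (2 * d)" for y
  have w0: "0 \<le> w y" if "0 \<le> y" "y \<le> d" for y
  proof -
    have "w y * d = a * (d - y) + b * y" using assms by (simp add: w_def field_simps)
    moreover have "0 \<le> a * (d - y) + b * y" using assms that by simp
    ultimately show ?thesis using assms by (metis zero_le_mult_iff not_le)
  qed
  have T: "trapezoid d a b \<in> sets lborel" using closed_trapezoid by simp
  have slice: "(\<lambda>x. (x, y)) -` trapezoid d a b = (if y \<in> {0..d} then {0..w y} else {})" for y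
    using assms by (auto simp: trapezoid_def w_def field_simps)
  have "emeasure lborel (trapezoid d a b) = emeasure (lborel \<Otimes>\<^sub>M lborel) (trapezoid d a b)"
    by (simp add: lborel_prod)
  also have "\<dots> = (\<integral>\<^sup>+ y. emeasure lborel ((\<lambda>x. (x, y)) -` trapezoid d a b) \<partial>lborel)"
    by (rule lborel_pair.emeasure_pair_measure_alt2) (use T in \<open>simp only: lborel_prod\<close>)
  also have "\<dots> = (\<integral>\<^sup>+ y. ennreal (w y) * indicator {0..d} y \<partial>lborel)"
    by (intro nn_integral_cong) (auto simp: slice w0 indicator_def)
  also have "\<dots> = ennreal (W d - W 0)"
  proof (rule nn_integral_FTC_Icc)
    show "w \<in> borel_measurable borel" unfolding w_def by measurable
    show "(W has_real_derivative w y) (at y)" if "y \<in> {0..d}" for y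
      unfolding W_def w_def using assms(1) by (auto intro!: derivative_eq_intros simp: field_simps)
  qed (use assms w0 in auto)
  also have "W d - W 0 = d * (a + b) / 2"
    using assms by (simp add: W_def field_simps power2_eq_square)
  finally show ?thesis .
qed

lemma measure_trapezoid:
  assumes "d > 0" "a \<ge> 0" "b \<ge> 0"
  shows "measure lborel (trapezoid d a b) = d * (a + b) / 2"
    and "trapezoid d a b \<in> fmeasurable lborel"
  using emeasure_trapezoid[OF assms] assms closed_trapezoid
  by (auto simp: measure_def intro!: fmeasurableI)

lemma trapezoid_subset_hull:
  assumes "d > 0" "a \<ge> 0" "b \<ge> 0"
    and S: "(0, 0) \<in> S" "(0, d) \<in> S" "(a, 0) \<in> S" "(b, d) \<in> S"
  shows "trapezoid d a b \<subseteq> convex hull S"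
proof
  fix z assume z: "z \<in> trapezoid d a b"
  obtain x y where xy: "z = (x, y)" by (cases z)
  define t where "t = y / d"
  define w where "w = (1 - t) * a + t * b"
  have t: "0 \<le> t" "t \<le> 1" using z assms by (auto simp: xy trapezoid_def t_def)
  have ty: "t * d = y" using assms by (simp add: t_def)
  have "x * d \<le> w * d" using z assms by (auto simp: xy trapezoid_def w_def t_def field_simps)
  then have x: "0 \<le> x" "x \<le> w" using z assms by (auto simp: xy trapezoid_def)
  have "(1 - t) *\<^sub>R (0, 0) + t *\<^sub>R (0, d) \<in> convex hull S"
    using t S by (intro convexD[OF convex_convex_hull] hull_inc) auto
  then have l: "(0, y) \<in> convex hull S" by (simp add: ty)
  have "(1 - t) *\<^sub>R (a, 0) + t *\<^sub>R (b, d) \<in> convex hull S"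
    using t S by (intro convexD[OF convex_convex_hull] hull_inc) auto
  then have r: "(w, y) \<in> convex hull S" by (simp add: ty w_def)
  show "z \<in> convex hull S"
  proof (cases "w = 0")
    case True
    then show ?thesis using l x xy by simp
  next
    case False
    then have "(1 - x / w) *\<^sub>R (0, y) + (x / w) *\<^sub>R (w, y) \<in> convex hull S"
      using x l r by (intro convexD[OF convex_convex_hull]) auto
    then show ?thesis using False by (simp add: xy algebra_simps)
  qed
qed

lemma finite_supp: "finite (supp f)"
proof (rule finite_subset)
  show "supp f \<subseteq> (\<Union>j\<in>{..degree f}. {..degree (coeff f j)} \<times> {j})"
  proof
    fix z assume "z \<in> supp f"
    then obtain i j where z: "z = (i, j)" "coeff (coeff f j) i \<noteq> 0" by (auto simp: supp_def)
    then have "i \<le> degree (coeff f j)" "coeff f j \<noteq> 0" by (auto intro: le_degree)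
    then show "z \<in> (\<Union>j\<in>{..degree f}. {..degree (coeff f j)} \<times> {j})" using z by (auto intro: le_degree)
  qed
qed auto

lemma polytope_measurable: "generic_newton_polytope f \<in> fmeasurable lborel"
proof -
  have "compact (generic_newton_polytope f)"
    unfolding generic_newton_polytope_def by (intro finite_imp_compact_convex_hull) (simp add: finite_supp)
  then show ?thesis
    using borel_closed[OF compact_imp_closed] emeasure_compact_finite by (intro fmeasurableI) auto
qed

lemma newton_area_lower:
  assumes "degree g > 0" "coeff g 0 \<noteq> 0"
  shows "real (degree g) * (real (a_deg g) + real (b_deg g)) / 2 \<le> newton_area g"
proof -
  have g0: "lead_coeff g \<noteq> 0" using assms by auto
  let ?T = "trapezoid (real (degree g)) (real (a_deg g)) (real (b_deg g))"
  have "?T \<subseteq> generic_newton_polytope g"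
    unfolding generic_newton_polytope_def
  proof (rule trapezoid_subset_hull)
    have "(a_deg g, 0) \<in> supp g" "(b_deg g, degree g) \<in> supp g"
      using assms g0 by (simp_all add: supp_def a_deg_def b_deg_def)
    then show "(real (a_deg g), 0) \<in> {(0, 0), (0, real (degree g))} \<union> (\<lambda>(i, j). (real i, real j)) ` supp g"
      "(real (b_deg g), real (degree g)) \<in> {(0, 0), (0, real (degree g))} \<union> (\<lambda>(i, j). (real i, real j)) ` supp g"
      by force+
  qed (use assms in auto)
  then have "measure lborel ?T \<le> newton_area g"
    unfolding newton_area_def using closed_trapezoid by (intro measure_mono_fmeasurable polytope_measurable) auto
  then show ?thesis using assms by (subst (asm) measure_trapezoid) auto
qed

lemma newton_area_upper:
  assumes "degree g > 0" "a \<ge> 0" "b \<ge> 0"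
    and bound: "\<And>j. j \<le> degree g \<Longrightarrow> coeff g j \<noteq> 0 \<Longrightarrow>
      real (degree g) * real (degree (coeff g j)) \<le> a * (real (degree g) - real j) + b * real j"
  shows "newton_area g \<le> real (degree g) * (a + b) / 2"
proof -
  let ?T = "trapezoid (real (degree g)) a b"
  have "generic_newton_polytope g \<subseteq> ?T"
    unfolding generic_newton_polytope_def
  proof (intro hull_minimal convex_trapezoid Un_least)
    show "{(0, 0), (0, real (degree g))} \<subseteq> ?T" using assms by (auto simp: trapezoid_def)
    show "(\<lambda>(i, j). (real i, real j)) ` supp g \<subseteq> ?T"
    proof clarify
      fix i j assume "(i, j) \<in> supp g"
      then have ij: "coeff (coeff g j) i \<noteq> 0" by (simp add: supp_def)
      then have i: "i \<le> degree (coeff g j)" and nz: "coeff g j \<noteq> 0" by (auto intro: le_degree)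
      then have j: "j \<le> degree g" by (auto intro: le_degree)
      have "real (degree g) * real i \<le> real (degree g) * real (degree (coeff g j))"
        using i by (intro mult_left_mono) auto
      also have "\<dots> \<le> a * (real (degree g) - real j) + b * real j" using bound[OF j nz] .
      finally show "(real i, real j) \<in> ?T" using j by (simp add: trapezoid_def)
    qed
  qed
  then have "newton_area g \<le> measure lborel ?T"
    unfolding newton_area_def using measure_trapezoid(2)[of "real (degree g)" a b] assms(1-3) fmeasurableD[OF polytope_measurable]
    by (intro measure_mono_fmeasurable) auto
  then show ?thesis using assms by (subst (asm) measure_trapezoid) auto
qed

lemma coeff_mult_top:
  fixes p q :: "'b::comm_semiring_0 poly"
  assumes "degree p \<le> m" "degree q \<le> n"
  shows "coeff (p * q) (m + n) = coeff p m * coeff q n"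
proof -
  have "coeff (p * q) (m + n) = (\<Sum>i\<le>m + n. if i = m then coeff p m * coeff q n else 0)"
    unfolding coeff_mult
  proof (intro sum.cong refl)
    fix i assume "i \<in> {..m + n}"
    consider "i < m" | "i = m" | "i > m" by linarith
    then show "coeff p i * coeff q (m + n - i) = (if i = m then coeff p m * coeff q n else 0)"
    proof cases
      case 1
      then have "coeff q (m + n - i) = 0" using assms(2) by (intro coeff_eq_0) auto
      then show ?thesis using 1 by simp
    next
      case 3
      then have "coeff p i = 0" using assms(1) by (intro coeff_eq_0) auto
      then show ?thesis using 3 by simp
    qed simp
  qed
  then show ?thesis by simp
qed

text \<open>
The Newton polygon of \<open>f\<close> at \<open>x = \<infinity>\<close> consists of the single edge from \<open>(a, 0)\<close> to \<open>(b, d)\<close>; with denominators cleared.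
\<close>

definition one_slope :: "'b::zero poly poly \<Rightarrow> bool" where
  "one_slope f \<longleftrightarrow> (\<forall>k\<le>degree f. degree f * degree (coeff f k) \<le>
      k * degree (lead_coeff f) + (degree f - k) * degree (coeff f 0))"

lemma one_slopeD: "one_slope f \<Longrightarrow> k \<le> degree f \<Longrightarrow> degree f * degree (coeff f k) \<le>
      k * degree (lead_coeff f) + (degree f - k) * degree (coeff f 0)"
  by (simp add: one_slope_def)

text \<open>
\<open>f\<close> made homogeneous of degree \<open>d\<close> in two variables. The extreme coefficients of a transformed polynomial are its values at the
columns of the matrix.
\<close>

definition form :: "'b::comm_ring_1 poly poly \<Rightarrow> 'b poly \<Rightarrow> 'b poly \<Rightarrow> 'b poly" where
  "form f \<alpha> \<gamma> = (\<Sum>j\<le>degree f. coeff f j * (\<alpha> ^ j * \<gamma> ^ (degree f - j)))"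

lemma linear_power_top:
  fixes a b :: "'b::comm_ring_1"
  shows "degree ([:b, a:] ^ j) \<le> j" "coeff ([:b, a:] ^ j) j = a ^ j"
proof -
  show deg: "degree ([:b, a:] ^ j) \<le> j" for j
    using degree_power_le[of "[:b, a:]" j] degree_pCons_le[of b "[:a:]"] by (auto intro: order_trans)
  show "coeff ([:b, a:] ^ j) j = a ^ j"
  proof (induction j)
    case (Suc j)
    have "degree [:b, a:] \<le> 1" by simp
    from coeff_mult_top[OF this deg[of j]] show ?case using Suc by simp
  qed simp
qed

lemma GL2_act_coeffs:
  "degree (GL2_act A f) \<le> degree f"
  "coeff (GL2_act A f) (degree f) = form f (A $$ (0,0)) (A $$ (1,0))"
  "coeff (GL2_act A f) 0 = form f (A $$ (0,1)) (A $$ (1,1))"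
proof -
  let ?p = "[:A $$ (0,1), A $$ (0,0):]" and ?q = "[:A $$ (1,1), A $$ (1,0):]"
  have deg: "degree (?p ^ j * ?q ^ (degree f - j)) \<le> degree f" if "j \<le> degree f" for j
  proof -
    have "degree (?p ^ j * ?q ^ (degree f - j)) \<le> degree (?p ^ j) + degree (?q ^ (degree f - j))"
      by (rule degree_mult_le)
    also have "\<dots> \<le> j + (degree f - j)" by (intro add_mono linear_power_top)
    finally show ?thesis using that by simp
  qed
  show "degree (GL2_act A f) \<le> degree f"
    unfolding GL2_act_def
    by (intro degree_sum_le order_trans[OF degree_smult_le] deg) auto
  have top: "coeff (?p ^ j * ?q ^ (degree f - j)) (degree f) = A $$ (0,0) ^ j * A $$ (1,0) ^ (degree f - j)"
    if "j \<le> degree f" for j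
    using coeff_mult_top[OF linear_power_top(1)[of _ _ j] linear_power_top(1)[of _ _ "degree f - j"]] that
    by (simp add: linear_power_top(2))
  show "coeff (GL2_act A f) (degree f) = form f (A $$ (0,0)) (A $$ (1,0))"
    unfolding GL2_act_def form_def coeff_sum coeff_smult 
    by (intro sum.cong refl) (use top in \<open>simp only: atMost_iff\<close>)
  have "coeff (?p ^ j * ?q ^ (degree f - j)) 0 = A $$ (0,1) ^ j * A $$ (1,1) ^ (degree f - j)" for j
    by (simp flip: poly_0_coeff_0)
  then show "coeff (GL2_act A f) 0 = form f (A $$ (0,1)) (A $$ (1,1))"
    unfolding GL2_act_def form_def coeff_sum coeff_smult by simp
qed

lemma sum_with_dominant_term:
  fixes t :: "'i \<Rightarrow> 'b::comm_ring_1 poly"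
  assumes "finite I" "i \<in> I" "t i \<noteq> 0"
    and "\<And>j. j \<in> I \<Longrightarrow> j \<noteq> i \<Longrightarrow> t j \<noteq> 0 \<Longrightarrow> degree (t j) < degree (t i)"
  shows "sum t I \<noteq> 0" "degree (sum t I) = degree (t i)"
proof -
  have small: "sum t J = 0 \<or> degree (sum t J) < degree (t i)" if "finite J" "J \<subseteq> I - {i}" for J
    using that
  proof (induction J rule: finite_induct)
    case (insert j J)
    have "t j = 0 \<or> degree (t j) < degree (t i)" using insert.prems assms(4) by auto
    then show ?case using insert degree_add_less[of "t j" "degree (t i)" "sum t J"] by auto
  qed simp
  have s: "sum t I = t i + sum t (I - {i})" using assms by (simp add: sum.remove)
  have "coeff (sum t (I - {i})) (degree (t i)) = 0"
    using small[of "I - {i}"] assms(1) by (auto intro: coeff_eq_0)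
  then have "coeff (sum t I) (degree (t i)) \<noteq> 0" using assms(3) by (simp add: s)
  then show "sum t I \<noteq> 0" by auto
  show "degree (sum t I) = degree (t i)"
    using small[of "I - {i}"] assms(1) by (auto simp: s degree_add_eq_left)
qed

text \<open>
If \<open>d\<close> does not divide \<open>a - b\<close>, the two extreme terms \<open>P\<close> and \<open>Q\<close> never have equal degrees. All other terms lie on or below the segment
between them, so the larger of the two dominates.
\<close>

lemma form_degree:
  fixes f :: "'b::idom poly poly"
  assumes d: "degree f > 0"
    and slope: "one_slope f"
    and ndvd: "\<not> int (degree f) dvd int (degree (coeff f 0)) - int (degree (lead_coeff f))"
    and f0: "coeff f 0 \<noteq> 0" and nz: "\<alpha> \<noteq> 0 \<or> \<gamma> \<noteq> 0"
  shows "form f \<alpha> \<gamma> \<noteq> 0"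
    and "\<alpha> \<noteq> 0 \<Longrightarrow> degree (lead_coeff f) \<le> degree (form f \<alpha> \<gamma>)"
    and "\<gamma> \<noteq> 0 \<Longrightarrow> degree (coeff f 0) \<le> degree (form f \<alpha> \<gamma>)"
proof -
  define n where "n = degree f"
  define P where "P = degree (lead_coeff f) + n * degree \<alpha>"
  define Q where "Q = degree (coeff f 0) + n * degree \<gamma>"
  define t where "t j = coeff f j * (\<alpha> ^ j * \<gamma> ^ (n - j))" for j
  have form: "form f \<alpha> \<gamma> = sum t {..n}" by (simp add: form_def t_def n_def)
  have lf: "lead_coeff f \<noteq> 0" using d by auto
  have deg_t: "n * degree (t j) \<le> j * P + (n - j) * Q" if "j \<le> n" "t j \<noteq> 0" for j
  proof -
    have nz: "coeff f j \<noteq> 0" "\<alpha> ^ j \<noteq> 0" "\<gamma> ^ (n - j) \<noteq> 0" using that(2) by (auto simp: t_def)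
    have "degree (t j) = degree (coeff f j) + (degree (\<alpha> ^ j) + degree (\<gamma> ^ (n - j)))"
      unfolding t_def using nz by (simp add: degree_mult_eq)
    also have "\<dots> \<le> degree (coeff f j) + (degree \<alpha> * j + degree \<gamma> * (n - j))"
      by (intro add_mono order_refl degree_power_le)
    finally have "n * degree (t j) \<le> n * (degree (coeff f j) + (degree \<alpha> * j + degree \<gamma> * (n - j)))"
      by (rule mult_le_mono2)
    also have "\<dots> = n * degree (coeff f j) + j * (n * degree \<alpha>) + (n - j) * (n * degree \<gamma>)"
      by (simp add: algebra_simps)
    also have "\<dots> \<le> j * degree (lead_coeff f) + (n - j) * degree (coeff f 0) + j * (n * degree \<alpha>) + (n - j) * (n * degree \<gamma>)"
      using one_slopeD[OF slope, of j] that(1) by (simp add: n_def)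
    also have "\<dots> = j * P + (n - j) * Q" by (simp add: P_def Q_def add_mult_distrib2)
    finally show ?thesis .
  qed
  have PQ: "P \<noteq> Q"
  proof
    assume "P = Q"
    then have "int (degree (coeff f 0)) - int (degree (lead_coeff f)) = int n * (int (degree \<alpha>) - int (degree \<gamma>))"
      by (simp add: P_def Q_def algebra_simps flip: of_nat_add of_nat_mult)
    then show False using ndvd by (simp add: n_def)
  qed
  have n0: "n > 0" using d by (simp add: n_def)
  have tn: "t n \<noteq> 0" "degree (t n) = P" if "\<alpha> \<noteq> 0"
    using that lf by (auto simp: t_def P_def n_def degree_mult_eq degree_power_eq)
  have t0: "t 0 \<noteq> 0" "degree (t 0) = Q" if "\<gamma> \<noteq> 0"
    using that f0 by (auto simp: t_def Q_def n_def degree_mult_eq degree_power_eq)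
  have main: "form f \<alpha> \<gamma> \<noteq> 0 \<and> (\<alpha> \<noteq> 0 \<longrightarrow> P \<le> degree (form f \<alpha> \<gamma>)) \<and> (\<gamma> \<noteq> 0 \<longrightarrow> Q \<le> degree (form f \<alpha> \<gamma>))"
  proof (cases "\<alpha> \<noteq> 0 \<and> (\<gamma> = 0 \<or> Q < P)")
    case True
    have "degree (t j) < degree (t n)" if "j \<in> {..n}" "j \<noteq> n" "t j \<noteq> 0" for j
    proof -
      have "\<gamma> \<noteq> 0" using that by (auto simp: t_def power_0_left)
      then have "Q < P" using True by simp
      then have "(n - j) * Q < (n - j) * P" using that by simp
      moreover have "n * degree (t j) \<le> j * P + (n - j) * Q" using deg_t[of j] that by simp
      ultimately have "n * degree (t j) < j * P + (n - j) * P" by linarith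
      also have "j * P + (n - j) * P = n * P" using that by (simp flip: add_mult_distrib)
      finally show ?thesis using tn True by simp
    qed
    from sum_with_dominant_term[of "{..n}" n t, OF _ _ _ this] show ?thesis using tn True by (auto simp: form)
  next
    case False
    then have \<gamma>: "\<gamma> \<noteq> 0" and PQ': "\<alpha> = 0 \<or> P < Q" using nz PQ by auto
    have "degree (t j) < degree (t 0)" if "j \<in> {..n}" "j \<noteq> 0" "t j \<noteq> 0" for j
    proof -
      have "\<alpha> \<noteq> 0" using that by (auto simp: t_def power_0_left)
      then have "P < Q" using PQ' by simp
      then have "j * P < j * Q" using that by simp
      moreover have "n * degree (t j) \<le> j * P + (n - j) * Q" using deg_t[of j] that by simp
      ultimately have "n * degree (t j) < j * Q + (n - j) * Q" by linarith
      also have "j * Q + (n - j) * Q = n * Q" using that by (simp flip: add_mult_distrib)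
      finally show ?thesis using t0 \<gamma> by simp
    qed
    from sum_with_dominant_term[of "{..n}" 0 t, OF _ _ _ this] show ?thesis using t0 \<gamma> PQ' by (auto simp: form)
  qed
  then show "form f \<alpha> \<gamma> \<noteq> 0"
    "\<alpha> \<noteq> 0 \<Longrightarrow> degree (lead_coeff f) \<le> degree (form f \<alpha> \<gamma>)"
    "\<gamma> \<noteq> 0 \<Longrightarrow> degree (coeff f 0) \<le> degree (form f \<alpha> \<gamma>)"
    by (auto simp: P_def Q_def)
qed

lemma GL2_rows_columns:
  assumes "A \<in> GL2"
  shows "A $$ (0,0) \<noteq> 0 \<or> A $$ (1,0) \<noteq> 0" "A $$ (0,1) \<noteq> 0 \<or> A $$ (1,1) \<noteq> 0"
    "A $$ (0,0) \<noteq> 0 \<or> A $$ (0,1) \<noteq> 0" "A $$ (1,0) \<noteq> 0 \<or> A $$ (1,1) \<noteq> 0"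
proof -
  have A: "A \<in> carrier_mat 2 2" using assms by (simp add: GL2_def)
  obtain B where AB: "inverts_mat A B" "inverts_mat B A"
    using assms by (auto simp: GL2_def invertible_mat_def)
  have AB1: "A * B = 1\<^sub>m 2" using AB(1) A by (simp add: inverts_mat_def)
  have dB: "dim_col B = 2" using arg_cong[OF AB1, of dim_col] by simp
  have BA1: "B * A = 1\<^sub>m (dim_row B)" using AB(2) by (simp add: inverts_mat_def)
  have rB: "dim_row B = 2" using arg_cong[OF BA1, of dim_col] A by simp
  have AB_entry: "(\<Sum>k<2. A $$ (i, k) * B $$ (k, j)) = (if i = j then 1 else 0)" if "i < 2" "j < 2" for i j
    using arg_cong[OF AB1, of "\<lambda>M. M $$ (i, j)"] that A dB rB by (simp add: scalar_prod_def lessThan_atLeast0)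
  have BA_entry: "(\<Sum>k<2. B $$ (i, k) * A $$ (k, j)) = (if i = j then 1 else 0)" if "i < 2" "j < 2" for i j
    using arg_cong[OF BA1, of "\<lambda>M. M $$ (i, j)"] that A dB rB by (simp add: scalar_prod_def lessThan_atLeast0)
  have s: "{..<2::nat} = {0, 1}" by auto
  show "A $$ (0,0) \<noteq> 0 \<or> A $$ (1,0) \<noteq> 0" using BA_entry[of 0 0] by (auto simp: s)
  show "A $$ (0,1) \<noteq> 0 \<or> A $$ (1,1) \<noteq> 0" using BA_entry[of 1 1] by (auto simp: s)
  show "A $$ (0,0) \<noteq> 0 \<or> A $$ (0,1) \<noteq> 0" using AB_entry[of 0 0] by (auto simp: s)
  show "A $$ (1,0) \<noteq> 0 \<or> A $$ (1,1) \<noteq> 0" using AB_entry[of 1 1] by (auto simp: s)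
qed

lemma mat_2_in_GL2:
  fixes A :: "'b::comm_ring_1 poly mat"
  assumes A: "A \<in> carrier_mat 2 2" and B: "B \<in> carrier_mat 2 2" and "A * B = 1\<^sub>m 2" "B * A = 1\<^sub>m 2"
  shows "A \<in> GL2"
  using assms by (auto simp: GL2_def invertible_mat_def inverts_mat_def square_mat.simps)

definition mat2 :: "'b \<Rightarrow> 'b \<Rightarrow> 'b \<Rightarrow> 'b \<Rightarrow> 'b mat" where
  "mat2 \<alpha> \<beta> \<gamma> \<delta> = mat 2 2 (\<lambda>(i, j). if i = 0 then (if j = 0 then \<alpha> else \<beta>) else (if j = 0 then \<gamma> else \<delta>))"

lemma mat2_mult:
  fixes \<alpha> :: "'b::comm_ring_1"
  shows "mat2 \<alpha> \<beta> \<gamma> \<delta> * mat2 \<alpha>' \<beta>' \<gamma>' \<delta>' =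
    mat2 (\<alpha> * \<alpha>' + \<beta> * \<gamma>') (\<alpha> * \<beta>' + \<beta> * \<delta>') (\<gamma> * \<alpha>' + \<delta> * \<gamma>') (\<gamma> * \<beta>' + \<delta> * \<delta>')"
proof -
  have s: "{0..<2::nat} = {0, 1}" by auto
  show ?thesis by (rule eq_matI) (auto simp: mat2_def scalar_prod_def s)
qed

lemma mat2_one: "mat2 1 0 0 1 = (1\<^sub>m 2 :: 'b::comm_ring_1 mat)"
  by (rule eq_matI) (auto simp: mat2_def)

lemma shift_in_GL2: "mat2 1 \<beta> 0 1 \<in> GL2" "mat2 0 1 1 \<beta> \<in> GL2"
proof -
  show "mat2 1 \<beta> 0 1 \<in> GL2"
    by (rule mat_2_in_GL2[of _ "mat2 1 (-\<beta>) 0 1"]) (simp_all add: mat2_mult mat2_one, simp_all add: mat2_def)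
  show "mat2 0 1 1 \<beta> \<in> GL2"
    by (rule mat_2_in_GL2[of _ "mat2 (-\<beta>) 1 1 0"]) (simp_all add: mat2_mult mat2_one, simp_all add: mat2_def)
qed

lemma pcompose_sum_monoms: "pcompose f q = (\<Sum>j\<le>degree f. smult (coeff f j) (q ^ j))"
  for f :: "'b::comm_ring_1 poly"
proof -
  have "degree (map_poly (\<lambda>x. [:x:]) f) = degree f" by (rule degree_map_poly) simp
  then show ?thesis by (simp add: pcompose_altdef poly_altdef coeff_map_poly)
qed

lemma GL2_act_shift: "GL2_act (mat2 1 \<beta> 0 1) f = pcompose f [:\<beta>, 1:]"
  by (simp add: GL2_act_def pcompose_sum_monoms mat2_def one_pCons[symmetric])

lemma GL2_act_reflect_shift:
  assumes "coeff f 0 \<noteq> 0"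
  shows "GL2_act (mat2 0 1 1 \<beta>) f = pcompose (reflect_poly f) [:\<beta>, 1:]"
proof -
  have "pcompose (reflect_poly f) [:\<beta>, 1:] = (\<Sum>j\<le>degree f. smult (coeff f (degree f - j)) ([:\<beta>, 1:] ^ j))"
    using assms by (simp add: pcompose_sum_monoms coeff_reflect_poly)
  also have "\<dots> = (\<Sum>j\<le>degree f. smult (coeff f j) ([:\<beta>, 1:] ^ (degree f - j)))"
    by (rule sum.reindex_bij_witness[of _ "\<lambda>j. degree f - j" "\<lambda>j. degree f - j"]) auto
  finally show ?thesis by (simp add: GL2_act_def mat2_def one_pCons[symmetric])
qed

lemma irreducible_pcompose_shift:
  fixes f :: "'b::idom poly"
  assumes "irreducible f"
  shows "irreducible (pcompose f [:\<beta>, 1:])"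
proof -
  have inv: "pcompose (pcompose p [:\<gamma>, 1:]) [:-\<gamma>, 1:] = p" for p and \<gamma> :: 'b
  proof -
    have "pcompose [:\<gamma>, 1:] [:-\<gamma>, 1:] = [:0, 1:]" by (simp add: pcompose_pCons)
    then show ?thesis by (simp only: pcompose_assoc[symmetric] pcompose_idR)
  qed
  have unit: "pcompose p q dvd 1" if "p dvd 1" for p q :: "'b poly"
  proof -
    from that obtain r where "1 = p * r" by (rule dvdE)
    then have "pcompose 1 q = pcompose p q * pcompose r q" by (metis pcompose_mult)
    then show ?thesis by (metis dvdI pcompose_1)
  qed
  show ?thesis
  proof (rule Factorial_Ring.irreducibleI)
    show "pcompose f [:\<beta>, 1:] \<noteq> 0" using assms inv[of f \<beta>] by (auto simp: irreducible_def)
    show "\<not> pcompose f [:\<beta>, 1:] dvd 1"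
    proof
      assume "pcompose f [:\<beta>, 1:] dvd 1"
      then have "pcompose (pcompose f [:\<beta>, 1:]) [:-\<beta>, 1:] dvd 1" by (rule unit)
      then show False using assms unfolding inv by (simp add: Factorial_Ring.irreducible_def)
    qed
    fix p q assume "pcompose f [:\<beta>, 1:] = p * q"
    then have "f = pcompose p [:-\<beta>, 1:] * pcompose q [:-\<beta>, 1:]" using inv[of f \<beta>] by (simp add: pcompose_mult)
    then have "pcompose p [:-\<beta>, 1:] dvd 1 \<or> pcompose q [:-\<beta>, 1:] dvd 1"
      by (rule Factorial_Ring.irreducibleD[OF assms])
    moreover have "r dvd 1" if "pcompose r [:-\<beta>, 1:] dvd 1" for r
      using unit[OF that, of "[:\<beta>, 1:]"] inv[of r "-\<beta>"] by simp
    ultimately show "p dvd 1 \<or> q dvd 1" by blast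
  qed
qed

lemma irreducible_reflect:
  fixes f :: "'b::idom poly"
  assumes "irreducible f" "degree f \<ge> 2"
  shows "irreducible (reflect_poly f)"
proof (rule Factorial_Ring.irreducibleI)
  have f0: "coeff f 0 \<noteq> 0" by (rule irreducible_coeff_0_nz[OF assms])
  show "reflect_poly f \<noteq> 0" using assms by auto
  show "\<not> reflect_poly f dvd 1" using degree_unit_poly[of "reflect_poly f"] f0 assms by auto
  fix p q assume pq: "reflect_poly f = p * q"
  have "coeff (reflect_poly f) 0 \<noteq> 0" using assms by auto
  then have p0: "coeff p 0 \<noteq> 0" and q0: "coeff q 0 \<noteq> 0" unfolding pq by (auto simp: coeff_mult)
  have "f = reflect_poly p * reflect_poly q" using f0 pq by (metis reflect_poly_mult reflect_poly_reflect_poly)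
  then have "reflect_poly p dvd 1 \<or> reflect_poly q dvd 1" by (rule Factorial_Ring.irreducibleD[OF assms(1)])
  moreover have "r dvd 1" if r: "reflect_poly r dvd 1" "coeff r 0 \<noteq> 0" for r :: "'b poly"
  proof -
    have "degree r = 0" using degree_unit_poly[OF r(1)] r(2) by simp
    then obtain c where "r = [:c:]" by (rule degree_eq_zeroE)
    then show ?thesis using r(1) by simp
  qed
  ultimately show "p dvd 1 \<or> q dvd 1" using p0 q0 by blast
qed

lemma GL2_equiv_shift:
  fixes f :: "'b::field poly poly"
  assumes "irreducible f" "degree f \<ge> 2"
  shows "GL2_equiv (pcompose f [:\<beta>, 1:]) f" "GL2_equiv (pcompose (reflect_poly f) [:\<beta>, 1:]) f"
proof -
  have f0: "coeff f 0 \<noteq> 0" by (rule irreducible_coeff_0_nz[OF assms])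
  show "GL2_equiv (pcompose f [:\<beta>, 1:]) f"
    unfolding GL2_equiv_def
    using assms irreducible_pcompose_shift[OF assms(1), of \<beta>] shift_in_GL2(1)[of \<beta>] GL2_act_shift[of \<beta> f]
    by (auto simp: degree_pcompose intro!: bexI[of _ "mat2 1 \<beta> 0 1"])
  show "GL2_equiv (pcompose (reflect_poly f) [:\<beta>, 1:]) f"
    unfolding GL2_equiv_def
    using assms f0 irreducible_pcompose_shift[OF irreducible_reflect[OF assms], of \<beta>] shift_in_GL2(2)[of \<beta>]
      GL2_act_reflect_shift[of f \<beta>]
    by (auto simp: degree_pcompose intro!: bexI[of _ "mat2 0 1 1 \<beta>"])
qed

lemma orbit_min_eq_iff:
  fixes f :: "'b::field poly poly"
  assumes "irreducible f" "degree f \<ge> 2" "\<And>g. n g \<ge> 0"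
  shows "n f = orbit_min n f \<longleftrightarrow> (\<forall>g. GL2_equiv g f \<longrightarrow> n f \<le> n g)"
proof -
  have refl: "GL2_equiv f f" using GL2_equiv_shift(1)[OF assms(1,2), of 0] unfolding pcompose_idR .
  let ?S = "{n g |g. GL2_equiv g f}"
  have bdd: "bdd_below ?S" using assms(3) by (intro bdd_belowI[of _ 0]) auto
  have in_S: "n f \<in> ?S" using refl by blast
  show ?thesis unfolding orbit_min_def
  proof
    assume "n f = Inf ?S"
    then show "\<forall>g. GL2_equiv g f \<longrightarrow> n f \<le> n g" using cInf_lower[OF _ bdd] by auto
  next
    assume "\<forall>g. GL2_equiv g f \<longrightarrow> n f \<le> n g"
    then have "n f \<le> Inf ?S" using in_S by (intro cInf_greatest) auto
    moreover have "Inf ?S \<le> n f" by (rule cInf_lower[OF in_S bdd])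
    ultimately show "n f = Inf ?S" by simp
  qed
qed

lemma deg_x_ge: "a_deg g \<le> deg_x g" "b_deg g \<le> deg_x g"
  unfolding deg_x_def a_deg_def b_deg_def by (auto intro!: Max_ge)

text \<open>
The leading and constant coefficients of \<open>g\<close> are values of the form at the columns \<open>(\<alpha>, \<gamma>)\<close> and \<open>(\<beta>, \<delta>)\<close>. No column is 0,
so both degrees are at least \<open>min a b\<close>; no row is 0, so one of them is at least \<open>max a b\<close>.
\<close>

lemma orbit_lower_bounds:
  fixes f :: "'b::field poly poly"
  assumes d: "degree f \<ge> 2"
    and slope: "one_slope f"
    and ndvd: "\<not> int (degree f) dvd int (degree (coeff f 0)) - int (degree (lead_coeff f))"
    and f0: "coeff f 0 \<noteq> 0" and g: "GL2_equiv g f"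
  shows "degree g = degree f" "coeff g 0 \<noteq> 0"
    "min (a_deg f) (b_deg f) \<le> min (a_deg g) (b_deg g)"
    "max (a_deg f) (b_deg f) \<le> max (a_deg g) (b_deg g)"
proof -
  obtain A where A: "A \<in> GL2" "g = GL2_act A f" using g by (auto simp: GL2_equiv_def)
  note nz = GL2_rows_columns[OF A(1)]
  note act = GL2_act_coeffs[of A f, folded A(2)]
  have d0: "degree f > 0" using d by simp
  note F = form_degree[OF d0 slope ndvd f0]
  have "coeff g (degree f) \<noteq> 0" using F(1)[OF nz(1)] act(2) by simp
  then show dg: "degree g = degree f" using act(1) le_degree by (metis antisym)
  show "coeff g 0 \<noteq> 0" using F(1)[OF nz(2)] act(3) by simp
  have bg: "b_deg g = degree (form f (A $$ (0,0)) (A $$ (1,0)))" using act(2) dg by (simp add: b_deg_def)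
  have ag: "a_deg g = degree (form f (A $$ (0,1)) (A $$ (1,1)))" using act(3) by (simp add: a_deg_def)
  note B = F(2,3)[OF nz(1), folded bg a_deg_def b_deg_def]
  note C = F(2,3)[OF nz(2), folded ag a_deg_def b_deg_def]
  show "min (a_deg f) (b_deg f) \<le> min (a_deg g) (b_deg g)" using B C nz(1,2) by auto
  show "max (a_deg f) (b_deg f) \<le> max (a_deg g) (b_deg g)" using B C nz(3,4) by (auto simp: max_def)
qed

lemma one_slope_deg_x:
  fixes f :: "'b::zero poly poly"
  assumes d: "degree f > 0"
    and slope: "one_slope f"
  shows "deg_x f = max (a_deg f) (b_deg f)"
proof -
  have "degree (coeff f k) \<le> max (a_deg f) (b_deg f)" if "k \<le> degree f" for k
  proof -
    have "degree f * degree (coeff f k) \<le> k * max (a_deg f) (b_deg f) + (degree f - k) * max (a_deg f) (b_deg f)"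
      using one_slopeD[OF slope that] by (rule order_trans) (auto intro!: add_mono mult_left_mono simp: a_deg_def b_deg_def)
    also have "\<dots> = degree f * max (a_deg f) (b_deg f)" using that by (simp flip: add_mult_distrib)
    finally show ?thesis using d by simp
  qed
  then have "deg_x f \<le> max (a_deg f) (b_deg f)" unfolding deg_x_def by (subst Max_le_iff) auto
  then show ?thesis using deg_x_ge[of f] by simp
qed

lemma one_slope_area:
  fixes f :: "'b::zero poly poly"
  assumes d: "degree f > 0" and f0: "coeff f 0 \<noteq> 0"
    and slope: "one_slope f"
  shows "newton_area f = real (degree f) * (real (a_deg f) + real (b_deg f)) / 2"
proof (rule antisym)
  show "newton_area f \<le> real (degree f) * (real (a_deg f) + real (b_deg f)) / 2"
  proof (rule newton_area_upper[OF d])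
    fix j assume j: "j \<le> degree f"
    have "real (degree f * degree (coeff f j)) \<le> real (j * degree (lead_coeff f) + (degree f - j) * degree (coeff f 0))"
      using one_slopeD[OF slope j] by (simp only: of_nat_le_iff)
    also have "\<dots> = real j * real (degree (lead_coeff f)) + (real (degree f) - real j) * real (degree (coeff f 0))"
      using j by (simp add: of_nat_diff)
    finally have "real (degree f) * real (degree (coeff f j)) \<le>
        real j * real (degree (lead_coeff f)) + (real (degree f) - real j) * real (degree (coeff f 0))"
      by simp
    then show "real (degree f) * real (degree (coeff f j)) \<le>
        real (a_deg f) * (real (degree f) - real j) + real (b_deg f) * real j"
      by (simp only: a_deg_def b_deg_def mult.commute add.commute)
  qed auto
qed (rule newton_area_lower[OF d f0])

text \<open>
Exponents are integers, so points strictly below the edge of integral slope satisfy an inequality with a defect of 1; they lie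
in the trapezoid whose lower right corner is moved to the left by 1.
\<close>

lemma reduced_invariants:
  fixes h :: "'b::zero poly poly"
  assumes d: "degree h > 0" and h0: "coeff h 0 \<noteq> 0" and lead: "degree (lead_coeff h) = b"
    and red: "\<And>k. k < degree h \<Longrightarrow> coeff h k \<noteq> 0 \<Longrightarrow> degree (coeff h k) < b + (degree h - k) * m"
  shows "newton_area h < real (degree h) * real (2 * b + degree h * m) / 2"
    and "a_deg h < b + degree h * m"
    and "m > 0 \<Longrightarrow> deg_x h < b + degree h * m"
proof -
  define n where "n = degree h"
  have n0: "n > 0" using d by (simp add: n_def)
  show a: "a_deg h < b + degree h * m" using red[OF d h0] by (simp add: a_deg_def)
  have "newton_area h \<le> real (degree h) * ((real (b + n * m) - 1) + real b) / 2"
  proof (rule newton_area_upper[OF d])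
    have "1 \<le> b + n * m" using a by (simp add: n_def)
    then have "real 1 \<le> real (b + n * m)" by (simp only: of_nat_le_iff)
    then show "0 \<le> real (b + n * m) - 1" by simp
    fix j assume j: "j \<le> degree h" and nz: "coeff h j \<noteq> 0"
    show "real (degree h) * real (degree (coeff h j)) \<le>
        (real (b + n * m) - 1) * (real (degree h) - real j) + real b * real j"
    proof (cases "j = degree h")
      case True then show ?thesis using lead by (simp add: mult.commute)
    next
      case False
      then have "degree (coeff h j) + 1 \<le> b + (n - j) * m" using red[of j] j nz by (simp add: n_def)
      then have "real (degree (coeff h j) + 1) \<le> real (b + (n - j) * m)" by (simp only: of_nat_le_iff)
      then have "real (degree (coeff h j)) \<le> real b + (real n - real j) * real m - 1"
        using j by (simp add: n_def of_nat_diff)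
      then have "real n * real (degree (coeff h j)) \<le> real n * (real b + (real n - real j) * real m - 1)"
        by (intro mult_left_mono) auto
      also have "\<dots> \<le> (real (b + n * m) - 1) * (real n - real j) + real b * real j"
        by (simp add: algebra_simps)
      finally show ?thesis by (simp add: n_def)
    qed
  qed simp
  also have "\<dots> < real (degree h) * real (2 * b + degree h * m) / 2"
    using d by (simp add: n_def)
  finally show "newton_area h < real (degree h) * real (2 * b + degree h * m) / 2" .
  show "deg_x h < b + degree h * m" if m: "m > 0"
  proof -
    have "e < b + degree h * m" if "e \<in> (\<lambda>j. degree (coeff h j)) ` {..degree h}" for e
    proof -
      from that obtain j where j: "j \<le> degree h" "e = degree (coeff h j)" by auto
      show ?thesis
      proof (cases "j = degree h")
        case True then show ?thesis using j lead d m by simp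
      next
        case False
        show ?thesis
        proof (cases "coeff h j = 0")
          case True
          then have "e = 0" using j by simp
          then show ?thesis using a by linarith
        next
          case nz: False
          have "e < b + (degree h - j) * m" using red[of j] nz False j by simp
          also have "b + (degree h - j) * m \<le> b + degree h * m" by simp
          finally show ?thesis .
        qed
      qed
    qed
    then show ?thesis unfolding deg_x_def by (subst Max_less_iff) auto
  qed
qed

text \<open>
If \<open>d\<close> divides \<open>a - b\<close>, the common leading term of the roots, or of their reciprocals when \<open>b > a\<close>, can be translated away.
For \<open>m > 0\<close> this lowers the degree in \<open>x\<close>; for \<open>m = 0\<close>, that is \<open>a = b\<close>, it lowers \<open>c\<close>.
\<close>

lemma exists_reduction:
  fixes f :: "'a::{alg_closed_field, field_char_0} poly poly"
  assumes f: "minimal_poly2 f" "degree f \<ge> 2"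
    and dvd: "max (a_deg f) (b_deg f) = min (a_deg f) (b_deg f) + degree f * m"
  obtains h where "GL2_equiv h f" "newton_area h < real (degree f) * (real (a_deg f) + real (b_deg f)) / 2"
    "deg_x h < max (a_deg f) (b_deg f) \<or> c_deg h < c_deg f"
proof -
  have irr: "irreducible f" using f by (simp add: minimal_poly2_def)
  have f0: "coeff f 0 \<noteq> 0" by (rule irreducible_coeff_0_nz[OF irr f(2)])
  define b where "b = min (a_deg f) (b_deg f)"
  have "\<exists>h. GL2_equiv h f \<and> degree h = degree f \<and> degree (lead_coeff h) = b \<and>
      (\<forall>k<degree f. coeff h k \<noteq> 0 \<longrightarrow> degree (coeff h k) < b + (degree f - k) * m)"
  proof (cases "b_deg f \<le> a_deg f")
    case True
    then have b: "b = degree (lead_coeff f)" and "degree (coeff f 0) = degree (lead_coeff f) + degree f * m"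
      using dvd by (auto simp: a_deg_def b_deg_def b_def)
    then obtain \<beta> where "\<forall>k<degree f. coeff (pcompose f [:\<beta>, 1:]) k \<noteq> 0 \<longrightarrow>
        degree (coeff (pcompose f [:\<beta>, 1:]) k) < degree (lead_coeff f) + (degree f - k) * m"
      using minimal_newton_polygon(2)[OF f] by blast
    then show ?thesis using GL2_equiv_shift(1)[OF irr f(2), of \<beta>] b lead_coeff_comp[of "[:\<beta>, 1:]" f]
      by (intro exI[of _ "pcompose f [:\<beta>, 1:]"]) (simp add: degree_pcompose)
  next
    case False
    then have b: "b = degree (coeff f 0)" and "degree (lead_coeff f) = degree (coeff f 0) + degree f * m"
      using dvd by (auto simp: a_deg_def b_deg_def b_def)
    then obtain \<beta> where "\<forall>k<degree f. coeff (pcompose (reflect_poly f) [:\<beta>, 1:]) k \<noteq> 0 \<longrightarrow>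
        degree (coeff (pcompose (reflect_poly f) [:\<beta>, 1:]) k) < degree (coeff f 0) + (degree f - k) * m"
      using minimal_newton_polygon(3)[OF f] by blast
    moreover have "coeff (reflect_poly f) (degree f) = coeff f 0" by (simp add: coeff_reflect_poly)
    ultimately show ?thesis
      using GL2_equiv_shift(2)[OF irr f(2), of \<beta>] b lead_coeff_comp[of "[:\<beta>, 1:]" "reflect_poly f"] f0
      by (intro exI[of _ "pcompose (reflect_poly f) [:\<beta>, 1:]"]) (simp add: degree_pcompose)
  qed
  then obtain h where h: "GL2_equiv h f" "degree h = degree f" "degree (lead_coeff h) = b"
    and red: "\<And>k. k < degree h \<Longrightarrow> coeff h k \<noteq> 0 \<Longrightarrow> degree (coeff h k) < b + (degree h - k) * m" by auto
  have h0: "coeff h 0 \<noteq> 0" using h(1) f(2) by (intro irreducible_coeff_0_nz) (auto simp: GL2_equiv_def)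
  have dh: "degree h > 0" using h(2) f(2) by simp
  note R = reduced_invariants[OF dh h0 h(3) red, unfolded h(2)]
  have sum: "a_deg f + b_deg f = 2 * b + degree f * m"
    using dvd unfolding b_def by (auto simp: max_def min_def split: if_splits)
  show ?thesis
  proof (rule that[OF h(1)])
    show "newton_area h < real (degree f) * (real (a_deg f) + real (b_deg f)) / 2"
      using R(1) unfolding of_nat_add[symmetric] sum .
    show "deg_x h < max (a_deg f) (b_deg f) \<or> c_deg h < c_deg f"
    proof (cases "m = 0")
      case True
      then have "c_deg h < b" using R(2) by (simp add: c_deg_def min_less_iff_disj)
      moreover have "c_deg f = b" by (simp add: c_deg_def b_def)
      ultimately show ?thesis by simp
    next
      case False
      then show ?thesis using R(3) dvd by (simp add: b_def)
    qed
  qed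
qed

theorem theorem4p3:
  fixes f :: "'a :: {alg_closed_field, field_char_0} poly poly"
  assumes "minimal_poly2 f"
    and "degree f \<ge> 2"
  shows "(newton_area f = orbit_min newton_area f \<longleftrightarrow>
            real (deg_x f) = orbit_min (\<lambda>g. real (deg_x g)) f \<and>
            real (c_deg f) = orbit_min (\<lambda>g. real (c_deg g)) f) \<and>
         (real (deg_x f) = orbit_min (\<lambda>g. real (deg_x g)) f \<and>
            real (c_deg f) = orbit_min (\<lambda>g. real (c_deg g)) f \<longleftrightarrow>
            \<not> int (degree f) dvd int (deg_x f) - int (c_deg f))"
proof -
  have irr: "irreducible f" using assms by (simp add: minimal_poly2_def)
  have d0: "degree f > 0" using assms by simp
  have f0: "coeff f 0 \<noteq> 0" by (rule irreducible_coeff_0_nz[OF irr assms(2)])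
  have slope: "one_slope f" using minimal_newton_polygon(1)[OF assms] by (simp add: one_slope_def)
  note area = one_slope_area[OF d0 f0 slope] and dx = one_slope_deg_x[OF d0 slope]
  have area_min: "newton_area f = orbit_min newton_area f \<longleftrightarrow> (\<forall>g. GL2_equiv g f \<longrightarrow> newton_area f \<le> newton_area g)"
    by (rule orbit_min_eq_iff[OF irr assms(2)]) (simp add: newton_area_def)
  have dx_min: "real (deg_x f) = orbit_min (\<lambda>g. real (deg_x g)) f \<longleftrightarrow> (\<forall>g. GL2_equiv g f \<longrightarrow> deg_x f \<le> deg_x g)"
    using orbit_min_eq_iff[OF irr assms(2), of "\<lambda>g. real (deg_x g)"] by simp
  have c_min: "real (c_deg f) = orbit_min (\<lambda>g. real (c_deg g)) f \<longleftrightarrow> (\<forall>g. GL2_equiv g f \<longrightarrow> c_deg f \<le> c_deg g)"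
    using orbit_min_eq_iff[OF irr assms(2), of "\<lambda>g. real (c_deg g)"] by simp
  show ?thesis
  proof (cases "int (degree f) dvd int (deg_x f) - int (c_deg f)")
    case False
    have "\<not> int (degree f) dvd int (degree (coeff f 0)) - int (degree (lead_coeff f))"
    proof
      assume "int (degree f) dvd int (degree (coeff f 0)) - int (degree (lead_coeff f))"
      then have 1: "int (degree f) dvd int (a_deg f) - int (b_deg f)" by (simp add: a_deg_def b_deg_def)
      then have "int (degree f) dvd int (b_deg f) - int (a_deg f)" by (metis dvd_minus_iff minus_diff_eq)
      then show False using 1 False by (auto simp: dx c_deg_def max_def min_def split: if_splits)
    qed
    note low = orbit_lower_bounds[OF assms(2) slope this f0]
    have "deg_x f \<le> deg_x g \<and> c_deg f \<le> c_deg g \<and> newton_area f \<le> newton_area g" if g: "GL2_equiv g f" for g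
    proof (intro conjI)
      show "deg_x f \<le> deg_x g" using low(4)[OF g] deg_x_ge[of g] dx by linarith
      show "c_deg f \<le> c_deg g" using low(3)[OF g] by (simp add: c_deg_def)
      have "a_deg f + b_deg f \<le> a_deg g + b_deg g" using low(3,4)[OF g] by (auto simp: min_def max_def split: if_splits)
      then have "real (a_deg f) + real (b_deg f) \<le> real (a_deg g) + real (b_deg g)" by linarith
      then have "newton_area f \<le> real (degree g) * (real (a_deg g) + real (b_deg g)) / 2"
        unfolding area low(1)[OF g] by (intro divide_right_mono mult_left_mono) auto
      also have "\<dots> \<le> newton_area g" using low(1,2)[OF g] d0 by (intro newton_area_lower) auto
      finally show "newton_area f \<le> newton_area g" .
    qed
    then show ?thesis using False area_min dx_min c_min by blast
  next
    case True
    then obtain k where k: "int (deg_x f) - int (c_deg f) = int (degree f) * k" by (rule dvdE)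
    have "c_deg f \<le> deg_x f" by (simp add: dx c_deg_def)
    then have "k \<ge> 0" using k d0 by (metis diff_ge_0_iff_ge of_nat_0_less_iff of_nat_le_iff zero_le_mult_iff not_le)
    then have "int (max (a_deg f) (b_deg f)) = int (min (a_deg f) (b_deg f) + degree f * nat k)"
      using k by (simp add: dx c_deg_def)
    then have "max (a_deg f) (b_deg f) = min (a_deg f) (b_deg f) + degree f * nat k" by (simp only: of_nat_eq_iff)
    then obtain h where "GL2_equiv h f" "newton_area h < newton_area f" "deg_x h < deg_x f \<or> c_deg h < c_deg f"
      using exists_reduction[OF assms] area dx by metis
    then show ?thesis using True area_min dx_min c_min by (meson not_le)
  qed
qed

end
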